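(* Let $W_0:\mathbb{R}^d\times\mathcal{P}_2(\mathbb{R}^d)\to\mathbb{R}^d$ and $F,G:\mathbb{R}^d\times\mathcal{P}_2(\mathbb{R}^d)\times\mathbb{R}^d\to\mathbb{R}^d$ be continuous. Assume: (1) (linear growth) there is a constant $C$ such that for all $(x,\mu,u)$, $|W_0(x,\mu)|+|F(x,\mu,u)|+|G(x,\mu,u)|\le C(1+|x|+|u|+\sqrt{E_2(\mu)})$; (2) (monotonicity) for all $X,Y,U,V\in\mathcal{H}$, $\langle \tilde W_0(X)-\tilde W_0(Y),X-Y\rangle\ge 0$ and $\langle \tilde F(X,U)-\tilde F(Y,V),U-V\rangle+\langle\tilde G(X,U)-\tilde G(Y,V),X-Y\rangle\ge 0$. Then there is at most one monotone solution $W$ on $[0,T]$ of $$\partial_t W+F(x,m,W)\cdot\nabla_xW+\int_{\mathbb{R}^d}F(y,m,W(t,y,m))\cdot D_mW(t,x,m)(y)\,m(dy)=G(x,m,W)$$ in $(0,T)\times\mathbb{R}^d\times\mathcal{P}_2(\mathbb{R}^d)$ with initial condition $W(0,x,m)=W_0(x,m)$. Moreover, if such a solution $W$ exists, it is $L^2$-monotone: for every $t\in[0,T]$ and all $X,Y\in\mathcal{H}$, $\langle \tilde W(t,X)-\tilde W(t,Y),X-Y\rangle\ge 0$.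
   Context: Fix $d\ge1$, $T>0$ and a sufficiently rich probability space $(\Omega,\mathcal{A},\mathbb{P})$ (supporting a collection of independent Brownian motions). $\mathcal{H}=L^2(\Omega,\mathbb{R}^d)$ with $\langle X,Y\rangle=\mathbb{E}[X\cdot Y]$ and norm $\|\cdot\|$; $\mathcal{L}(X)$ is the law of $X$; $\mathcal{P}_2(\mathbb{R}^d)$ carries the Wasserstein distance $\mathcal{W}_2$; $E_q(\mu)=\int|y|^q\mu(dy)$ and $E_q(X)=\mathbb{E}|X|^q$. Lifts: $\tilde W_0(X)=W_0(X,\mathcal{L}(X))$, $\tilde W(t,X)=W(t,X,\mathcal{L}(X))$, $\tilde F(X,U)=F(X,\mathcal{L}(X),U)$, $\tilde G(X,U)=G(X,\mathcal{L}(X),U)$. $D_m$ is the Wasserstein derivative (it plays no role in the definition of monotone solution). Test functions: $H^{\mathcal{H}}_{test}$ is the set of functions $\psi(t,X)=\varphi(t)+\langle h,X\rangle-\alpha e^{\lambda t}E_4(X)$ on $[0,T)\times\mathcal{H}$ with $\varphi$ bounded in $C^1([0,\tau],\mathbb{R})$ for every $\tau<T$, $h\in\mathcal{H}$, $\alpha,\lambda>0$ (value $-\infty$ if $E_4(X)=\infty$). For $X\in L^4(\Omega,\mathbb{R}^d)$ and $A\in\mathcal{H}$ with $|X|^2X\cdot A\in L^1$, $A\cdot\nabla_X\psi(t,X)=\langle h,A\rangle-4\alpha e^{\lambda t}\mathbb{E}[|X|^2X\cdot A]$. Monotone solution: a continuous $W:[0,T]\times\mathbb{R}^d\times\mathcal{P}_2(\mathbb{R}^d)\to\mathbb{R}^d$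 with linear growth ($|W(t,x,\mu)|\le C(1+|x|+\sqrt{E_2(\mu)})$ for some $C$) is a monotone solution of the equation (with coefficients $(F,G)$) if for all $Y,V\in\mathcal{H}$, all $\psi\in H^{\mathcal{H}}_{test}$ and every $(t^*,X^* )\in(0,T)\times L^4(\Omega,\mathbb{R}^d)$ which is a point of minimum of $(t,X)\mapsto\langle\tilde W(t,X)-V,X-Y\rangle-\psi(t,X)$, writing $W^*=\tilde W(t^*,X^* )$, $$\partial_t\psi(t^*,X^* )+\tilde F(X^*,W^* )\cdot\nabla_X\psi(t^*,X^* )\ge\langle\tilde F(X^*,W^* ),W^*-V\rangle+\langle\tilde G(X^*,W^* ),X^*-Y\rangle.$$ It has initial condition $W_0$ if $W(0,\cdot,\cdot)=W_0$. *)

theory Defs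
  imports "HOL-Probability.Probability"
begin

section \<open>Sufficiently rich probability spaces\<close>

definition brownian_motion :: "'w measure \<Rightarrow> (real \<Rightarrow> 'w \<Rightarrow> real) \<Rightarrow> bool" where
  "brownian_motion M B \<longleftrightarrow>
     (\<forall>t\<ge>0. B t \<in> borel_measurable M) \<and>
     (AE \<omega> in M. B 0 \<omega> = 0) \<and>
     (AE \<omega> in M. continuous_on {0..} (\<lambda>t. B t \<omega>)) \<and>
     (\<forall>s t. 0 \<le> s \<and> s < t \<longrightarrow>
        distributed M lborel (\<lambda>\<omega>. B t \<omega> - B s \<omega>) (normal_density 0 (sqrt (t - s)))) \<and>
     (\<forall>(n::nat) \<tau>. 0 \<le> \<tau> 0 \<and> strict_mono \<tau> \<longrightarrow>
        prob_space.indep_vars M (\<lambda>_. borel) (\<lambda>k \<omega>. B (\<tau> (Suc k)) \<omega> - B (\<tau> k) \<omega>) {..<n})"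

text \<open>The processes are independent as random elements of the space of all functions on
  \<open>[0,\<infinity>)\<close> with its product sigma-algebra. A Brownian motion in \<open>\<real>\<^sup>d\<close> is \<open>d\<close> of these real ones.\<close>

definition indep_brownian_motions ::
    "'w measure \<Rightarrow> 'i set \<Rightarrow> ('i \<Rightarrow> real \<Rightarrow> 'w \<Rightarrow> real) \<Rightarrow> bool" where
  "indep_brownian_motions M I B \<longleftrightarrow>
     (\<forall>i\<in>I. brownian_motion M (B i)) \<and>
     prob_space.indep_vars M (\<lambda>_. PiM {0..} (\<lambda>_. borel)) (\<lambda>i \<omega>. \<lambda>t\<in>{0..}. B i t \<omega>) I"

section \<open>Square-integrable random variables\<close>

text \<open>Elements of \<open>L\<^sup>q\<close> are represented by functions; all notions below are invariant under
  almost sure equality.\<close>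

definition Lq :: "'w measure \<Rightarrow> nat \<Rightarrow> ('w \<Rightarrow> 'a::euclidean_space) set" where
  "Lq M q = {X \<in> borel_measurable M. integrable M (\<lambda>\<omega>. norm (X \<omega>) ^ q)}"

abbreviation hilb :: "'w measure \<Rightarrow> ('w \<Rightarrow> 'a::euclidean_space) set" where
  "hilb M \<equiv> Lq M 2"

definition ip :: "'w measure \<Rightarrow> ('w \<Rightarrow> 'a::euclidean_space) \<Rightarrow> ('w \<Rightarrow> 'a) \<Rightarrow> real" where
  "ip M X Y = (\<integral>\<omega>. X \<omega> \<bullet> Y \<omega> \<partial>M)"

definition emoment :: "'w measure \<Rightarrow> nat \<Rightarrow> ('w \<Rightarrow> 'a::euclidean_space) \<Rightarrow> ennreal" where
  "emoment M q X = (\<integral>\<^sup>+\<omega>. ennreal (norm (X \<omega>) ^ q) \<partial>M)"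

abbreviation law :: "'w measure \<Rightarrow> ('w \<Rightarrow> 'a::euclidean_space) \<Rightarrow> 'a measure" where
  "law M X \<equiv> distr M borel X"

section \<open>The Wasserstein space\<close>

definition P2 :: "'a::euclidean_space measure set" where
  "P2 = {\<mu>. prob_space \<mu> \<and> sets \<mu> = sets borel \<and> integrable \<mu> (\<lambda>y. norm y ^ 2)}"

definition E2 :: "'a::euclidean_space measure \<Rightarrow> real" where
  "E2 \<mu> = (\<integral>y. norm y ^ 2 \<partial>\<mu>)"

definition couplings ::
    "'a::euclidean_space measure \<Rightarrow> 'a measure \<Rightarrow> ('a \<times> 'a) measure set" where
  "couplings \<mu> \<nu> = {\<pi>. prob_space \<pi> \<and> sets \<pi> = sets (borel \<Otimes>\<^sub>M borel) \<and>
     distr \<pi> borel fst = \<mu> \<and> distr \<pi> borel snd = \<nu>}"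

definition W2 :: "'a::euclidean_space measure \<Rightarrow> 'a measure \<Rightarrow> real" where
  "W2 \<mu> \<nu> = sqrt (INF \<pi>\<in>couplings \<mu> \<nu>. \<integral>(x, y). norm (x - y) ^ 2 \<partial>\<pi>)"

text \<open>Joint continuity on \<open>S \<times> P2\<close> for the product of the metric of \<open>S\<close> and \<open>W2\<close>.\<close>

definition continuous_W2 ::
    "'s::metric_space set \<Rightarrow> ('s \<Rightarrow> 'a::euclidean_space measure \<Rightarrow> 'b::metric_space) \<Rightarrow> bool" where
  "continuous_W2 S f \<longleftrightarrow>
     (\<forall>z\<in>S. \<forall>\<mu>\<in>P2. \<forall>\<epsilon>>0. \<exists>\<delta>>0. \<forall>z'\<in>S. \<forall>\<nu>\<in>P2.
        dist z' z < \<delta> \<and> W2 \<nu> \<mu> < \<delta> \<longrightarrow> dist (f z' \<nu>) (f z \<mu>) < \<epsilon>)"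

section \<open>Lifts and monotonicity\<close>

definition lift ::
    "'w measure \<Rightarrow> ('a::euclidean_space \<Rightarrow> 'a measure \<Rightarrow> 'a) \<Rightarrow> ('w \<Rightarrow> 'a) \<Rightarrow> 'w \<Rightarrow> 'a" where
  "lift M w X = (\<lambda>\<omega>. w (X \<omega>) (law M X))"

definition lift2 ::
    "'w measure \<Rightarrow> ('a::euclidean_space \<Rightarrow> 'a measure \<Rightarrow> 'a \<Rightarrow> 'a) \<Rightarrow>
     ('w \<Rightarrow> 'a) \<Rightarrow> ('w \<Rightarrow> 'a) \<Rightarrow> 'w \<Rightarrow> 'a" where
  "lift2 M f X U = (\<lambda>\<omega>. f (X \<omega>) (law M X) (U \<omega>))"

definition L2_monotone ::
    "'w measure \<Rightarrow> ('a::euclidean_space \<Rightarrow> 'a measure \<Rightarrow> 'a) \<Rightarrow> bool" where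
  "L2_monotone M w \<longleftrightarrow>
     (\<forall>X\<in>hilb M. \<forall>Y\<in>hilb M. ip M (lift M w X - lift M w Y) (X - Y) \<ge> 0)"

definition jointly_L2_monotone ::
    "'w measure \<Rightarrow> ('a::euclidean_space \<Rightarrow> 'a measure \<Rightarrow> 'a \<Rightarrow> 'a) \<Rightarrow>
     ('a \<Rightarrow> 'a measure \<Rightarrow> 'a \<Rightarrow> 'a) \<Rightarrow> bool" where
  "jointly_L2_monotone M F G \<longleftrightarrow>
     (\<forall>X\<in>hilb M. \<forall>Y\<in>hilb M. \<forall>U\<in>hilb M. \<forall>V\<in>hilb M.
        ip M (lift2 M F X U - lift2 M F Y V) (U - V)
        + ip M (lift2 M G X U - lift2 M G Y V) (X - Y) \<ge> 0)"

section \<open>Test functions\<close>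

text \<open>Boundedness of \<open>\<phi>\<close> and \<open>\<phi>'\<close> on \<open>[0,\<tau>]\<close> is automatic by compactness.\<close>

definition C1_locally :: "real \<Rightarrow> (real \<Rightarrow> real) \<Rightarrow> bool" where
  "C1_locally T \<phi> \<longleftrightarrow>
     (\<forall>\<tau>. 0 < \<tau> \<and> \<tau> < T \<longrightarrow>
        (\<exists>\<phi>'. (\<forall>t\<in>{0..\<tau>}. (\<phi> has_real_derivative \<phi>' t) (at t within {0..\<tau>})) \<and>
              continuous_on {0..\<tau>} \<phi>'))"

definition test_fun ::
    "'w measure \<Rightarrow> (real \<Rightarrow> real) \<Rightarrow> ('w \<Rightarrow> 'a::euclidean_space) \<Rightarrow> real \<Rightarrow> real \<Rightarrow>
     real \<Rightarrow> ('w \<Rightarrow> 'a) \<Rightarrow> ereal" where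
  "test_fun M \<phi> h \<alpha> l t X =
     ereal (\<phi> t + ip M h X) - ereal (\<alpha> * exp (l * t)) * enn2ereal (emoment M 4 X)"

definition test_fun_dt ::
    "'w measure \<Rightarrow> (real \<Rightarrow> real) \<Rightarrow> ('w \<Rightarrow> 'a::euclidean_space) \<Rightarrow> real \<Rightarrow> real \<Rightarrow>
     real \<Rightarrow> ('w \<Rightarrow> 'a) \<Rightarrow> real" where
  "test_fun_dt M \<phi> h \<alpha> l t X = deriv (\<lambda>s. real_of_ereal (test_fun M \<phi> h \<alpha> l s X)) t"

text \<open>The derivative \<open>A \<cdot> \<nabla>\<^sub>X \<psi>(t,X)\<close> in the direction \<open>A\<close>.\<close>

definition test_fun_dX ::
    "'w measure \<Rightarrow> ('w \<Rightarrow> 'a::euclidean_space) \<Rightarrow> real \<Rightarrow> real \<Rightarrow>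
     real \<Rightarrow> ('w \<Rightarrow> 'a) \<Rightarrow> ('w \<Rightarrow> 'a) \<Rightarrow> real" where
  "test_fun_dX M h \<alpha> l t X A =
     ip M h A - 4 * \<alpha> * exp (l * t) * (\<integral>\<omega>. norm (X \<omega>) ^ 2 * (X \<omega> \<bullet> A \<omega>) \<partial>M)"

section \<open>Monotone solutions\<close>

text \<open>The minimum is global over \<open>[0,T) \<times> L\<^sup>2\<close>; the minimised function is \<open>\<infinity>\<close> where the fourth
  moment is infinite.\<close>

definition min_point ::
    "'w measure \<Rightarrow> real \<Rightarrow> (real \<Rightarrow> ('w \<Rightarrow> 'a::euclidean_space) \<Rightarrow> ereal) \<Rightarrow>
     real \<Rightarrow> ('w \<Rightarrow> 'a) \<Rightarrow> bool" where
  "min_point M T J t' X' \<longleftrightarrow> (\<forall>t\<in>{0..<T}. \<forall>X\<in>hilb M. J t' X' \<le> J t X)"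

definition monotone_solution ::
    "'w measure \<Rightarrow> real \<Rightarrow> ('a::euclidean_space \<Rightarrow> 'a measure \<Rightarrow> 'a \<Rightarrow> 'a) \<Rightarrow>
     ('a \<Rightarrow> 'a measure \<Rightarrow> 'a \<Rightarrow> 'a) \<Rightarrow> (real \<Rightarrow> 'a \<Rightarrow> 'a measure \<Rightarrow> 'a) \<Rightarrow> bool" where
  "monotone_solution M T F G W \<longleftrightarrow>
     continuous_W2 ({0..T} \<times> UNIV) (\<lambda>(t, x) \<mu>. W t x \<mu>) \<and>
     (\<exists>C. \<forall>t\<in>{0..T}. \<forall>x. \<forall>\<mu>\<in>P2. norm (W t x \<mu>) \<le> C * (1 + norm x + sqrt (E2 \<mu>))) \<and>
     (\<forall>Y\<in>hilb M. \<forall>V\<in>hilb M. \<forall>\<phi>. \<forall>h\<in>hilb M. \<forall>\<alpha>>0. \<forall>l>0. \<forall>t\<in>{0<..<T}. \<forall>X\<in>Lq M 4.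
        C1_locally T \<phi> \<longrightarrow>
        min_point M T
          (\<lambda>s Z. ereal (ip M (lift M (W s) Z - V) (Z - Y)) - test_fun M \<phi> h \<alpha> l s Z) t X \<longrightarrow>
        (let U = lift M (W t) X; A = lift2 M F X U; B = lift2 M G X U
         in test_fun_dt M \<phi> h \<alpha> l t X + test_fun_dX M h \<alpha> l t X A
              \<ge> ip M A (U - V) + ip M B (X - Y)))"

definition has_initial_condition ::
    "(real \<Rightarrow> 'a::euclidean_space \<Rightarrow> 'a measure \<Rightarrow> 'a) \<Rightarrow> ('a \<Rightarrow> 'a measure \<Rightarrow> 'a) \<Rightarrow> bool" where
  "has_initial_condition W W0 \<longleftrightarrow> (\<forall>x. \<forall>\<mu>\<in>P2. W 0 x \<mu> = W0 x \<mu>)"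

end

theory Submission
  imports Defs
begin

text \<open>
  For two monotone solutions \<open>W\<close>, \<open>V\<close> write \<open>gap M (W t) (V s) X Y\<close> for
  \<open>\<langle>W(t,X) - V(s,Y), X - Y\<rangle>\<close>. Everything follows from the claim that
  \<open>gap M (W t) (V t) X Y \<ge> 0\<close> for all \<open>t\<close>, \<open>X\<close>, \<open>Y\<close>. With \<open>V = W\<close> the claim is
  \<open>L\<^sup>2\<close>-monotonicity. With two different solutions, inserting \<open>Y = X + \<theta>(W(t,X) - V(t,X))\<close> and letting
  \<open>\<theta>\<close> decrease to \<open>0\<close> (Minty's argument) forces \<open>W(t,X) = V(t,X)\<close> almost surely.

  The claim is a comparison principle. Suppose it fails at some \<open>t\<^sub>0, X\<^sub>0, Y\<^sub>0\<close>. Neither field is assumed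
  differentiable, so time is doubled, and one minimises
  \<open>\<langle>W(t,X) - V(s,Y), X - Y\<rangle> + \<alpha> e\<^bsup>l(t+s)\<^esup> (E\<^sub>4(X) + E\<^sub>4(Y)) + \<delta>(t+s) + N(t-s)\<^sup>2
    + \<gamma>/(T-t) + \<gamma>/(T-s) + \<langle>h,X\<rangle> + \<langle>k,Y\<rangle>\<close>.
  Here \<open>E\<^sub>4\<close> is the fourth moment \<open>mom M 4\<close>. If a minimum is attained at positive times, then freezing
  \<open>(s,Y)\<close> turns it into a minimum of the kind tested in the definition for \<open>W\<close>, freezing \<open>(t,X)\<close> one for \<open>V\<close>. In the sum of the two resulting
  inequalities the terms in \<open>F\<close> and \<open>G\<close> are nonnegative by joint monotonicity and the contributions of
  \<open>N(t-s)\<^sup>2\<close> cancel, while \<open>l\<close> is so large that the time derivative of \<open>e\<^bsup>l(t+s)\<^esup>\<close> absorbs the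
  derivatives of the fourth moments along the flow (\<open>first_order_inequality\<close>). What remains is
  \<open>0 \<le> -2\<delta> + O(\<alpha>)\<close>, which is false for small \<open>\<alpha>\<close>. Two points need work.

  Existence of the minimum. Bounded sets of \<open>L\<^sup>2\<close> are not compact, and only linear perturbations
  \<open>\<langle>h,X\<rangle>\<close> are available in the test functions. Stegall's principle gives a minimum for arbitrarily small
  \<open>h\<close>, \<open>k\<close>, and in a Hilbert space it has a short proof (\<open>stegall_L2\<close>): if \<open>Z'\<close> almost minimises
  \<open>f - \<kappa>|Z|\<^sup>2\<close>, then \<open>f - 2\<kappa>\<langle>Z',Z\<rangle>\<close> is almost minimised only near \<open>Z'\<close>; iterating with rapidly
  decreasing \<open>\<kappa>\<close> gives a Cauchy sequence. The sequence converges so fast that it is dominated by one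
  square-integrable function, so all the continuity that is needed is dominated convergence (\<open>dom_conv\<close>).

  Excluding \<open>t = 0\<close> or \<open>s = 0\<close>. At a minimum with \<open>t = 0\<close> one has to compare \<open>V(s,Y)\<close> with
  \<open>V(0,Y)\<close> for a \<open>Y\<close> about which only a bound of the fourth moment is known, and continuity of \<open>V\<close> is not uniform
  over such \<open>Y\<close> without a compactness argument in Wasserstein space. The lemma \<open>initial_layer\<close> obtains the
  comparison \<open>gap M (W 0) (V s) X Y \<ge> -\<kappa>s - \<alpha>(E\<^sub>4(X) + E\<^sub>4(Y))\<close> from the equation itself: it is the same
  minimisation with \<open>t\<close> frozen at \<open>0\<close>, where a penalty \<open>\<kappa>s\<close> with large \<open>\<kappa>\<close> beats all bounded terms. For
  large \<open>N\<close> the term \<open>N s\<^sup>2\<close> then dominates \<open>\<kappa>s\<close> up to a small error.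

  Almost sure equality of the lifts becomes equality at every \<open>(t,x,\<mu>)\<close> because \<open>M\<close> carries a random
  variable with a continuous distribution, an increment of a Brownian motion. Hence every finitely supported law
  is realised on \<open>M\<close>, and it can be perturbed slightly so as to charge the point \<open>x\<close>; such laws are dense and
  both fields are continuous.
\<close>

section \<open>Square-integrable random variables and their laws\<close>

definition mom :: "'w measure \<Rightarrow> nat \<Rightarrow> ('w \<Rightarrow> 'a::euclidean_space) \<Rightarrow> real" where
  "mom M q X = (\<integral>\<omega>. norm (X \<omega>) ^ q \<partial>M)"

lemma mom_nonneg [simp]: "0 \<le> mom M q X"
  unfolding mom_def by (rule integral_nonneg_AE) auto

lemma Lq_measurable [measurable_dest]: "X \<in> Lq M q \<Longrightarrow> X \<in> borel_measurable M"
  by (auto simp: Lq_def)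

lemma Lq_integrable: "X \<in> Lq M q \<Longrightarrow> integrable M (\<lambda>\<omega>. norm (X \<omega>) ^ q)"
  by (auto simp: Lq_def)

lemma LqI:
  assumes "X \<in> borel_measurable M" and "integrable M g" and "\<And>\<omega>. norm (X \<omega>) ^ q \<le> g \<omega>"
  shows "X \<in> Lq M q"
proof -
  have "integrable M (\<lambda>\<omega>. norm (X \<omega>) ^ q)"
    by (rule Bochner_Integration.integrable_bound[OF assms(2)])
       (use assms in \<open>auto intro!: AE_I2 order_trans[OF assms(3)]\<close>)
  then show ?thesis using assms(1) by (auto simp: Lq_def)
qed

lemma inner_young: "\<bar>x \<bullet> y\<bar> \<le> (norm x ^ 2 + norm y ^ 2) / 2" for x y :: "'a::real_inner"
proof -
  have "\<bar>x \<bullet> y\<bar> \<le> norm x * norm y" by (rule Cauchy_Schwarz_ineq2)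
  also have "\<dots> \<le> (norm x ^ 2 + norm y ^ 2) / 2"
    using sum_squares_bound[of "norm x" "norm y"] by simp
  finally show ?thesis .
qed

lemma norm_add_sq: "norm (x + y) ^ 2 \<le> 2 * norm x ^ 2 + 2 * norm y ^ 2" for x y :: "'a::real_inner"
  using inner_young[of x y] by (simp add: power2_norm_eq_inner inner_add_left inner_add_right inner_commute)

lemma norm_diff_sq: "norm (x - y) ^ 2 \<le> 2 * norm x ^ 2 + 2 * norm y ^ 2" for x y :: "'a::real_inner"
  using norm_add_sq[of x "-y"] by simp

lemma hilb_add: "X \<in> hilb M \<Longrightarrow> Y \<in> hilb M \<Longrightarrow> (\<lambda>\<omega>. X \<omega> + Y \<omega>) \<in> hilb M"
  by (rule LqI[where g="\<lambda>\<omega>. 2 * norm (X \<omega>)^2 + 2 * norm (Y \<omega>)^2"])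
     (auto simp: Lq_def intro!: norm_add_sq)

lemma hilb_diff: "X \<in> hilb M \<Longrightarrow> Y \<in> hilb M \<Longrightarrow> X - Y \<in> hilb M"
  by (rule LqI[where g="\<lambda>\<omega>. 2 * norm (X \<omega>)^2 + 2 * norm (Y \<omega>)^2"])
     (auto simp: Lq_def fun_diff_def intro!: norm_diff_sq)

lemma hilb_scale: "X \<in> hilb M \<Longrightarrow> (\<lambda>\<omega>. c *\<^sub>R X \<omega>) \<in> hilb M"
  by (auto simp: Lq_def power_mult_distrib)

lemma Lq_zero: "(\<lambda>\<omega>. 0) \<in> Lq M q" if "q > 0"
  using that by (auto simp: Lq_def power_0_left)

lemma hilb_integrable_inner:
  assumes "X \<in> hilb M" "Y \<in> hilb M"
  shows "integrable M (\<lambda>\<omega>. X \<omega> \<bullet> Y \<omega>)"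
proof (rule Bochner_Integration.integrable_bound[where f="\<lambda>\<omega>. (norm (X \<omega>) ^ 2 + norm (Y \<omega>) ^ 2) / 2"])
  show "integrable M (\<lambda>\<omega>. (norm (X \<omega>) ^ 2 + norm (Y \<omega>) ^ 2) / 2)"
    using assms by (auto simp: Lq_def)
  show "(\<lambda>\<omega>. X \<omega> \<bullet> Y \<omega>) \<in> borel_measurable M"
    using assms by (auto simp: Lq_def)
  show "AE \<omega> in M. norm (X \<omega> \<bullet> Y \<omega>) \<le> norm ((norm (X \<omega>) ^ 2 + norm (Y \<omega>) ^ 2) / 2)"
    using inner_young by (intro AE_I2) (auto intro: order_trans[OF inner_young])
qed

lemma ip_bound:
  assumes "X \<in> hilb M" "Y \<in> hilb M"
  shows "\<bar>ip M X Y\<bar> \<le> (mom M 2 X + mom M 2 Y) / 2"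
proof -
  have "\<bar>ip M X Y\<bar> \<le> (\<integral>\<omega>. \<bar>X \<omega> \<bullet> Y \<omega>\<bar> \<partial>M)"
    unfolding ip_def by (rule integral_abs_bound)
  also have "\<dots> \<le> (\<integral>\<omega>. (norm (X \<omega>) ^ 2 + norm (Y \<omega>) ^ 2) / 2 \<partial>M)"
    using assms by (intro integral_mono integrable_abs hilb_integrable_inner inner_young) (auto simp: Lq_def)
  also have "\<dots> = (mom M 2 X + mom M 2 Y) / 2"
    using assms by (simp add: mom_def Lq_def)
  finally show ?thesis .
qed

lemma ip_commute: "ip M X Y = ip M Y X"
  by (simp add: ip_def inner_commute)

lemma ip_diff_diff_flip: "ip M (A - B) (X - Y) = ip M (B - A) (Y - X)"
  unfolding ip_def by (rule Bochner_Integration.integral_cong) (auto simp: inner_diff_left inner_diff_right)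

lemma ip_minus_left: "ip M (\<lambda>\<omega>. - X \<omega>) Y = - ip M X Y"
  by (simp add: ip_def)

context prob_space
begin

lemma L4_hilb: "X \<in> Lq M 4 \<Longrightarrow> X \<in> hilb M"
proof (rule LqI[where g="\<lambda>\<omega>. 1 + norm (X \<omega>) ^ 4"])
  fix \<omega>
  have "0 \<le> (norm (X \<omega>) ^ 2 - 1) ^ 2" by simp
  then have "2 * norm (X \<omega>) ^ 2 \<le> 1 + norm (X \<omega>) ^ 4"
    by (simp add: power2_diff power_mult[symmetric])
  then show "norm (X \<omega>) ^ 2 \<le> 1 + norm (X \<omega>) ^ 4"
    using zero_le_power[of "norm (X \<omega>)" 2] norm_ge_zero[of "X \<omega>"] by linarith
qed (auto simp: Lq_def)

lemma mom2_sq_le: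
  assumes "X \<in> Lq M 4"
  shows "(mom M 2 X)^2 \<le> mom M 4 X"
proof -
  let ?c = "mom M 2 X"
  have i: "integrable M (\<lambda>\<omega>. norm (X \<omega>) ^ 2)" "integrable M (\<lambda>\<omega>. norm (X \<omega>) ^ 4)"
    using assms L4_hilb[OF assms] by (auto simp: Lq_def)
  have "0 \<le> (\<integral>\<omega>. (norm (X \<omega>) ^ 2 - ?c)^2 \<partial>M)" by (rule integral_nonneg_AE) auto
  also have "(\<lambda>\<omega>. (norm (X \<omega>) ^ 2 - ?c)^2) = (\<lambda>\<omega>. norm (X \<omega>) ^ 4 - 2 * ?c * norm (X \<omega>) ^ 2 + ?c^2)"
    by (auto simp: power2_diff power_mult[symmetric])
  also have "(\<integral>\<omega>. norm (X \<omega>) ^ 4 - 2 * ?c * norm (X \<omega>) ^ 2 + ?c^2 \<partial>M) = mom M 4 X - 2 * ?c * ?c + ?c^2"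
    using i by (simp add: mom_def prob_space)
  finally show ?thesis by (simp add: power2_eq_square)
qed

text \<open>Quadratic growth costs only an arbitrarily small multiple of the fourth moment plus a constant. This is how
  the fourth moment in the test functions makes every functional below coercive.\<close>

lemma mom2_le_mom4:
  assumes "X \<in> Lq M 4" "\<theta> > 0"
  shows "mom M 2 X \<le> \<theta> * mom M 4 X + 1 / \<theta>"
proof -
  let ?c = "mom M 2 X"
  have "0 \<le> (\<theta> * ?c - 1)^2" by simp
  then have "2 * \<theta> * ?c \<le> \<theta>^2 * ?c^2 + 1" by (simp add: power2_diff power_mult_distrib)
  moreover have "\<theta> * ?c \<ge> 0" using assms by simp
  ultimately have "\<theta> * ?c \<le> \<theta>^2 * ?c^2 + 1" by linarith
  also have "\<dots> \<le> \<theta>^2 * mom M 4 X + 1" using mom2_sq_le[OF assms(1)] by (simp add: mult_left_mono)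
  also have "\<dots> = \<theta> * (\<theta> * mom M 4 X + 1 / \<theta>)"
    using assms by (simp add: power2_eq_square distrib_left mult.assoc)
  finally have "\<theta> * ?c \<le> \<theta> * (\<theta> * mom M 4 X + 1 / \<theta>)" .
  then show ?thesis using assms(2) by (simp only: mult_le_cancel_left_pos)
qed

lemma law_P2:
  assumes "X \<in> hilb M"
  shows "law M X \<in> P2" and "E2 (law M X) = mom M 2 X"
proof -
  have [measurable]: "X \<in> borel_measurable M" using assms by (auto simp: Lq_def)
  show "law M X \<in> P2"
    using assms unfolding P2_def
    by (auto simp: Lq_def integrable_distr_eq intro!: prob_space_distr)
  show "E2 (law M X) = mom M 2 X"
    by (simp add: E2_def mom_def integral_distr)
qed

text \<open>The joint law of \<open>X\<close> and \<open>Y\<close> is a coupling. Every estimate of a Wasserstein distance below comes from here.\<close>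

lemma W2_law_le:
  assumes "X \<in> hilb M" "Y \<in> hilb M"
  shows "W2 (law M X) (law M Y) \<le> sqrt (mom M 2 (X - Y))"
proof -
  have [measurable]: "X \<in> borel_measurable M" "Y \<in> borel_measurable M" using assms by (auto simp: Lq_def)
  let ?\<pi> = "distr M (borel \<Otimes>\<^sub>M borel) (\<lambda>\<omega>. (X \<omega>, Y \<omega>))"
  have "?\<pi> \<in> couplings (law M X) (law M Y)"
    unfolding couplings_def by (auto intro!: prob_space_distr simp: distr_distr comp_def)
  moreover have "bdd_below ((\<lambda>\<pi>. \<integral>(x, y). norm (x - y) ^ 2 \<partial>\<pi>) ` couplings (law M X) (law M Y))"
    by (rule bdd_belowI2[of _ 0]) (auto intro!: integral_nonneg_AE)
  ultimately have "(INF \<pi>\<in>couplings (law M X) (law M Y). \<integral>(x, y). norm (x - y) ^ 2 \<partial>\<pi>)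
      \<le> (\<integral>(x, y). norm (x - y) ^ 2 \<partial>?\<pi>)"
    by (rule cINF_lower[rotated])
  also have "(\<integral>(x, y). norm (x - y) ^ 2 \<partial>?\<pi>) = mom M 2 (X - Y)"
    by (subst integral_distr) (auto simp: mom_def split_beta')
  finally show ?thesis unfolding W2_def by (rule real_sqrt_le_mono)
qed

end

lemma P2_prob: "\<mu> \<in> P2 \<Longrightarrow> prob_space \<mu>" by (simp add: P2_def)

lemma id_hilb: "\<mu> \<in> P2 \<Longrightarrow> (\<lambda>x. x) \<in> hilb \<mu>"
  by (auto simp: P2_def Lq_def measurable_def space_borel sets_eq_imp_space_eq)

lemma law_id: "\<mu> \<in> P2 \<Longrightarrow> law \<mu> (\<lambda>x. x) = \<mu>"
  by (auto simp: P2_def intro!: distr_id2)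

text \<open>Apply the coupling bound to the identity, as a random variable on \<open>\<mu>\<close> itself.\<close>

lemma W2_refl: 
  assumes "\<mu> \<in> P2" shows "W2 \<mu> \<mu> \<le> 0"
proof -
  interpret prob_space \<mu> using assms by (rule P2_prob)
  show ?thesis using W2_law_le[OF id_hilb[OF assms] id_hilb[OF assms]]
    by (simp add: law_id[OF assms] mom_def)
qed

section \<open>Continuity of lifted vector fields under dominated convergence\<close>

text \<open>Almost sure convergence under one square-integrable bound. Lifts are continuous for this mode of
  convergence by the dominated convergence theorem alone, and it is closed under all the operations used below.\<close>

definition dom_conv :: "'w measure \<Rightarrow> (nat \<Rightarrow> 'w \<Rightarrow> 'a::euclidean_space) \<Rightarrow> ('w \<Rightarrow> 'a) \<Rightarrow> ('w \<Rightarrow> real) \<Rightarrow> bool" where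
  "dom_conv M X X' g \<longleftrightarrow> (\<forall>n. X n \<in> borel_measurable M) \<and> X' \<in> borel_measurable M \<and> g \<in> hilb M \<and>
     (\<forall>n. AE \<omega> in M. norm (X n \<omega>) \<le> g \<omega>) \<and> (AE \<omega> in M. (\<lambda>n. X n \<omega>) \<longlonglongrightarrow> X' \<omega>)"

lemma hilbI_AE:
  fixes X :: "'w \<Rightarrow> 'a::euclidean_space" and g :: "'w \<Rightarrow> real"
  assumes "X \<in> borel_measurable M" "g \<in> hilb M" "AE \<omega> in M. norm (X \<omega>) \<le> g \<omega>"
  shows "X \<in> hilb M" and "mom M 2 X \<le> mom M 2 g"
proof -
  have b: "AE \<omega> in M. norm (X \<omega>) ^ 2 \<le> norm (g \<omega>) ^ 2"
    using assms(3) by eventually_elim (auto intro!: power_mono)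
  have i: "integrable M (\<lambda>\<omega>. norm (X \<omega>) ^ 2)"
    by (rule Bochner_Integration.integrable_bound[OF Lq_integrable[OF assms(2)]])
       (use assms b in auto)
  then show "X \<in> hilb M" using assms by (auto simp: Lq_def)
  show "mom M 2 X \<le> mom M 2 g" unfolding mom_def
    by (rule integral_mono_AE[OF i Lq_integrable[OF assms(2)] b])
qed

lemma dom_convD:
  assumes "dom_conv M X X' g"
  shows "X n \<in> borel_measurable M" "X' \<in> borel_measurable M" "g \<in> hilb M"
    "AE \<omega> in M. norm (X n \<omega>) \<le> g \<omega>" "AE \<omega> in M. (\<lambda>n. X n \<omega>) \<longlonglongrightarrow> X' \<omega>"
    "AE \<omega> in M. norm (X' \<omega>) \<le> g \<omega>"
proof -
  show *: "X n \<in> borel_measurable M" "X' \<in> borel_measurable M" "g \<in> hilb M"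
    "AE \<omega> in M. norm (X n \<omega>) \<le> g \<omega>" "AE \<omega> in M. (\<lambda>n. X n \<omega>) \<longlonglongrightarrow> X' \<omega>" for n
    using assms by (auto simp: dom_conv_def)
  have "AE \<omega> in M. \<forall>n. norm (X n \<omega>) \<le> g \<omega>" using assms by (auto simp: dom_conv_def AE_all_countable)
  with *(5) show "AE \<omega> in M. norm (X' \<omega>) \<le> g \<omega>"
    by eventually_elim (rule Lim_bounded[OF tendsto_norm], auto)
qed

lemma dom_conv_hilb:
  assumes "dom_conv M X X' g"
  shows "X n \<in> hilb M" "X' \<in> hilb M" "mom M 2 (X n) \<le> mom M 2 g" "mom M 2 X' \<le> mom M 2 g"
  by (rule hilbI_AE(1)[OF dom_convD(1,3,4)[OF assms]])
     (rule hilbI_AE(1)[OF dom_convD(2,3,6)[OF assms]] hilbI_AE(2)[OF dom_convD(1,3,4)[OF assms]]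
        hilbI_AE(2)[OF dom_convD(2,3,6)[OF assms]])+

lemma dom_conv_subseq:
  assumes "dom_conv M X X' g" "strict_mono r"
  shows "dom_conv M (\<lambda>n. X (r n)) X' g"
proof -
  have "AE \<omega> in M. (\<lambda>n. X (r n) \<omega>) \<longlonglongrightarrow> X' \<omega>"
    using dom_convD(5)[OF assms(1)]
    by eventually_elim (use LIMSEQ_subseq_LIMSEQ[OF _ assms(2)] in \<open>auto simp: comp_def\<close>)
  then show ?thesis using assms(1) unfolding dom_conv_def by blast
qed

lemma dom_conv_const: "X \<in> hilb M \<Longrightarrow> dom_conv M (\<lambda>n. X) X (\<lambda>\<omega>. norm (X \<omega>))"
  by (auto simp: dom_conv_def Lq_def)

lemma dom_conv_diff:
  assumes "dom_conv M X X' g" "dom_conv M Y Y' k"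
  shows "dom_conv M (\<lambda>n. X n - Y n) (X' - Y') (\<lambda>\<omega>. g \<omega> + k \<omega>)"
proof -
  have "AE \<omega> in M. norm (X n \<omega> - Y n \<omega>) \<le> g \<omega> + k \<omega>" for n
    using dom_convD(4)[OF assms(1), of n] dom_convD(4)[OF assms(2), of n]
    by eventually_elim (intro norm_triangle_le_diff add_mono)
  moreover have "AE \<omega> in M. (\<lambda>n. X n \<omega> - Y n \<omega>) \<longlonglongrightarrow> X' \<omega> - Y' \<omega>"
    using dom_convD(5)[OF assms(1)] dom_convD(5)[OF assms(2)]
    by eventually_elim (rule tendsto_diff)
  ultimately show ?thesis
    unfolding dom_conv_def fun_diff_def
    using borel_measurable_diff[OF dom_convD(1)[OF assms(1)] dom_convD(1)[OF assms(2)]]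
      borel_measurable_diff[OF dom_convD(2)[OF assms(1)] dom_convD(2)[OF assms(2)]]
      hilb_add[OF dom_convD(3)[OF assms(1)] dom_convD(3)[OF assms(2)]] by blast
qed

lemma dom_conv_ip:
  assumes "dom_conv M X X' g" "dom_conv M Y Y' k"
  shows "(\<lambda>n. ip M (X n) (Y n)) \<longlonglongrightarrow> ip M X' Y'"
  unfolding ip_def
proof (rule integral_dominated_convergence[where w="\<lambda>\<omega>. (norm (g \<omega>) ^ 2 + norm (k \<omega>) ^ 2) / 2"])
  note [measurable] = dom_convD(1,2)[OF assms(1)] dom_convD(1,2)[OF assms(2)]
  show "(\<lambda>\<omega>. X' \<omega> \<bullet> Y' \<omega>) \<in> borel_measurable M" by measurable
  show "(\<lambda>\<omega>. X n \<omega> \<bullet> Y n \<omega>) \<in> borel_measurable M" for n by measurable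
  show "integrable M (\<lambda>\<omega>. (norm (g \<omega>) ^ 2 + norm (k \<omega>) ^ 2) / 2)"
    using dom_convD(3)[OF assms(1)] dom_convD(3)[OF assms(2)] by (auto simp: Lq_def)
  show "AE \<omega> in M. (\<lambda>n. X n \<omega> \<bullet> Y n \<omega>) \<longlonglongrightarrow> X' \<omega> \<bullet> Y' \<omega>"
    using dom_convD(5)[OF assms(1)] dom_convD(5)[OF assms(2)]
    by eventually_elim (rule tendsto_inner)
  show "AE \<omega> in M. norm (X n \<omega> \<bullet> Y n \<omega>) \<le> (norm (g \<omega>) ^ 2 + norm (k \<omega>) ^ 2) / 2" for n
    using dom_convD(4)[OF assms(1), of n] dom_convD(4)[OF assms(2), of n]
  proof eventually_elim
    case (elim \<omega>)
    have "norm (X n \<omega>)^2 \<le> norm (g \<omega>)^2" "norm (Y n \<omega>)^2 \<le> norm (k \<omega>)^2"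
      using elim by (auto intro!: power_mono)
    then show ?case using inner_young[of "X n \<omega>" "Y n \<omega>"] unfolding real_norm_def by argo
  qed
qed

lemma mom2_eq_ip: "mom M 2 X = ip M X X"
  by (simp add: mom_def ip_def power2_norm_eq_inner)

lemma dom_conv_mom2_diff:
  assumes "dom_conv M X X' g"
  shows "(\<lambda>n. mom M 2 (X n - X')) \<longlonglongrightarrow> 0"
proof -
  have "dom_conv M (\<lambda>n. X n - X') (X' - X') (\<lambda>\<omega>. g \<omega> + norm (X' \<omega>))"
    by (intro dom_conv_diff assms dom_conv_const dom_conv_hilb(2)[OF assms])
  from dom_conv_ip[OF this this] show ?thesis
    by (simp add: mom2_eq_ip) (simp add: ip_def)
qed

text \<open>The part of the definition of a monotone solution that does not refer to test functions, with the growth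
  constant made explicit so that it can be shared by two solutions.\<close>

definition regular_field :: "real \<Rightarrow> real \<Rightarrow> (real \<Rightarrow> 'a::euclidean_space \<Rightarrow> 'a measure \<Rightarrow> 'a) \<Rightarrow> bool" where
  "regular_field L T W \<longleftrightarrow> 0 \<le> L \<and> continuous_W2 ({0..T} \<times> UNIV) (\<lambda>(t, x) \<mu>. W t x \<mu>) \<and>
     (\<forall>t\<in>{0..T}. \<forall>x. \<forall>\<mu>\<in>P2. norm (W t x \<mu>) \<le> L * (1 + norm x + sqrt (E2 \<mu>)))"

lemma regular_fieldD:
  assumes "regular_field L T W"
  shows "0 \<le> L" and "continuous_W2 ({0..T} \<times> UNIV) (\<lambda>(t, x) \<mu>. W t x \<mu>)"
    and "t \<in> {0..T} \<Longrightarrow> \<mu> \<in> P2 \<Longrightarrow> norm (W t x \<mu>) \<le> L * (1 + norm x + sqrt (E2 \<mu>))"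
  using assms by (auto simp: regular_field_def)

lemma continuous_W2_seq:
  assumes "continuous_W2 S f" "z \<in> S" "\<mu> \<in> P2" "\<And>n. z' n \<in> S" "\<And>n. \<nu> n \<in> P2"
    and "z' \<longlonglongrightarrow> z" "\<And>n. W2 (\<nu> n) \<mu> \<le> d n" "d \<longlonglongrightarrow> (0::real)"
  shows "(\<lambda>n. f (z' n) (\<nu> n)) \<longlonglongrightarrow> f z \<mu>"
proof (rule metric_LIMSEQ_I)
  fix e :: real assume "e > 0"
  then obtain \<delta> where \<delta>: "\<delta> > 0"
    "\<And>z' \<nu>. z' \<in> S \<Longrightarrow> \<nu> \<in> P2 \<Longrightarrow> dist z' z < \<delta> \<Longrightarrow> W2 \<nu> \<mu> < \<delta> \<Longrightarrow> dist (f z' \<nu>) (f z \<mu>) < e"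
    using assms(1-3) unfolding continuous_W2_def by meson
  have "\<forall>\<^sub>F n in sequentially. dist (z' n) z < \<delta>" using assms(6) \<delta>(1) by (rule tendstoD)
  moreover have "\<forall>\<^sub>F n in sequentially. d n < \<delta>" using assms(8) \<delta>(1) by (rule order_tendstoD)
  ultimately have "\<forall>\<^sub>F n in sequentially. dist (f (z' n) (\<nu> n)) (f z \<mu>) < e"
    by eventually_elim (intro \<delta>(2) assms(4,5) order_le_less_trans[OF assms(7)])
  then show "\<exists>N. \<forall>n\<ge>N. dist (f (z' n) (\<nu> n)) (f z \<mu>) < e"
    by (simp add: eventually_sequentially)
qed

lemma continuous_W2_section:
  assumes "continuous_W2 S f" "\<mu> \<in> P2"
  shows "continuous_on S (\<lambda>z. f z \<mu>)"
  unfolding continuous_on_sequentially comp_def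
proof (intro ballI allI impI)
  fix x :: "nat \<Rightarrow> 'a" and z assume "z \<in> S" "(\<forall>n. x n \<in> S) \<and> x \<longlonglongrightarrow> z"
  then show "(\<lambda>n. f (x n) \<mu>) \<longlonglongrightarrow> f z \<mu>"
    using continuous_W2_seq[OF assms(1) _ assms(2), of z x "\<lambda>_. \<mu>" "\<lambda>_. 0"] assms(2) W2_refl by auto
qed

lemma sq_sum3: "(1 + a + b)^2 \<le> 3 * (1 + a^2 + b^2)" for a b :: real
proof -
  have "0 \<le> (1 - a)^2 + (1 - b)^2 + (a - b)^2" by simp
  then show ?thesis by (simp add: power2_eq_square algebra_simps)
qed

context prob_space
begin

lemma const_Lq: "(\<lambda>\<omega>. c) \<in> Lq M q"
  by (auto simp: Lq_def)

lemma growth_hilb: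
  assumes "g \<in> hilb M" shows "(\<lambda>\<omega>. L * (1 + norm (g \<omega>) + c)) \<in> hilb M"
proof -
  have "(\<lambda>\<omega>. (1 + c) + norm (g \<omega>)) \<in> hilb M"
    using assms by (intro hilb_add const_Lq) (auto simp: Lq_def)
  from hilb_scale[OF this, of L] show ?thesis by (simp add: ac_simps)
qed

lemma lift_measurable:
  assumes "regular_field L T W" "t \<in> {0..T}" "X \<in> hilb M"
  shows "lift M (W t) X \<in> borel_measurable M"
proof -
  have "continuous_on ({0..T} \<times> UNIV) (\<lambda>(t,x). W t x (law M X))"
    using continuous_W2_section[OF regular_fieldD(2)[OF assms(1)] law_P2(1)[OF assms(3)]]
    by (simp add: split_beta')
  then have "continuous_on UNIV (\<lambda>x. (\<lambda>(t,x). W t x (law M X)) (t,x))"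
    by (rule continuous_on_compose2) (use assms(2) in \<open>auto intro!: continuous_intros\<close>)
  then have "(\<lambda>x. W t x (law M X)) \<in> borel_measurable borel"
    by (simp add: borel_measurable_continuous_onI)
  then show ?thesis unfolding lift_def using Lq_measurable[OF assms(3)] by measurable
qed

lemma lift_norm_le:
  assumes "regular_field L T W" "t \<in> {0..T}" "X \<in> hilb M"
  shows "norm (lift M (W t) X \<omega>) \<le> L * (1 + norm (X \<omega>) + sqrt (mom M 2 X))"
  using regular_fieldD(3)[OF assms(1,2) law_P2(1)[OF assms(3)], of "X \<omega>"] law_P2(2)[OF assms(3)]
  by (simp add: lift_def)

text \<open>Linear growth in \<open>x\<close> and in the second moment of the law becomes linear growth in \<open>L\<^sup>2\<close>.\<close>

lemma mom2_growth:
  assumes X: "X \<in> hilb M" and A: "A \<in> borel_measurable M"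
    and le: "\<And>\<omega>. norm (A \<omega>) \<le> L * (1 + norm (X \<omega>) + sqrt (mom M 2 X))"
  shows "A \<in> hilb M" "mom M 2 A \<le> 6 * L^2 * (1 + mom M 2 X)"
proof -
  have le2: "norm (A \<omega>) ^ 2 \<le> 3 * L^2 * (1 + norm (X \<omega>)^2 + mom M 2 X)" for \<omega>
  proof -
    have "norm (A \<omega>) ^ 2 \<le> (L * (1 + norm (X \<omega>) + sqrt (mom M 2 X)))^2"
      using le by (rule power_mono) simp
    also have "\<dots> = L^2 * (1 + norm (X \<omega>) + sqrt (mom M 2 X))^2" by (simp add: power_mult_distrib)
    also have "\<dots> \<le> L^2 * (3 * (1 + norm (X \<omega>)^2 + (sqrt (mom M 2 X))^2))"
      by (intro mult_left_mono sq_sum3) auto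
    finally show ?thesis by (simp add: algebra_simps)
  qed
  have i: "integrable M (\<lambda>\<omega>. norm (X \<omega>)^2)" using X by (rule Lq_integrable)
  show Ah: "A \<in> hilb M" by (rule LqI[OF A _ le2]) (use i in auto)
  have "mom M 2 A \<le> (\<integral>\<omega>. 3 * L^2 * (1 + norm (X \<omega>)^2 + mom M 2 X) \<partial>M)"
    unfolding mom_def[of M 2 A] by (intro integral_mono Lq_integrable[OF Ah] le2) (use i in auto)
  also have "\<dots> = 3 * L^2 * (1 + 2 * mom M 2 X)"
    using i by (simp add: mom_def prob_space)
  also have "\<dots> \<le> 3 * L^2 * (2 + 2 * mom M 2 X)" by (intro mult_left_mono) auto
  finally show "mom M 2 A \<le> 6 * L^2 * (1 + mom M 2 X)" by (simp add: algebra_simps)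
qed

lemma lift_hilb:
  assumes "regular_field L T W" "t \<in> {0..T}" "X \<in> hilb M"
  shows "lift M (W t) X \<in> hilb M" "mom M 2 (lift M (W t) X) \<le> 6 * L^2 * (1 + mom M 2 X)"
  using mom2_growth[OF assms(3) lift_measurable[OF assms] lift_norm_le[OF assms]] by auto

text \<open>Dominated convergence gives \<open>L\<^sup>2\<close> convergence, hence convergence of the laws, so the joint continuity of
  \<open>W\<close> applies at almost every \<open>\<omega>\<close>; linear growth turns the bound of the arguments into a bound of the values.\<close>

lemma dom_conv_lift:
  assumes W: "regular_field L T W" and t: "\<And>n. t n \<in> {0..T}" "t \<longlonglongrightarrow> t'" and X: "dom_conv M X X' g"
  shows "dom_conv M (\<lambda>n. lift M (W (t n)) (X n)) (lift M (W t') X')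
           (\<lambda>\<omega>. L * (1 + norm (g \<omega>) + sqrt (mom M 2 g)))"
proof -
  have t': "t' \<in> {0..T}" using closed_sequentially[OF closed_real_atLeastAtMost] t by blast
  note h = dom_conv_hilb[OF X]
  have "(\<lambda>n. sqrt (mom M 2 (X n - X'))) \<longlonglongrightarrow> sqrt 0"
    by (intro tendsto_real_sqrt dom_conv_mom2_diff[OF X])
  then have d: "(\<lambda>n. sqrt (mom M 2 (X n - X'))) \<longlonglongrightarrow> 0" by simp
  have "AE \<omega> in M. (\<lambda>n. lift M (W (t n)) (X n) \<omega>) \<longlonglongrightarrow> lift M (W t') X' \<omega>"
    using dom_convD(5)[OF X]
  proof eventually_elim
    case (elim \<omega>)
    have "(\<lambda>n. (t n, X n \<omega>)) \<longlonglongrightarrow> (t', X' \<omega>)" by (intro tendsto_Pair t elim)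
    from continuous_W2_seq[OF regular_fieldD(2)[OF W] _ law_P2(1)[OF h(2)] _ law_P2(1)[OF h(1)] this
        W2_law_le[OF h(1,2)] d] t t'
    show ?case by (simp add: lift_def)
  qed
  moreover have "AE \<omega> in M. norm (lift M (W (t n)) (X n) \<omega>) \<le> L * (1 + norm (g \<omega>) + sqrt (mom M 2 g))" for n
    using dom_convD(4)[OF X, of n]
  proof eventually_elim
    case (elim \<omega>)
    have "norm (lift M (W (t n)) (X n) \<omega>) \<le> L * (1 + norm (X n \<omega>) + sqrt (mom M 2 (X n)))"
      by (rule lift_norm_le[OF W t(1) h(1)])
    also have "\<dots> \<le> L * (1 + norm (g \<omega>) + sqrt (mom M 2 g))"
      using elim h(3)[of n] by (intro mult_left_mono add_mono regular_fieldD(1)[OF W]) auto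
    finally show ?case .
  qed
  ultimately show ?thesis
    unfolding dom_conv_def
    using lift_measurable[OF W t(1) h(1)] lift_measurable[OF W t' h(2)] growth_hilb[OF dom_convD(3)[OF X]]
    by auto
qed

lemma ip_lift_tendsto:
  assumes "regular_field L T W" "regular_field L' T V"
    and "\<And>n. t n \<in> {0..T}" "t \<longlonglongrightarrow> t'" "\<And>n. s n \<in> {0..T}" "s \<longlonglongrightarrow> s'"
    and X: "dom_conv M X X' g" and Y: "dom_conv M Y Y' k"
  shows "(\<lambda>n. ip M (lift M (W (t n)) (X n) - lift M (V (s n)) (Y n)) (X n - Y n))
    \<longlonglongrightarrow> ip M (lift M (W t') X' - lift M (V s') Y') (X' - Y')"
  by (rule dom_conv_ip[OF dom_conv_diff[OF dom_conv_lift[OF assms(1,3,4) X]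
        dom_conv_lift[OF assms(2,5,6) Y]] dom_conv_diff[OF X Y]])

end

section \<open>A variational principle with linear perturbations\<close>

lemma mom2_diff:
  assumes "X \<in> hilb M" "Y \<in> hilb M"
  shows "mom M 2 (X - Y) = mom M 2 X - 2 * ip M Y X + mom M 2 Y"
proof -
  have "mom M 2 (X - Y) = (\<integral>\<omega>. (X \<omega> \<bullet> X \<omega> - 2 * (Y \<omega> \<bullet> X \<omega>)) + Y \<omega> \<bullet> Y \<omega> \<partial>M)"
    unfolding mom2_eq_ip ip_def
    by (rule Bochner_Integration.integral_cong)
       (auto simp: inner_diff_left inner_diff_right inner_commute)
  also have "\<dots> = mom M 2 X - 2 * ip M Y X + mom M 2 Y"
    using hilb_integrable_inner[OF assms(1) assms(1)] hilb_integrable_inner[OF assms(2) assms(2)]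
      hilb_integrable_inner[OF assms(2) assms(1)]
    by (simp add: mom2_eq_ip ip_def)
  finally show ?thesis .
qed

lemma mom2_diff_le:
  assumes "X \<in> hilb M" "Y \<in> hilb M"
  shows "mom M 2 (X - Y) \<le> 2 * mom M 2 X + 2 * mom M 2 Y"
  using ip_bound[OF assms] mom2_diff[OF assms] by (simp add: ip_commute abs_le_iff)

lemma ip_diff_scale_left:
  assumes "X \<in> hilb M" "Y \<in> hilb M" "Z \<in> hilb M"
  shows "ip M (\<lambda>\<omega>. X \<omega> - c *\<^sub>R Y \<omega>) Z = ip M X Z - c * ip M Y Z"
  using hilb_integrable_inner[OF assms(1,3)] hilb_integrable_inner[OF assms(2,3)]
  by (simp add: ip_def inner_diff_left)

text \<open>Completeness of \<open>L\<^sup>2\<close> with a dominating function. By the rate of decay, the sum \<open>S\<close> of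
  \<open>4\<^sup>n |Z\<^sub>n\<^sub>+\<^sub>1 - Z\<^sub>n|\<^sup>2\<close> is integrable, and pointwise \<open>|Z\<^sub>n\<^sub>+\<^sub>1 - Z\<^sub>n| \<le> 2\<^sup>-\<^sup>n S\<^sup>1\<^sup>/\<^sup>2\<close>. Summing, the sequence
  converges and is bounded by \<open>|Z\<^sub>0| + 2 S\<^sup>1\<^sup>/\<^sup>2\<close>.\<close>

lemma fast_Cauchy_dom_conv:
  fixes Z :: "nat \<Rightarrow> 'w \<Rightarrow> 'a::euclidean_space"
  assumes Z: "\<And>n. Z n \<in> hilb M" and C: "\<And>n. mom M 2 (Z (Suc n) - Z n) \<le> C / 16 ^ n"
  obtains Z' g where "dom_conv M Z Z' g" "mom M 2 g \<le> 2 * mom M 2 (Z 0) + 16 * C"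
proof -
  have [measurable]: "Z n \<in> borel_measurable M" for n using Z by (rule Lq_measurable)
  define u where "u n \<omega> = 4 ^ n * norm (Z (Suc n) \<omega> - Z n \<omega>) ^ 2" for n \<omega>
  have C0: "0 \<le> C" using order_trans[OF mom_nonneg C[of 0]] by simp
  have um [measurable]: "u n \<in> borel_measurable M" for n unfolding u_def by measurable
  have u0: "0 \<le> u n \<omega>" for n \<omega> by (simp add: u_def)
  have ui: "integrable M (u n)" for n
    using hilb_diff[OF Z[of "Suc n"] Z[of n]] unfolding u_def by (auto simp: Lq_def)
  have uI: "(\<integral>\<omega>. u n \<omega> \<partial>M) \<le> C * (1/4) ^ n" for n
  proof -
    have "(\<integral>\<omega>. u n \<omega> \<partial>M) = 4 ^ n * mom M 2 (Z (Suc n) - Z n)" by (simp add: u_def mom_def)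
    also have "\<dots> \<le> 4 ^ n * (C / 16 ^ n)" by (intro mult_left_mono C) auto
    also have "\<dots> = C * (4 ^ n / 16 ^ n)" by simp
    also have "(4::real) ^ n / 16 ^ n = (1/4) ^ n" by (simp flip: power_divide)
    finally show ?thesis .
  qed
  have geo: "(\<lambda>n. C * (1/4) ^ n) sums (C * (4/3))"
    using sums_mult[OF geometric_sums[of "1/4::real"], of C] by simp
  have sumI: "summable (\<lambda>n. \<integral>\<omega>. u n \<omega> \<partial>M)"
    by (rule summable_comparison_test'[OF sums_summable[OF geo], of 0]) (use uI in \<open>auto intro!: integral_nonneg_AE simp: u0\<close>)
  have "(\<integral>\<^sup>+\<omega>. (\<Sum>n. ennreal (u n \<omega>)) \<partial>M) = (\<Sum>n. \<integral>\<^sup>+\<omega>. ennreal (u n \<omega>) \<partial>M)"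
    by (rule nn_integral_suminf) measurable
  also have "\<dots> = (\<Sum>n. ennreal (\<integral>\<omega>. u n \<omega> \<partial>M))"
    by (intro suminf_cong nn_integral_eq_integral ui) (simp add: u0)
  also have "\<dots> = ennreal (\<Sum>n. \<integral>\<omega>. u n \<omega> \<partial>M)"
    by (rule suminf_ennreal2) (use sumI in \<open>auto intro!: integral_nonneg_AE simp: u0\<close>)
  finally have "(\<integral>\<^sup>+\<omega>. (\<Sum>n. ennreal (u n \<omega>)) \<partial>M) \<noteq> \<infinity>" by simp
  then have "AE \<omega> in M. (\<Sum>n. ennreal (u n \<omega>)) \<noteq> \<infinity>"
    by (intro nn_integral_PInf_AE) measurable
  then have us: "AE \<omega> in M. summable (\<lambda>n. u n \<omega>)"
    by eventually_elim (rule summable_suminf_not_top, auto simp: u0)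
  define S where "S \<omega> = (\<Sum>n. u n \<omega>)" for \<omega>
  have Sm [measurable]: "S \<in> borel_measurable M" unfolding S_def by measurable
  have us': "AE \<omega> in M. summable (\<lambda>n. norm (u n \<omega>))" using us by (simp add: u0)
  have sumI': "summable (\<lambda>n. \<integral>\<omega>. norm (u n \<omega>) \<partial>M)" using sumI by (simp add: u0)
  have Si: "integrable M S" unfolding S_def by (rule integrable_suminf[OF ui us' sumI'])
  have "(\<integral>\<omega>. S \<omega> \<partial>M) = (\<Sum>n. \<integral>\<omega>. u n \<omega> \<partial>M)"
    unfolding S_def by (rule integral_suminf[OF ui us' sumI'])
  also have "\<dots> \<le> (\<Sum>n. C * (1/4) ^ n)"
    by (intro suminf_le uI sumI sums_summable[OF geo])
  also have "\<dots> = C * (4/3)" using geo by (rule sums_unique[symmetric])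
  finally have SI: "(\<integral>\<omega>. S \<omega> \<partial>M) \<le> 2 * C" using C0 by simp
  have S0: "AE \<omega> in M. 0 \<le> S \<omega>"
    using us unfolding S_def by eventually_elim (intro suminf_nonneg u0)
  have SI': "(\<integral>\<omega>. \<bar>S \<omega>\<bar> \<partial>M) \<le> 2 * C"
  proof -
    have "(\<integral>\<omega>. \<bar>S \<omega>\<bar> \<partial>M) = (\<integral>\<omega>. S \<omega> \<partial>M)"
      by (rule integral_cong_AE) (use S0 in auto)
    then show ?thesis using SI by simp
  qed
  define g where "g \<omega> = norm (Z 0 \<omega>) + 2 * sqrt \<bar>S \<omega>\<bar>" for \<omega>
  have gm [measurable]: "g \<in> borel_measurable M" unfolding g_def by measurable
  have gle: "norm (g \<omega>) ^ 2 \<le> 2 * norm (Z 0 \<omega>) ^ 2 + 8 * \<bar>S \<omega>\<bar>" for \<omega>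
    using norm_add_sq[of "norm (Z 0 \<omega>)" "2 * sqrt \<bar>S \<omega>\<bar>"]
    by (simp add: g_def power_mult_distrib)
  have gi: "integrable M (\<lambda>\<omega>. 2 * norm (Z 0 \<omega>) ^ 2 + 8 * \<bar>S \<omega>\<bar>)"
    using Si Lq_integrable[OF Z[of 0]] by simp
  have g: "g \<in> hilb M" by (rule LqI[OF gm gi gle])
  have "mom M 2 g \<le> (\<integral>\<omega>. 2 * norm (Z 0 \<omega>) ^ 2 + 8 * \<bar>S \<omega>\<bar> \<partial>M)"
    unfolding mom_def[of M 2 g] by (intro integral_mono Lq_integrable[OF g] gi gle)
  also have "\<dots> = 2 * mom M 2 (Z 0) + 8 * (\<integral>\<omega>. \<bar>S \<omega>\<bar> \<partial>M)"
    using Si Lq_integrable[OF Z[of 0]] by (simp add: mom_def)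
  finally have g_mom: "mom M 2 g \<le> 2 * mom M 2 (Z 0) + 16 * C" using SI' by simp
  have key: "AE \<omega> in M. (\<forall>n. norm (Z n \<omega>) \<le> g \<omega>) \<and> convergent (\<lambda>n. Z n \<omega>)"
    using us
  proof eventually_elim
    case (elim \<omega>)
    let ?d = "\<lambda>n. Z (Suc n) \<omega> - Z n \<omega>" and ?q = "sqrt \<bar>S \<omega>\<bar>"
    have d: "norm (?d n) \<le> ?q * (1/2) ^ n" for n
    proof -
      have "(2 ^ n * norm (?d n)) ^ 2 = u n \<omega>"
        by (simp add: u_def power_mult_distrib power_mult[symmetric] mult.commute[of n 2])
           (simp add: power_mult)
      also have "\<dots> \<le> S \<omega>"
        using sum_le_suminf[OF elim, of "{n}"] u0 by (simp add: S_def)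
      finally have "2 ^ n * norm (?d n) \<le> ?q"
        by (intro real_le_rsqrt) simp
      then show ?thesis by (simp add: field_simps power_divide)
    qed
    have tel: "Z n \<omega> = Z 0 \<omega> + (\<Sum>i<n. ?d i)" for n
      using sum_lessThan_telescope[of "\<lambda>i. Z i \<omega>" n] by simp
    have geo2: "summable (\<lambda>n. ?q * (1/2) ^ n)" "(\<Sum>n. ?q * (1/2::real) ^ n) = ?q * 2"
      using sums_mult[OF geometric_sums[of "1/2::real"], of ?q]
      by (auto simp: sums_iff)
    have "norm (Z n \<omega>) \<le> g \<omega>" for n
    proof -
      have "norm (\<Sum>i<n. ?d i) \<le> (\<Sum>i<n. ?q * (1/2) ^ i)" by (rule sum_norm_le) (rule d)
      also have "\<dots> \<le> (\<Sum>i. ?q * (1/2::real) ^ i)" by (rule sum_le_suminf[OF geo2(1)]) auto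
      finally have "norm (\<Sum>i<n. ?d i) \<le> 2 * ?q" using geo2(2) by simp
      then show ?thesis unfolding g_def by (subst tel) (intro norm_triangle_le add_left_mono)
    qed
    moreover have "convergent (\<lambda>n. Z 0 \<omega> + (\<Sum>i<n. ?d i))"
    proof -
      have "summable ?d" by (rule summable_comparison_test'[OF geo2(1), of 0]) (use d in auto)
      then have "convergent (\<lambda>n. \<Sum>i<n. ?d i)" by (simp add: summable_iff_convergent)
      then show ?thesis by (simp add: convergent_add_const_iff)
    qed
    ultimately show ?case by (simp only: tel[symmetric]) simp
  qed
  have "dom_conv M Z (\<lambda>\<omega>. lim (\<lambda>n. Z n \<omega>)) g"
    unfolding dom_conv_def using g key by (auto simp: convergent_LIMSEQ_iff)
  then show ?thesis using g_mom by (rule that)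
qed

lemma dom_conv_weighted_sums:
  assumes Z: "dom_conv M Z Z' g" and \<kappa>: "\<And>n. 0 \<le> \<kappa> n" "\<And>n. \<kappa> n \<le> c * (1/2) ^ n"
  obtains H' where "dom_conv M (\<lambda>n \<omega>. \<Sum>j<n. \<kappa> j *\<^sub>R Z j \<omega>) H' (\<lambda>\<omega>. (2 * c) *\<^sub>R g \<omega>)"
proof -
  note [measurable] = dom_convD(1)[OF Z]
  have all: "AE \<omega> in M. \<forall>n. norm (Z n \<omega>) \<le> g \<omega>"
    using dom_convD(4)[OF Z] by (simp add: AE_all_countable)
  have key: "AE \<omega> in M. (\<forall>n. norm (\<Sum>j<n. \<kappa> j *\<^sub>R Z j \<omega>) \<le> 2 * c * g \<omega>) \<and> convergent (\<lambda>n. \<Sum>j<n. \<kappa> j *\<^sub>R Z j \<omega>)"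
    using all
  proof eventually_elim
    case (elim \<omega>)
    have g0: "0 \<le> g \<omega>" using elim[rule_format, of 0] norm_ge_zero order_trans by blast
    have t: "norm (\<kappa> j *\<^sub>R Z j \<omega>) \<le> (c * g \<omega>) * (1/2) ^ j" for j
    proof -
      have "norm (\<kappa> j *\<^sub>R Z j \<omega>) = \<kappa> j * norm (Z j \<omega>)" using \<kappa>(1) by simp
      also have "\<dots> \<le> (c * (1/2) ^ j) * g \<omega>"
        using elim \<kappa>(2)[of j] order_trans[OF \<kappa>(1) \<kappa>(2), of j] by (intro mult_mono) auto
      finally show ?thesis by (simp add: mult_ac)
    qed
    have geo2: "summable (\<lambda>n. (c * g \<omega>) * (1/2) ^ n)" "(\<Sum>n. (c * g \<omega>) * (1/2::real) ^ n) = 2 * c * g \<omega>"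
      using sums_mult[OF geometric_sums[of "1/2::real"], of "c * g \<omega>"]
      by (auto simp: sums_iff)
    have c0: "0 \<le> c" using order_trans[OF \<kappa>(1) \<kappa>(2), of 0] by simp
    have "norm (\<Sum>j<n. \<kappa> j *\<^sub>R Z j \<omega>) \<le> 2 * c * g \<omega>" for n
    proof -
      have "norm (\<Sum>j<n. \<kappa> j *\<^sub>R Z j \<omega>) \<le> (\<Sum>j<n. (c * g \<omega>) * (1/2) ^ j)" by (rule sum_norm_le) (rule t)
      also have "\<dots> \<le> 2 * c * g \<omega>"
        unfolding geo2(2)[symmetric] by (rule sum_le_suminf[OF geo2(1)]) (use g0 c0 in auto)
      finally show ?thesis .
    qed
    moreover have "summable (\<lambda>j. \<kappa> j *\<^sub>R Z j \<omega>)"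
      by (rule summable_comparison_test'[OF geo2(1), of 0]) (use t in auto)
    ultimately show ?case by (simp add: summable_iff_convergent)
  qed
  have "dom_conv M (\<lambda>n \<omega>. \<Sum>j<n. \<kappa> j *\<^sub>R Z j \<omega>) (\<lambda>\<omega>. lim (\<lambda>n. \<Sum>j<n. \<kappa> j *\<^sub>R Z j \<omega>)) (\<lambda>\<omega>. (2 * c) *\<^sub>R g \<omega>)"
    unfolding dom_conv_def using hilb_scale[OF dom_convD(3)[OF Z], of "2 * c"] key
    by (auto simp: convergent_LIMSEQ_iff)
  then show ?thesis by (rule that)
qed

text \<open>Stegall's variational principle on \<open>K \<times> D\<close> with \<open>K\<close> compact and \<open>D\<close> bounded in \<open>L\<^sup>2\<close>.

  One step: let \<open>(p\<^sub>n, Z\<^sub>n)\<close> minimise \<open>f + \<langle>H\<^sub>n,\<cdot>\<rangle> - \<kappa>\<^sub>n|\<cdot>|\<^sup>2\<close> up to an error, and put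
  \<open>H\<^sub>n\<^sub>+\<^sub>1 = H\<^sub>n - 2\<kappa>\<^sub>n Z\<^sub>n\<close>. Since
  \<open>-2\<kappa>\<^sub>n\<langle>Z\<^sub>n,Z\<rangle> = -\<kappa>\<^sub>n|Z|\<^sup>2 + \<kappa>\<^sub>n|Z - Z\<^sub>n|\<^sup>2 - \<kappa>\<^sub>n|Z\<^sub>n|\<^sup>2\<close>, the new functional exceeds its value at
  \<open>(p\<^sub>n, Z\<^sub>n)\<close> by \<open>\<kappa>\<^sub>n|Z - Z\<^sub>n|\<^sup>2\<close>, up to the error. As \<open>(p\<^sub>n\<^sub>+\<^sub>1, Z\<^sub>n\<^sub>+\<^sub>1)\<close> almost minimises it,
  \<open>|Z\<^sub>n\<^sub>+\<^sub>1 - Z\<^sub>n|\<^sup>2\<close> is at most of order \<open>\<kappa>\<^sub>n\<^sub>+\<^sub>1/\<kappa>\<^sub>n\<close>. The superexponential choice of \<open>\<kappa>\<close> makes this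
  ratio summable fast enough for the previous completeness lemma, while \<open>H\<close> stays of size \<open>\<kappa>\<^sub>0\<close>. The hypothesis of
  semicontinuity is restricted to dominated sequences because lifts are continuous along those.\<close>

lemma stegall_L2:
  fixes f :: "'p::metric_space \<Rightarrow> ('w \<Rightarrow> 'b::euclidean_space) \<Rightarrow> real"
  assumes K: "compact K" "K \<noteq> {}" and D: "D \<subseteq> hilb M" "D \<noteq> {}"
    and R: "\<And>Z. Z \<in> D \<Longrightarrow> mom M 2 Z \<le> R"
    and bdd: "\<And>p Z. p \<in> K \<Longrightarrow> Z \<in> D \<Longrightarrow> B \<le> f p Z"
    and lsc: "\<And>p p' Z Z' g c c'. (\<And>n. p n \<in> K) \<Longrightarrow> p \<longlonglongrightarrow> p' \<Longrightarrow> p' \<in> K \<Longrightarrow> (\<And>n. Z n \<in> D) \<Longrightarrow>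
        dom_conv M Z Z' g \<Longrightarrow> (\<And>n::nat. f (p n) (Z n) \<le> c n) \<Longrightarrow> c \<longlonglongrightarrow> c' \<Longrightarrow> Z' \<in> D \<and> f p' Z' \<le> c'"
    and \<eta>: "\<eta> > 0"
  obtains H p Z where "H \<in> hilb M" "mom M 2 H \<le> \<eta>" "p \<in> K" "Z \<in> D"
    "\<And>p' Z'. p' \<in> K \<Longrightarrow> Z' \<in> D \<Longrightarrow> f p Z + ip M H Z \<le> f p' Z' + ip M H Z'"
proof -
  obtain Z0 where "Z0 \<in> D" using D by blast
  then have R0: "0 \<le> R" using order_trans[OF mom_nonneg R] by blast
  \<comment> \<open>The limit of \<open>H\<^sub>n\<close> is at most \<open>4\<kappa>\<^sub>0 g\<close>, and \<open>18R + 32\<close> bounds the second moment of the dominating \<open>g\<close>.\<close>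
  define \<kappa>0 where "\<kappa>0 = sqrt (\<eta> / (16 * (18 * R + 32)))"
  have \<kappa>0: "\<kappa>0 > 0" "16 * \<kappa>0^2 * (18 * R + 32) = \<eta>"
    using \<eta> R0 by (simp_all add: \<kappa>0_def divide_simps)
  define \<kappa> where "\<kappa> n = \<kappa>0 / 16 ^ (n^2)" for n :: nat
  have \<kappa>_pos: "0 < \<kappa> n" for n using \<kappa>0 by (simp add: \<kappa>_def)
  have \<kappa>_step: "\<kappa> (Suc n) \<le> \<kappa> n / 16 ^ n" for n
  proof -
    have "n^2 + n \<le> (Suc n)^2" by (simp add: power2_eq_square)
    then have "(16::real) ^ (n^2) * 16 ^ n \<le> 16 ^ ((Suc n)^2)"
      unfolding power_add[symmetric] by (rule power_increasing) simp
    then show ?thesis using \<kappa>0 unfolding \<kappa>_def divide_divide_eq_left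
      by (intro divide_left_mono) auto
  qed
  have \<kappa>_mono: "\<kappa> (Suc n) \<le> \<kappa> n" for n
  proof (rule order_trans[OF \<kappa>_step])
    show "\<kappa> n / 16 ^ n \<le> \<kappa> n"
      using divide_left_mono[of 1 "16 ^ n" "\<kappa> n"] \<kappa>_pos[of n] by simp
  qed
  have \<kappa>_geo: "\<kappa> n \<le> \<kappa>0 * (1/2) ^ n" for n
  proof -
    have "n \<le> n^2" by (simp add: power2_nat_le_imp_le)
    then have "(2::real) ^ n \<le> 16 ^ (n^2)"
      using power_mono[of "2::real" 16 n] power_increasing[of n "n^2" "16::real"] by linarith
    then have "\<kappa>0 / 16 ^ (n^2) \<le> \<kappa>0 / 2 ^ n" using \<kappa>0 by (intro divide_left_mono) auto
    then show ?thesis by (simp add: \<kappa>_def power_divide)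
  qed
  have \<kappa>_lim: "\<kappa> \<longlonglongrightarrow> 0"
  proof (rule tendsto_sandwich[OF _ _ tendsto_const])
    show "(\<lambda>n. \<kappa>0 * (1/2) ^ n) \<longlonglongrightarrow> 0"
      by (intro tendsto_mult_right_zero LIMSEQ_power_zero) simp
  qed (use \<kappa>_pos \<kappa>_geo in \<open>auto intro!: always_eventually less_imp_le\<close>)
  have near: "\<exists>p\<in>K. \<exists>Z\<in>D. \<forall>p'\<in>K. \<forall>Z'\<in>D.
      f p Z + ip M H Z - k * mom M 2 Z \<le> f p' Z' + ip M H Z' - k * mom M 2 Z' + \<sigma>"
    if H: "H \<in> hilb M" and k: "k > 0" "\<sigma> > 0" for H k \<sigma>
  proof -
    define q where "q = (\<lambda>(p, Z). f p Z + ip M H Z - k * mom M 2 Z)"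
    have low: "B - (mom M 2 H + R) / 2 - k * R \<le> q (p, Z)" if "p \<in> K" "Z \<in> D" for p Z
    proof -
      have "- ip M H Z \<le> (mom M 2 H + mom M 2 Z) / 2"
        using H D that by (intro abs_le_D2 ip_bound) auto
      moreover have "k * mom M 2 Z \<le> k * R" using R[OF that(2)] k by (intro mult_left_mono) auto
      ultimately show ?thesis using bdd[OF that] R[OF that(2)]
        unfolding q_def prod.case by argo
    qed
    have ne: "q ` (K \<times> D) \<noteq> {}" using K D by auto
    have bb: "bdd_below (q ` (K \<times> D))"
      by (rule bdd_belowI2[of _ "B - (mom M 2 H + R) / 2 - k * R"]) (use low in auto)
    have "Inf (q ` (K \<times> D)) < Inf (q ` (K \<times> D)) + \<sigma>" using k by simp
    then obtain y where "y \<in> q ` (K \<times> D)" "y < Inf (q ` (K \<times> D)) + \<sigma>"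
      using cInf_lessD[OF ne] by blast
    then obtain p Z where pZ: "p \<in> K" "Z \<in> D" "q (p, Z) < Inf (q ` (K \<times> D)) + \<sigma>" by auto
    have "q (p, Z) \<le> q (p', Z') + \<sigma>" if "p' \<in> K" "Z' \<in> D" for p' Z'
      using pZ(3) cINF_lower[OF bb, of "(p', Z')"] that by force
    then show ?thesis using pZ(1,2) by (auto simp: q_def)
  qed
  define P where "P n x \<longleftrightarrow> (case x of (H, p, Z) \<Rightarrow> (n = 0 \<longrightarrow> H = (\<lambda>\<omega>. 0)) \<and> H \<in> hilb M \<and> p \<in> K \<and> Z \<in> D \<and>
     (\<forall>p'\<in>K. \<forall>Z'\<in>D. f p Z + ip M H Z - \<kappa> n * mom M 2 Z \<le>
        f p' Z' + ip M H Z' - \<kappa> n * mom M 2 Z' + \<kappa> (Suc n)))" for n :: nat and x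
  define Q where "Q n x y \<longleftrightarrow> (case x of (H, p, Z) \<Rightarrow> fst y = (\<lambda>\<omega>. H \<omega> - (2 * \<kappa> n) *\<^sub>R Z \<omega>))"
    for n and x y :: "('w \<Rightarrow> 'b) \<times> 'p \<times> ('w \<Rightarrow> 'b)"
  have "\<exists>x. P 0 x"
  proof -
    have H: "(\<lambda>\<omega>. 0) \<in> hilb M" by (rule Lq_zero) simp
    from near[OF H \<kappa>_pos[of 0] \<kappa>_pos[of "Suc 0"]] obtain p Z where "P 0 (\<lambda>\<omega>. 0, p, Z)"
      unfolding P_def using H by auto
    then show ?thesis by blast
  qed
  moreover have "\<exists>y. P (Suc n) y \<and> Q n x y" if "P n x" for n x
  proof -
    obtain H p Z where x: "x = (H, p, Z)" by (cases x)
    have H: "(\<lambda>\<omega>. H \<omega> - (2 * \<kappa> n) *\<^sub>R Z \<omega>) \<in> hilb M" (is "?H \<in> _")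
      using that D hilb_diff[OF _ hilb_scale, of H M Z "2 * \<kappa> n"]
      by (auto simp: P_def x fun_diff_def)
    from near[OF H \<kappa>_pos[of "Suc n"] \<kappa>_pos[of "Suc (Suc n)"]] obtain p' Z' where "P (Suc n) (?H, p', Z')"
      unfolding P_def using H by auto
    then show ?thesis unfolding Q_def x by force
  qed
  ultimately obtain F where F: "\<And>n. P n (F n)" "\<And>n. Q n (F n) (F (Suc n))"
    using dependent_nat_choice[of P Q] by blast
  define H where "H n = fst (F n)" for n
  define p where "p n = fst (snd (F n))" for n
  define Z where "Z n = snd (snd (F n))" for n
  have Fn: "F n = (H n, p n, Z n)" for n by (simp add: H_def p_def Z_def)
  have H0: "H 0 = (\<lambda>\<omega>. 0)" and Hh: "H n \<in> hilb M" and pK: "p n \<in> K" and ZD: "Z n \<in> D"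
    and min: "\<And>p' Z'. p' \<in> K \<Longrightarrow> Z' \<in> D \<Longrightarrow> f (p n) (Z n) + ip M (H n) (Z n) - \<kappa> n * mom M 2 (Z n) \<le>
        f p' Z' + ip M (H n) Z' - \<kappa> n * mom M 2 Z' + \<kappa> (Suc n)" for n
    using F(1)[of n] F(1)[of 0] by (auto simp: P_def Fn)
  have HS: "H (Suc n) = (\<lambda>\<omega>. H n \<omega> - (2 * \<kappa> n) *\<^sub>R Z n \<omega>)" for n
    using F(2)[of n] by (auto simp: Q_def Fn)
  have Zh: "Z n \<in> hilb M" for n using ZD D by auto
  have ipS: "ip M (H (Suc n)) X = ip M (H n) X - 2 * \<kappa> n * ip M (Z n) X" if "X \<in> hilb M" for n X
    unfolding HS by (rule ip_diff_scale_left[OF Hh Zh that])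
  have step: "mom M 2 (Z (Suc n) - Z n) \<le> (2 + R) / 16 ^ n" for n
  proof -
    have 1: "f (p n) (Z n) + ip M (H n) (Z n) - \<kappa> n * mom M 2 (Z n) \<le> f (p (Suc n)) (Z (Suc n))
        + ip M (H n) (Z (Suc n)) - \<kappa> n * mom M 2 (Z (Suc n)) + \<kappa> (Suc n)"
      by (rule min[OF pK ZD])
    have 2: "f (p (Suc n)) (Z (Suc n)) + ip M (H (Suc n)) (Z (Suc n)) - \<kappa> (Suc n) * mom M 2 (Z (Suc n)) \<le> f (p n) (Z n)
        + ip M (H (Suc n)) (Z n) - \<kappa> (Suc n) * mom M 2 (Z n) + \<kappa> (Suc (Suc n))"
      by (rule min[OF pK ZD])
    have 3: "\<kappa> n * mom M 2 (Z (Suc n) - Z n) = \<kappa> n * mom M 2 (Z (Suc n)) - 2 * \<kappa> n * ip M (Z n) (Z (Suc n))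
        + \<kappa> n * mom M 2 (Z n)"
      unfolding mom2_diff[OF Zh Zh] by (simp add: algebra_simps)
    have 4: "\<kappa> n * ip M (Z n) (Z n) = \<kappa> n * mom M 2 (Z n)" by (simp add: mom2_eq_ip)
    have 5: "\<kappa> (Suc n) * mom M 2 (Z (Suc n)) \<le> \<kappa> (Suc n) * R" "0 \<le> \<kappa> (Suc n) * mom M 2 (Z n)"
      using \<kappa>_pos[of "Suc n"] by (auto intro!: mult_left_mono R ZD)
    have "\<kappa> n * mom M 2 (Z (Suc n) - Z n) \<le> \<kappa> (Suc n) + \<kappa> (Suc (Suc n)) + \<kappa> (Suc n) * R"
      using 1 2 3 4 5 unfolding ipS[OF Zh] by linarith
    also have "\<dots> \<le> \<kappa> (Suc n) * (2 + R)" using \<kappa>_mono[of "Suc n"] by (simp add: algebra_simps)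
    also have "\<dots> \<le> \<kappa> n / 16 ^ n * (2 + R)" using R0 by (intro mult_right_mono \<kappa>_step) auto
    also have "\<dots> = \<kappa> n * ((2 + R) / 16 ^ n)" by simp
    finally show ?thesis using \<kappa>_pos[of n] by (simp only: mult_le_cancel_left_pos)
  qed
  obtain Z' g where Z': "dom_conv M Z Z' g" "mom M 2 g \<le> 2 * mom M 2 (Z 0) + 16 * (2 + R)"
    using fast_Cauchy_dom_conv[OF Zh step] by blast
  have g_le: "mom M 2 g \<le> 18 * R + 32" using Z'(2) R[OF ZD[of 0]] by simp
  have "0 \<le> 2 * \<kappa> n" "2 * \<kappa> n \<le> (2 * \<kappa>0) * (1/2) ^ n" for n
    using \<kappa>_pos[of n] \<kappa>_geo[of n] by auto
  then obtain H'' where H'': "dom_conv M (\<lambda>n \<omega>. \<Sum>j<n. (2 * \<kappa> j) *\<^sub>R Z j \<omega>) H'' (\<lambda>\<omega>. (2 * (2 * \<kappa>0)) *\<^sub>R g \<omega>)"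
    using dom_conv_weighted_sums[OF Z'(1), of "\<lambda>n. 2 * \<kappa> n" "2 * \<kappa>0"] by blast
  define H' where "H' = (\<lambda>\<omega>. - H'' \<omega>)"
  have Hsum: "H n = (\<lambda>\<omega>. - (\<Sum>j<n. (2 * \<kappa> j) *\<^sub>R Z j \<omega>))" for n
    by (induction n) (auto simp: H0 HS)
  have H': "dom_conv M H H' (\<lambda>\<omega>. (2 * (2 * \<kappa>0)) *\<^sub>R g \<omega>)"
    using H'' unfolding dom_conv_def Hsum H'_def
    by (auto intro: tendsto_minus)
  have "mom M 2 H' \<le> mom M 2 (\<lambda>\<omega>. (2 * (2 * \<kappa>0)) *\<^sub>R g \<omega>)" by (rule dom_conv_hilb(4)[OF H'])
  also have "\<dots> = 16 * \<kappa>0^2 * mom M 2 g" by (simp add: mom_def power_mult_distrib)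
  also have "\<dots> \<le> 16 * \<kappa>0^2 * (18 * R + 32)" by (intro mult_left_mono g_le) auto
  finally have H'_mom: "mom M 2 H' \<le> \<eta>" using \<kappa>0 by simp
  have H'h: "H' \<in> hilb M" by (rule dom_conv_hilb(2)[OF H'])
  obtain p' r where r: "p' \<in> K" "strict_mono r" "(\<lambda>n. p (r n)) \<longlonglongrightarrow> p'"
    using K(1) pK unfolding compact_def comp_def by blast
  have lim: "Z' \<in> D \<and> f p' Z' \<le> f p1 Z1 + ip M H' Z1 - ip M H' Z' + 0 * R + 0" if "p1 \<in> K" "Z1 \<in> D" for p1 Z1
  proof (rule lsc)
    have Z1: "Z1 \<in> hilb M" using that D by auto
    show "p (r n) \<in> K" for n using pK by simp
    show "Z (r n) \<in> D" for n by (rule ZD)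
    show "dom_conv M (\<lambda>n. Z (r n)) Z' g" by (rule dom_conv_subseq[OF Z'(1) r(2)])
    have *: "f (p n) (Z n) \<le> f p1 Z1 + ip M (H n) Z1 - ip M (H n) (Z n) + \<kappa> n * R + \<kappa> (Suc n)" for n
    proof -
      have "\<kappa> n * mom M 2 (Z n) \<le> \<kappa> n * R" "0 \<le> \<kappa> n * mom M 2 Z1"
        using \<kappa>_pos[of n] by (auto intro!: mult_left_mono R ZD)
      then show ?thesis using min[OF that, of n] by linarith
    qed
    show "f (p (r n)) (Z (r n)) \<le> (\<lambda>n. f p1 Z1 + ip M (H n) Z1 - ip M (H n) (Z n) + \<kappa> n * R + \<kappa> (Suc n)) (r n)" for n
      using *[of "r n"] by simp
    have "(\<lambda>n. f p1 Z1 + ip M (H n) Z1 - ip M (H n) (Z n) + \<kappa> n * R + \<kappa> (Suc n))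
      \<longlonglongrightarrow> f p1 Z1 + ip M H' Z1 - ip M H' Z' + 0 * R + 0"
      by (intro tendsto_intros \<kappa>_lim LIMSEQ_Suc dom_conv_ip[OF H' dom_conv_const[OF Z1]] dom_conv_ip[OF H' Z'(1)])
    from LIMSEQ_subseq_LIMSEQ[OF this r(2)]
    show "(\<lambda>n. (\<lambda>n. f p1 Z1 + ip M (H n) Z1 - ip M (H n) (Z n) + \<kappa> n * R + \<kappa> (Suc n)) (r n))
      \<longlonglongrightarrow> f p1 Z1 + ip M H' Z1 - ip M H' Z' + 0 * R + 0"
      by (simp add: comp_def)
  qed (use r in auto)
  show ?thesis
  proof (rule that[OF H'h H'_mom r(1)])
    show "Z' \<in> D" using lim K D by blast
    show "f p' Z' + ip M H' Z' \<le> f p1 Z1 + ip M H' Z1" if "p1 \<in> K" "Z1 \<in> D" for p1 Z1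
      using lim[OF that] by simp
  qed
qed

section \<open>Minimisers of the doubled functional\<close>

definition gap :: "'w measure \<Rightarrow> ('a::euclidean_space \<Rightarrow> 'a measure \<Rightarrow> 'a) \<Rightarrow> ('a \<Rightarrow> 'a measure \<Rightarrow> 'a) \<Rightarrow>
    ('w \<Rightarrow> 'a) \<Rightarrow> ('w \<Rightarrow> 'a) \<Rightarrow> real" where
  "gap M w v X Y = ip M (lift M w X - lift M v Y) (X - Y)"

lemma gap_flip: "gap M w v X Y = gap M v w Y X"
  unfolding gap_def by (rule ip_diff_diff_flip)

text \<open>The same exponential weight \<open>e\<^bsup>l(t+s)\<^esup>\<close> multiplies both fourth moments: freezing \<open>(s, Y)\<close> leaves a
  weight of the form \<open>\<beta> e\<^bsup>lt\<^esup>\<close>, as in the test functions, and the frozen moment becomes part of the scalar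
  function of time.\<close>

definition doubled :: "'w measure \<Rightarrow> (real \<Rightarrow> 'a::euclidean_space \<Rightarrow> 'a measure \<Rightarrow> 'a) \<Rightarrow>
    (real \<Rightarrow> 'a \<Rightarrow> 'a measure \<Rightarrow> 'a) \<Rightarrow> real \<Rightarrow> real \<Rightarrow> (real \<times> real \<Rightarrow> real) \<Rightarrow>
    real \<times> real \<Rightarrow> ('w \<Rightarrow> 'a) \<Rightarrow> ('w \<Rightarrow> 'a) \<Rightarrow> real" where
  "doubled M W V \<alpha> l g p X Y = gap M (W (fst p)) (V (snd p)) X Y +
     \<alpha> * exp (l * (fst p + snd p)) * (mom M 4 X + mom M 4 Y) + g p"

lemma norm_fst_snd_le: "norm (fst z) \<le> norm z" "norm (snd z) \<le> norm z"
  by (cases z; simp add: norm_fst_le norm_snd_le)+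

lemma fst_hilb:
  assumes "Z \<in> hilb M"
  shows "(\<lambda>\<omega>. fst (Z \<omega>)) \<in> hilb M" "mom M 2 (\<lambda>\<omega>. fst (Z \<omega>)) \<le> mom M 2 Z"
proof -
  have m: "(\<lambda>\<omega>. fst (Z \<omega>)) \<in> borel_measurable M"
    by (rule measurable_compose[OF Lq_measurable[OF assms]
        borel_measurable_continuous_onI[OF continuous_on_fst[OF continuous_on_id]]])
  have n: "(\<lambda>\<omega>. norm (Z \<omega>)) \<in> hilb M" using assms by (auto simp: Lq_def)
  have "mom M 2 (\<lambda>\<omega>. norm (Z \<omega>)) = mom M 2 Z" by (simp add: mom_def)
  with hilbI_AE[OF m n] show "(\<lambda>\<omega>. fst (Z \<omega>)) \<in> hilb M" "mom M 2 (\<lambda>\<omega>. fst (Z \<omega>)) \<le> mom M 2 Z"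
    by (auto simp: norm_fst_snd_le)
qed

lemma snd_hilb:
  assumes "Z \<in> hilb M"
  shows "(\<lambda>\<omega>. snd (Z \<omega>)) \<in> hilb M" "mom M 2 (\<lambda>\<omega>. snd (Z \<omega>)) \<le> mom M 2 Z"
proof -
  have m: "(\<lambda>\<omega>. snd (Z \<omega>)) \<in> borel_measurable M"
    by (rule measurable_compose[OF Lq_measurable[OF assms]
        borel_measurable_continuous_onI[OF continuous_on_snd[OF continuous_on_id]]])
  have n: "(\<lambda>\<omega>. norm (Z \<omega>)) \<in> hilb M" using assms by (auto simp: Lq_def)
  have "mom M 2 (\<lambda>\<omega>. norm (Z \<omega>)) = mom M 2 Z" by (simp add: mom_def)
  with hilbI_AE[OF m n] show "(\<lambda>\<omega>. snd (Z \<omega>)) \<in> hilb M" "mom M 2 (\<lambda>\<omega>. snd (Z \<omega>)) \<le> mom M 2 Z"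
    by (auto simp: norm_fst_snd_le)
qed

lemma pair_hilb:
  assumes "X \<in> hilb M" "Y \<in> hilb M"
  shows "(\<lambda>\<omega>. (X \<omega>, Y \<omega>)) \<in> hilb M" "mom M 2 (\<lambda>\<omega>. (X \<omega>, Y \<omega>)) = mom M 2 X + mom M 2 Y"
  using assms by (auto simp: Lq_def norm_Pair mom_def)

lemma ip_pair:
  assumes "H \<in> hilb M" "Z \<in> hilb M"
  shows "ip M H Z = ip M (\<lambda>\<omega>. fst (H \<omega>)) (\<lambda>\<omega>. fst (Z \<omega>)) + ip M (\<lambda>\<omega>. snd (H \<omega>)) (\<lambda>\<omega>. snd (Z \<omega>))"
  using hilb_integrable_inner[OF fst_hilb(1) fst_hilb(1), OF assms]
    hilb_integrable_inner[OF snd_hilb(1) snd_hilb(1), OF assms]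
  by (simp add: ip_def inner_prod_def)

lemma dom_conv_bounded_linear:
  assumes "dom_conv M Z Z' g" "bounded_linear \<Phi>" "\<And>z. norm (\<Phi> z) \<le> norm z"
  shows "dom_conv M (\<lambda>n \<omega>. \<Phi> (Z n \<omega>)) (\<lambda>\<omega>. \<Phi> (Z' \<omega>)) g"
proof -
  have m: "\<Phi> \<in> borel_measurable borel"
    using assms(2) by (intro borel_measurable_continuous_onI linear_continuous_on)
  have "AE \<omega> in M. norm (\<Phi> (Z n \<omega>)) \<le> g \<omega>" for n
    using dom_convD(4)[OF assms(1), of n] by eventually_elim (rule order_trans[OF assms(3)])
  moreover have "AE \<omega> in M. (\<lambda>n. \<Phi> (Z n \<omega>)) \<longlonglongrightarrow> \<Phi> (Z' \<omega>)"
    using dom_convD(5)[OF assms(1)] by eventually_elim (rule bounded_linear.tendsto[OF assms(2)])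
  ultimately show ?thesis unfolding dom_conv_def
    using measurable_compose[OF dom_convD(1)[OF assms(1)] m] measurable_compose[OF dom_convD(2)[OF assms(1)] m]
      dom_convD(3)[OF assms(1)] by blast
qed

text \<open>Fatou's lemma: the fourth moment is the only part of the doubled functional that is not continuous.\<close>

lemma mom4_lsc:
  fixes X Y :: "nat \<Rightarrow> 'w \<Rightarrow> 'a::euclidean_space"
  assumes X: "dom_conv M X X' g" "\<And>n. X n \<in> Lq M 4" and Y: "dom_conv M Y Y' k" "\<And>n. Y n \<in> Lq M 4"
    and b: "\<And>n. 0 < b n" "b \<longlonglongrightarrow> b'" "0 < b'"
    and le: "\<And>n. b n * (mom M 4 (X n) + mom M 4 (Y n)) \<le> c n" and c: "c \<longlonglongrightarrow> c'"
  shows "X' \<in> Lq M 4" "Y' \<in> Lq M 4" "b' * (mom M 4 X' + mom M 4 Y') \<le> c'"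
proof -
  note [measurable] = dom_convD(1,2)[OF X(1)] dom_convD(1,2)[OF Y(1)]
  define u where "u n \<omega> = b n * (norm (X n \<omega>) ^ 4 + norm (Y n \<omega>) ^ 4)" for n \<omega>
  define u' where "u' \<omega> = b' * (norm (X' \<omega>) ^ 4 + norm (Y' \<omega>) ^ 4)" for \<omega>
  have [measurable]: "u n \<in> borel_measurable M" "u' \<in> borel_measurable M" for n
    unfolding u_def u'_def by measurable
  have u0: "0 \<le> u n \<omega>" "0 \<le> u' \<omega>" for n \<omega> 
    by (simp_all add: u_def u'_def less_imp_le[OF b(1)] less_imp_le[OF b(3)])
  have ui: "integrable M (u n)" "(\<integral>\<omega>. u n \<omega> \<partial>M) = b n * (mom M 4 (X n) + mom M 4 (Y n))" for n
    unfolding u_def mom_def using Lq_integrable[OF X(2)] Lq_integrable[OF Y(2)] by auto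
  have c0: "0 \<le> c n" for n
    using le[of n] b(1)[of n] by (meson add_nonneg_nonneg less_imp_le mom_nonneg mult_nonneg_nonneg order_trans)
  have c'0: "0 \<le> c'" by (rule LIMSEQ_le_const[OF c]) (use c0 in auto)
  have "AE \<omega> in M. ennreal (u' \<omega>) = liminf (\<lambda>n. ennreal (u n \<omega>))"
    using dom_convD(5)[OF X(1)] dom_convD(5)[OF Y(1)]
  proof eventually_elim
    case (elim \<omega>)
    have "(\<lambda>n. ennreal (u n \<omega>)) \<longlonglongrightarrow> ennreal (u' \<omega>)"
      unfolding u_def u'_def by (intro tendsto_ennrealI tendsto_intros elim b)
    then show ?case by (intro lim_imp_Liminf[symmetric]) auto
  qed
  then have "(\<integral>\<^sup>+\<omega>. ennreal (u' \<omega>) \<partial>M) = (\<integral>\<^sup>+\<omega>. liminf (\<lambda>n. ennreal (u n \<omega>)) \<partial>M)"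
    by (rule nn_integral_cong_AE)
  also have "\<dots> \<le> liminf (\<lambda>n. \<integral>\<^sup>+\<omega>. ennreal (u n \<omega>) \<partial>M)"
    by (rule nn_integral_liminf) measurable
  also have "\<dots> \<le> liminf (\<lambda>n. ennreal (c n))"
  proof (intro Liminf_mono always_eventually allI)
    fix n
    have "(\<integral>\<^sup>+\<omega>. ennreal (u n \<omega>) \<partial>M) = ennreal (\<integral>\<omega>. u n \<omega> \<partial>M)"
      by (rule nn_integral_eq_integral[OF ui(1)]) (simp add: u0)
    also have "\<dots> \<le> ennreal (c n)" unfolding ui(2) using le by (rule ennreal_leI)
    finally show "(\<integral>\<^sup>+\<omega>. ennreal (u n \<omega>) \<partial>M) \<le> ennreal (c n)" .
  qed
  also have "\<dots> = ennreal c'" using tendsto_ennrealI[OF c] by (intro lim_imp_Liminf) auto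
  finally have le': "(\<integral>\<^sup>+\<omega>. ennreal (u' \<omega>) \<partial>M) \<le> ennreal c'" .
  have u'i: "integrable M u'"
    by (rule integrableI_bounded) (use le' u0 in \<open>auto intro: order_le_less_trans\<close>)
  have sc: "norm (X' \<omega>) ^ 4 \<le> (1 / b') * u' \<omega>" "norm (Y' \<omega>) ^ 4 \<le> (1 / b') * u' \<omega>" for \<omega>
    using b(3) by (auto simp: u'_def)
  show L: "X' \<in> Lq M 4" "Y' \<in> Lq M 4"
    by (rule LqI[OF _ _ sc(1)] LqI[OF _ _ sc(2)]; use u'i in auto)+
  have "b' * (mom M 4 X' + mom M 4 Y') = (\<integral>\<omega>. u' \<omega> \<partial>M)"
    unfolding u'_def mom_def using L by (simp add: Lq_def)
  also have "ennreal \<dots> = (\<integral>\<^sup>+\<omega>. ennreal (u' \<omega>) \<partial>M)"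
    by (rule nn_integral_eq_integral[OF u'i, symmetric]) (simp add: u0)
  finally have "ennreal (b' * (mom M 4 X' + mom M 4 Y')) \<le> ennreal c'" using le' by simp
  then show "b' * (mom M 4 X' + mom M 4 Y') \<le> c'" using c'0 by simp
qed

context prob_space
begin

lemma gap_bound:
  assumes W: "regular_field L T W" and V: "regular_field L T V" and ts: "t \<in> {0..T}" "s \<in> {0..T}"
    and X: "X \<in> hilb M" and Y: "Y \<in> hilb M"
  shows "\<bar>gap M (W t) (V s) X Y\<bar> \<le> (12 * L^2 + 1) * (2 + mom M 2 X + mom M 2 Y)"
proof -
  let ?A = "lift M (W t) X" and ?B = "lift M (V s) Y"
  note A = lift_hilb[OF W ts(1) X] and B = lift_hilb[OF V ts(2) Y]
  have "\<bar>gap M (W t) (V s) X Y\<bar> \<le> (mom M 2 (?A - ?B) + mom M 2 (X - Y)) / 2"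
    unfolding gap_def by (intro ip_bound hilb_diff A B X Y)
  also have "\<dots> \<le> (12 * L^2 + 1) * (2 + mom M 2 X + mom M 2 Y)"
  proof -
    have "0 \<le> L^2 * mom M 2 X" "0 \<le> L^2 * mom M 2 Y" "0 \<le> L^2" by simp_all
    moreover have "6 * L^2 * (1 + c) = 6 * L^2 + 6 * (L^2 * c)" for c by (simp add: algebra_simps)
    moreover have "(12 * L^2 + 1) * (2 + mom M 2 X + mom M 2 Y) = 24 * L^2 + 12 * (L^2 * mom M 2 X)
        + 12 * (L^2 * mom M 2 Y) + 2 + mom M 2 X + mom M 2 Y" by (simp add: algebra_simps)
    ultimately show ?thesis using mom2_diff_le[OF A(1) B(1)] mom2_diff_le[OF X Y] A(2) B(2) by argo
  qed
  finally show ?thesis .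
qed

text \<open>Coercivity reduces the problem to a bounded set of variables with bounded fourth moments and to a compact
  sublevel set of \<open>g\<close>, where the variational principle applies to the pair \<open>(X, Y)\<close> as one random variable. The
  bounds hold uniformly for all \<open>h\<close>, \<open>k\<close> in the unit ball, so the restricted minimum is a global one.\<close>

lemma exists_perturbed_min:
  fixes W V :: "real \<Rightarrow> 'b::euclidean_space \<Rightarrow> 'b measure \<Rightarrow> 'b"
  assumes W: "regular_field L T W" and V: "regular_field L T V" and \<alpha>: "\<alpha> > 0" and l: "l \<ge> 0"
    and S: "S \<subseteq> {0..T} \<times> {0..T}" "S \<noteq> {}"
    and g: "continuous_on S g" "\<And>p. p \<in> S \<Longrightarrow> 0 \<le> g p" "\<And>c. compact {p\<in>S. g p \<le> c}"
    and \<eta>: "\<eta> > 0"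
  obtains h k t s X Y where "h \<in> hilb M" "mom M 2 h \<le> \<eta>" "k \<in> hilb M" "mom M 2 k \<le> \<eta>"
    "(t, s) \<in> S" "X \<in> Lq M 4" "Y \<in> Lq M 4"
    "\<And>t' s' X' Y'. (t', s') \<in> S \<Longrightarrow> X' \<in> Lq M 4 \<Longrightarrow> Y' \<in> Lq M 4 \<Longrightarrow>
      doubled M W V \<alpha> l g (t, s) X Y + ip M h X + ip M k Y
      \<le> doubled M W V \<alpha> l g (t', s') X' Y' + ip M h X' + ip M k Y'"
proof -
  define Q where "Q = 12 * L^2 + 2"
  have Q: "Q > 0" unfolding Q_def by (simp add: add_nonneg_pos)
  \<comment> \<open>Chosen so that the second moments, entering with factor \<open>Q\<close>, use up half of the fourth-moment penalty.\<close>
  define \<theta> where "\<theta> = \<alpha> / (2 * Q)"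
  have \<theta>: "\<theta> > 0" "Q * \<theta> = \<alpha> / 2" using \<alpha> Q by (auto simp: \<theta>_def)
  define C0 where "C0 = 2 * Q + Q * (2 / \<theta>)"
  have C0: "0 < C0" unfolding C0_def using Q \<theta> by (intro add_pos_pos mult_pos_pos) auto
  let ?J = "doubled M W V \<alpha> l g"
  have weight: "\<alpha> \<le> \<alpha> * exp (l * (fst p + snd p))" if "p \<in> S" for p
    using \<alpha> l S that by (cases p) auto
  have coercive: "g p + (\<alpha> / 2) * (mom M 4 X + mom M 4 Y) - C0 \<le> ?J p X Y + ip M h X + ip M k Y"
    if p: "p \<in> S" and XY: "X \<in> Lq M 4" "Y \<in> Lq M 4" and hk: "h \<in> hilb M" "mom M 2 h \<le> 1" "k \<in> hilb M" "mom M 2 k \<le> 1"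
    for p h k and X Y :: "'a \<Rightarrow> 'b"
  proof -
    note XY2 = L4_hilb[OF XY(1)] L4_hilb[OF XY(2)]
    have 1: "- gap M (W (fst p)) (V (snd p)) X Y \<le> (12 * L^2 + 1) * (2 + mom M 2 X + mom M 2 Y)"
      by (rule abs_le_D2, rule gap_bound[OF W V _ _ XY2]) (use p S in auto)
    have 2: "- ip M h X \<le> (mom M 2 h + mom M 2 X) / 2" "- ip M k Y \<le> (mom M 2 k + mom M 2 Y) / 2"
      using ip_bound[OF hk(1) XY2(1)] ip_bound[OF hk(3) XY2(2)] by (auto dest: abs_le_D2)
    have 3: "\<alpha> * (mom M 4 X + mom M 4 Y) \<le> \<alpha> * exp (l * (fst p + snd p)) * (mom M 4 X + mom M 4 Y)"
      using weight[OF p] by (intro mult_right_mono) auto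
    have "Q * (mom M 2 X + mom M 2 Y) \<le> Q * (\<theta> * mom M 4 X + 1 / \<theta> + (\<theta> * mom M 4 Y + 1 / \<theta>))"
      using Q by (intro mult_left_mono add_mono mom2_le_mom4 XY \<theta>) auto
    also have "\<dots> = (Q * \<theta>) * (mom M 4 X + mom M 4 Y) + Q * (2 / \<theta>)" by (simp add: algebra_simps)
    finally have 4: "Q * (mom M 2 X + mom M 2 Y) \<le> (\<alpha> / 2) * (mom M 4 X + mom M 4 Y) + Q * (2 / \<theta>)"
      unfolding \<theta>(2) .
    have 5: "Q * (2 + mom M 2 X + mom M 2 Y) = (12 * L^2 + 1) * (2 + mom M 2 X + mom M 2 Y) + (2 + mom M 2 X + mom M 2 Y)"
      by (simp add: Q_def algebra_simps)
    have 6: "Q * (2 + mom M 2 X + mom M 2 Y) = 2 * Q + Q * (mom M 2 X + mom M 2 Y)" by (simp add: algebra_simps)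
    have 7: "\<alpha> * (mom M 4 X + mom M 4 Y) = (\<alpha> / 2) * (mom M 4 X + mom M 4 Y) + (\<alpha> / 2) * (mom M 4 X + mom M 4 Y)"
      by simp
    have "0 \<le> mom M 2 X" "0 \<le> mom M 2 Y" by simp_all
    then show ?thesis using 1 2 3 4 5 6 7 hk unfolding doubled_def C0_def by argo
  qed
  obtain p0 where p0: "p0 \<in> S" using S by blast
  define K where "K = {p\<in>S. g p \<le> g p0 + C0}"
  \<comment> \<open>Beyond this level of the fourth moments the functional is at least its value \<open>g p0\<close> at \<open>(p0, 0, 0)\<close>.\<close>
  define \<rho> where "\<rho> = 2 * (g p0 + C0) / \<alpha>"
  have \<rho>: "(\<alpha> / 2) * \<rho> = g p0 + C0" "0 \<le> \<rho>" using \<alpha> C0 g(2)[OF p0] by (auto simp: \<rho>_def)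
  let ?X = "\<lambda>Z \<omega>. fst (Z \<omega> :: 'b \<times> 'b)" and ?Y = "\<lambda>Z \<omega>. snd (Z \<omega> :: 'b \<times> 'b)"
  define D where "D = {Z. ?X Z \<in> Lq M 4 \<and> ?Y Z \<in> Lq M 4 \<and> mom M 4 (?X Z) + mom M 4 (?Y Z) \<le> \<rho>}"
  define f where "f p Z = ?J p (?X Z) (?Y Z)" for p and Z :: "'a \<Rightarrow> 'b \<times> 'b"
  have Dh: "Z \<in> hilb M" "mom M 2 Z \<le> \<rho> + 2" if "Z \<in> D" for Z
  proof -
    have XY: "?X Z \<in> Lq M 4" "?Y Z \<in> Lq M 4" "mom M 4 (?X Z) + mom M 4 (?Y Z) \<le> \<rho>"
      using that by (auto simp: D_def)
    from pair_hilb[OF L4_hilb[OF XY(1)] L4_hilb[OF XY(2)]] mom2_le_mom4[OF XY(1), of 1] mom2_le_mom4[OF XY(2), of 1] XY(3)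
    show "Z \<in> hilb M" "mom M 2 Z \<le> \<rho> + 2" by simp_all
  qed
  have zero: "mom M q (\<lambda>\<omega>. 0 :: 'b) = 0" if "q > 0" for q using that by (simp add: mom_def)
  have ip0: "ip M h (\<lambda>\<omega>. 0) = 0" for h :: "'a \<Rightarrow> 'b" by (simp add: ip_def)
  have J0: "?J p0 (\<lambda>\<omega>. 0) (\<lambda>\<omega>. 0) = g p0"
    unfolding doubled_def gap_def by (simp add: zero) (simp add: ip_def)
  have D0: "(\<lambda>\<omega>. 0) \<in> D" using \<rho> by (auto simp: D_def zero intro!: Lq_zero)
  have fge: "- C0 \<le> f p Z" if "p \<in> K" "Z \<in> D" for p Z
  proof -
    have "g p + (\<alpha> / 2) * (mom M 4 (?X Z) + mom M 4 (?Y Z)) - C0 \<le> f p Z + ip M (\<lambda>\<omega>. 0) (?X Z) + ip M (\<lambda>\<omega>. 0) (?Y Z)"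
      unfolding f_def using that by (intro coercive Lq_zero) (auto simp: K_def D_def zero)
    moreover have "0 \<le> (\<alpha> / 2) * (mom M 4 (?X Z) + mom M 4 (?Y Z))" using \<alpha> by simp
    ultimately show ?thesis using g(2)[of p] that by (simp add: K_def ip_def)
  qed
  have lsc: "Z' \<in> D \<and> f p' Z' \<le> c'"
    if p: "\<And>n. p n \<in> K" "p \<longlonglongrightarrow> p'" "p' \<in> K" and Z: "\<And>n. Z n \<in> D" "dom_conv M Z Z' G"
      and c: "\<And>n::nat. f (p n) (Z n) \<le> c n" "c \<longlonglongrightarrow> c'" for p p' Z Z' G c c'
  proof -
    have X: "dom_conv M (\<lambda>n. ?X (Z n)) (?X Z') G" and Y: "dom_conv M (\<lambda>n. ?Y (Z n)) (?Y Z') G"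
      by (intro dom_conv_bounded_linear[OF Z(2)] bounded_linear_fst bounded_linear_snd norm_fst_snd_le)+
    have X4: "?X (Z n) \<in> Lq M 4" and Y4: "?Y (Z n) \<in> Lq M 4" and le: "mom M 4 (?X (Z n)) + mom M 4 (?Y (Z n)) \<le> \<rho>" for n
      using Z(1)[of n] by (auto simp: D_def)
    note * = mom4_lsc[OF X X4 Y Y4]
    have "?X Z' \<in> Lq M 4" "?Y Z' \<in> Lq M 4" "1 * (mom M 4 (?X Z') + mom M 4 (?Y Z')) \<le> \<rho>"
      using *[of "\<lambda>_. 1" 1 "\<lambda>_. \<rho>" \<rho>] le by auto
    then have ZD: "Z' \<in> D" by (simp add: D_def)
    have pS: "p n \<in> S" "p' \<in> S" for n using p by (auto simp: K_def)
    have pT: "fst (p n) \<in> {0..T}" "snd (p n) \<in> {0..T}" for n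
      using subsetD[OF S(1) pS(1)[of n]] by (auto simp: mem_Times_iff)
    have gap_lim: "(\<lambda>n. gap M (W (fst (p n))) (V (snd (p n))) (?X (Z n)) (?Y (Z n)))
        \<longlonglongrightarrow> gap M (W (fst p')) (V (snd p')) (?X Z') (?Y Z')"
      unfolding gap_def
      by (rule ip_lift_tendsto[OF W V _ _ _ _ X Y])
         (rule pT tendsto_fst[OF p(2)] tendsto_snd[OF p(2)])+
    have g_lim: "(\<lambda>n. g (p n)) \<longlonglongrightarrow> g p'"
      using g(1) pS p(2) unfolding continuous_on_sequentially comp_def by blast
    let ?b = "\<lambda>p. \<alpha> * exp (l * (fst p + snd p))"
    have "?b p' * (mom M 4 (?X Z') + mom M 4 (?Y Z')) \<le>
        c' - gap M (W (fst p')) (V (snd p')) (?X Z') (?Y Z') - g p'"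
    proof (rule *(3))
      show "(\<lambda>n. ?b (p n)) \<longlonglongrightarrow> ?b p'" by (intro tendsto_intros p)
      show "(\<lambda>n. c n - gap M (W (fst (p n))) (V (snd (p n))) (?X (Z n)) (?Y (Z n)) - g (p n))
        \<longlonglongrightarrow> c' - gap M (W (fst p')) (V (snd p')) (?X Z') (?Y Z') - g p'"
        by (intro tendsto_diff c gap_lim g_lim)
      show "?b (p n) * (mom M 4 (?X (Z n)) + mom M 4 (?Y (Z n))) \<le>
          c n - gap M (W (fst (p n))) (V (snd (p n))) (?X (Z n)) (?Y (Z n)) - g (p n)" for n
        using c(1)[of n] by (simp add: f_def doubled_def)
    qed (use \<alpha> in auto)
    then show ?thesis using ZD by (simp add: f_def doubled_def)
  qed
  have K: "compact K" "p0 \<in> K" using g(3) p0 C0 by (auto simp: K_def)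
  obtain H p Z where H: "H \<in> hilb M" "mom M 2 H \<le> min \<eta> 1" and pZ: "p \<in> K" "Z \<in> D"
    and min: "\<And>p' Z'. p' \<in> K \<Longrightarrow> Z' \<in> D \<Longrightarrow> f p Z + ip M H Z \<le> f p' Z' + ip M H Z'"
  proof (rule stegall_L2[of K D M "\<rho> + 2" "- C0" f "min \<eta> 1"])
    show "compact K" "K \<noteq> {}" "D \<subseteq> hilb M" "D \<noteq> {}" using K D0 Dh(1) by auto
    show "min \<eta> 1 > 0" using \<eta> by simp
    show "mom M 2 Z \<le> \<rho> + 2" if "Z \<in> D" for Z using that by (rule Dh(2))
    show "- C0 \<le> f p Z" if "p \<in> K" "Z \<in> D" for p Z using that by (rule fge)
    show "Z' \<in> D \<and> f p' Z' \<le> c'"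
      if "\<And>n. p n \<in> K" "p \<longlonglongrightarrow> p'" "p' \<in> K" "\<And>n. Z n \<in> D" "dom_conv M Z Z' G"
        "\<And>n::nat. f (p n) (Z n) \<le> c n" "c \<longlonglongrightarrow> c'" for p p' Z Z' G c c'
      using that by (rule lsc)
  qed (rule that)
  let ?h = "\<lambda>\<omega>. fst (H \<omega>)" and ?k = "\<lambda>\<omega>. snd (H \<omega>)"
  have h: "?h \<in> hilb M" "mom M 2 ?h \<le> min \<eta> 1" and k: "?k \<in> hilb M" "mom M 2 ?k \<le> min \<eta> 1"
    using fst_hilb[OF H(1)] snd_hilb[OF H(1)] H(2) by auto
  obtain t s where p: "p = (t, s)" by (cases p)
  let ?v = "?J (t, s) (?X Z) (?Y Z) + ip M ?h (?X Z) + ip M ?k (?Y Z)"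
  have v: "f p Z + ip M H Z = ?v" unfolding f_def p ip_pair[OF H(1) Dh(1)[OF pZ(2)]] by simp
  have v0: "?v \<le> g p0"
    using min[OF K(2) D0] unfolding v by (simp add: f_def J0 ip0) (simp add: ip_def zero_prod_def[symmetric])
  show ?thesis
  proof (rule that[of ?h ?k t s "?X Z" "?Y Z"])
    show "(t, s) \<in> S" "?X Z \<in> Lq M 4" "?Y Z \<in> Lq M 4" using pZ p by (auto simp: K_def D_def)
    fix t' s' and X' Y' :: "'a \<Rightarrow> 'b" assume a: "(t', s') \<in> S" "X' \<in> Lq M 4" "Y' \<in> Lq M 4"
    let ?w = "?J (t', s') X' Y' + ip M ?h X' + ip M ?k Y'"
    show "?v \<le> ?w"
    proof (cases "g (t', s') \<le> g p0 + C0 \<and> mom M 4 X' + mom M 4 Y' \<le> \<rho>")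
      case True
      let ?Z = "\<lambda>\<omega>. (X' \<omega>, Y' \<omega>)"
      have Z: "?Z \<in> D" and K: "(t', s') \<in> K" using a True by (auto simp: D_def K_def)
      show ?thesis using min[OF K Z] unfolding v ip_pair[OF H(1) Dh(1)[OF Z]] by (simp add: f_def)
    next
      case False
      have "g (t', s') + (\<alpha> / 2) * (mom M 4 X' + mom M 4 Y') - C0 \<le> ?w"
        using h k by (intro coercive a) auto
      moreover have "g p0 + C0 \<le> g (t', s') + (\<alpha> / 2) * (mom M 4 X' + mom M 4 Y')"
      proof (cases "g (t', s') \<le> g p0 + C0")
        case True
        then have "\<rho> \<le> mom M 4 X' + mom M 4 Y'" using False by simp
        then have "(\<alpha> / 2) * \<rho> \<le> (\<alpha> / 2) * (mom M 4 X' + mom M 4 Y')" using \<alpha> by (intro mult_left_mono) auto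
        then show ?thesis using \<rho>(1) g(2)[OF a(1)] by linarith
      next
        case False
        moreover have "0 \<le> (\<alpha> / 2) * (mom M 4 X' + mom M 4 Y')" using \<alpha> by simp
        ultimately show ?thesis by linarith
      qed
      ultimately show ?thesis using v0 by linarith
    qed
  qed (use h k in auto)
qed

end

section \<open>The first-order inequality at a minimum\<close>

lemma emoment_finite: "X \<in> Lq M q \<Longrightarrow> emoment M q X = ennreal (mom M q X)"
  unfolding emoment_def mom_def by (rule nn_integral_eq_integral) (auto simp: Lq_def)

lemma emoment_infinite:
  assumes "X \<in> borel_measurable M" "X \<notin> Lq M q"
  shows "emoment M q X = \<infinity>"
proof (rule ccontr)
  assume "emoment M q X \<noteq> \<infinity>"
  then have "integrable M (\<lambda>\<omega>. norm (X \<omega>) ^ q)"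
    using assms(1) by (intro integrableI_bounded) (auto simp: emoment_def less_top[symmetric])
  then show False using assms by (simp add: Lq_def)
qed

lemma test_fun_finite:
  "X \<in> Lq M 4 \<Longrightarrow> test_fun M \<phi> h \<alpha> l t X = ereal (\<phi> t + ip M h X - \<alpha> * exp (l * t) * mom M 4 X)"
  by (simp add: test_fun_def emoment_finite enn2ereal_ennreal)

lemma test_fun_infinite:
  "X \<in> borel_measurable M \<Longrightarrow> X \<notin> Lq M 4 \<Longrightarrow> \<alpha> > 0 \<Longrightarrow> test_fun M \<phi> h \<alpha> l t X = -\<infinity>"
  by (simp add: test_fun_def emoment_infinite)

lemma test_fun_dt_eq:
  assumes "X \<in> Lq M 4" "(\<phi> has_real_derivative \<phi>') (at t)"
  shows "test_fun_dt M \<phi> h \<alpha> l t X = \<phi>' - \<alpha> * (l * exp (l * t)) * mom M 4 X"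
  unfolding test_fun_dt_def test_fun_finite[OF assms(1)] real_of_ereal.simps
proof (rule DERIV_imp_deriv)
  have "((\<lambda>s. \<alpha> * exp (l * s) * mom M 4 X) has_real_derivative \<alpha> * (l * exp (l * t)) * mom M 4 X) (at t)"
    by (auto intro!: derivative_eq_intros)
  from DERIV_diff[OF DERIV_add[OF assms(2) DERIV_const[of "ip M h X"]] this]
  show "((\<lambda>s. \<phi> s + ip M h X - \<alpha> * exp (l * s) * mom M 4 X) has_real_derivative
    \<phi>' - \<alpha> * (l * exp (l * t)) * mom M 4 X) (at t)" by simp
qed

lemma E2_nonneg [simp]: "0 \<le> E2 \<mu>"
  unfolding E2_def by (rule integral_nonneg_AE) auto

lemma regular_field_mono:
  assumes W: "regular_field L T W" and "L \<le> L'"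
  shows "regular_field L' T W"
proof -
  have "norm (W t x \<mu>) \<le> L' * (1 + norm x + sqrt (E2 \<mu>))" if "t \<in> {0..T}" "\<mu> \<in> P2" for t x \<mu>
  proof -
    have "L * (1 + norm x + sqrt (E2 \<mu>)) \<le> L' * (1 + norm x + sqrt (E2 \<mu>))"
      using assms(2) by (intro mult_right_mono) auto
    then show ?thesis using regular_fieldD(3)[OF W that] by (rule order_trans[rotated])
  qed
  then show ?thesis using regular_fieldD(1,2)[OF W] assms(2) unfolding regular_field_def by simp
qed

lemma monotone_solution_regular:
  assumes "monotone_solution M T F G W"
  obtains L where "regular_field L T W"
proof -
  have cont: "continuous_W2 ({0..T} \<times> UNIV) (\<lambda>(t, x) \<mu>. W t x \<mu>)"
    using assms unfolding monotone_solution_def by blast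
  obtain L where L: "\<And>t x \<mu>. t \<in> {0..T} \<Longrightarrow> \<mu> \<in> P2 \<Longrightarrow> norm (W t x \<mu>) \<le> L * (1 + norm x + sqrt (E2 \<mu>))"
    using assms unfolding monotone_solution_def by blast
  have "norm (W t x \<mu>) \<le> max L 0 * (1 + norm x + sqrt (E2 \<mu>))" if "t \<in> {0..T}" "\<mu> \<in> P2" for t x \<mu>
  proof -
    have "L * (1 + norm x + sqrt (E2 \<mu>)) \<le> max L 0 * (1 + norm x + sqrt (E2 \<mu>))"
      by (intro mult_right_mono) auto
    then show ?thesis using L[OF that, of x] by linarith
  qed
  then have "regular_field (max L 0) T W" using cont unfolding regular_field_def by simp
  then show ?thesis by (rule that)
qed

lemma C1_locallyI:
  assumes "\<And>s. s < T \<Longrightarrow> (\<phi> has_real_derivative \<phi>' s) (at s)" "continuous_on {..<T} \<phi>'"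
  shows "C1_locally T \<phi>"
  unfolding C1_locally_def
proof (intro allI impI exI[of _ \<phi>'] conjI ballI)
  fix \<tau> t assume "0 < \<tau> \<and> \<tau> < T" "t \<in> {0..\<tau>}"
  then show "(\<phi> has_real_derivative \<phi>' t) (at t within {0..\<tau>})"
    by (intro has_field_derivative_at_within[OF assms(1)]) auto
next
  fix \<tau> assume "0 < \<tau> \<and> \<tau> < T"
  then show "continuous_on {0..\<tau>} \<phi>'" by (intro continuous_on_subset[OF assms(2)]) auto
qed

locale master_equation = prob_space M for M :: "'w measure" +
  fixes T :: real and F G :: "'a::euclidean_space \<Rightarrow> 'a measure \<Rightarrow> 'a \<Rightarrow> 'a" and C :: real
  assumes T_pos: "T > 0" and C_nonneg: "0 \<le> C"
    and F_cont: "continuous_W2 UNIV (\<lambda>(x, u) \<mu>. F x \<mu> u)"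
    and G_cont: "continuous_W2 UNIV (\<lambda>(x, u) \<mu>. G x \<mu> u)"
    and F_growth: "\<mu> \<in> P2 \<Longrightarrow> norm (F x \<mu> u) \<le> C * (1 + norm x + norm u + sqrt (E2 \<mu>))"
    and G_growth: "\<mu> \<in> P2 \<Longrightarrow> norm (G x \<mu> u) \<le> C * (1 + norm x + norm u + sqrt (E2 \<mu>))"
    and FG_monotone: "jointly_L2_monotone M F G"
begin

text \<open>With \<open>\<Lambda>\<close> the growth constant of the drift along a solution, the fourth moment changes at a rate of at
  most \<open>16\<Lambda>\<close> (the factor 4 in the derivative times the bound \<open>4\<Lambda>\<close> for the cubic integral); the rest pays for the
  linear perturbation.\<close>

definition rate :: "real \<Rightarrow> real" where
  "rate \<Lambda> = 16 * \<Lambda> + 1 + 6 * \<Lambda>^2"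

lemma lift2_bound:
  assumes cont: "continuous_W2 UNIV (\<lambda>(x, u) \<mu>. H x \<mu> u)"
    and growth: "\<And>x \<mu> u. \<mu> \<in> P2 \<Longrightarrow> norm (H x \<mu> u) \<le> C * (1 + norm x + norm u + sqrt (E2 \<mu>))"
    and W: "regular_field L T W" and t: "t \<in> {0..T}" and X: "X \<in> hilb M"
  shows "lift2 M H X (lift M (W t) X) \<in> borel_measurable M"
    and "norm (lift2 M H X (lift M (W t) X) \<omega>) \<le> C * (1 + L) * (1 + norm (X \<omega>) + sqrt (mom M 2 X))"
proof -
  have "continuous_on UNIV (\<lambda>(x, u). H x (law M X) u)"
    using continuous_W2_section[OF cont law_P2(1)[OF X]] by (simp add: split_beta')
  then have m: "(\<lambda>(x, u). H x (law M X) u) \<in> borel_measurable (borel \<Otimes>\<^sub>M borel)"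
    unfolding borel_prod by (rule borel_measurable_continuous_onI)
  have "(\<lambda>\<omega>. (X \<omega>, lift M (W t) X \<omega>)) \<in> M \<rightarrow>\<^sub>M borel \<Otimes>\<^sub>M borel"
    using Lq_measurable[OF X] lift_measurable[OF W t X] by measurable
  from measurable_compose[OF this m] show "lift2 M H X (lift M (W t) X) \<in> borel_measurable M"
    by (simp add: lift2_def)
  let ?s = "sqrt (mom M 2 X)" and ?U = "lift M (W t) X"
  have "norm (lift2 M H X ?U \<omega>) \<le> C * (1 + norm (X \<omega>) + norm (?U \<omega>) + ?s)"
    using growth[OF law_P2(1)[OF X], of "X \<omega>" "?U \<omega>"] by (simp add: lift2_def law_P2(2)[OF X])
  also have "\<dots> \<le> C * (1 + norm (X \<omega>) + L * (1 + norm (X \<omega>) + ?s) + ?s)"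
    by (intro mult_left_mono add_mono lift_norm_le[OF W t X] C_nonneg order_refl)
  finally show "norm (lift2 M H X ?U \<omega>) \<le> C * (1 + L) * (1 + norm (X \<omega>) + ?s)"
    by (simp add: algebra_simps)
qed

lemma driftF:
  assumes "regular_field L T W" "t \<in> {0..T}" "X \<in> hilb M"
  shows "lift2 M F X (lift M (W t) X) \<in> borel_measurable M"
    and "norm (lift2 M F X (lift M (W t) X) \<omega>) \<le> C * (1 + L) * (1 + norm (X \<omega>) + sqrt (mom M 2 X))"
proof -
  note * = lift2_bound[where H = F, OF F_cont _ assms]
  show "lift2 M F X (lift M (W t) X) \<in> borel_measurable M" by (rule *(1)) (rule F_growth)
  show "norm (lift2 M F X (lift M (W t) X) \<omega>) \<le> C * (1 + L) * (1 + norm (X \<omega>) + sqrt (mom M 2 X))"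
    by (rule *(2)) (rule F_growth)
qed

lemma driftG:
  assumes "regular_field L T W" "t \<in> {0..T}" "X \<in> hilb M"
  shows "lift2 M G X (lift M (W t) X) \<in> borel_measurable M"
    and "norm (lift2 M G X (lift M (W t) X) \<omega>) \<le> C * (1 + L) * (1 + norm (X \<omega>) + sqrt (mom M 2 X))"
proof -
  note * = lift2_bound[where H = G, OF G_cont _ assms]
  show "lift2 M G X (lift M (W t) X) \<in> borel_measurable M" by (rule *(1)) (rule G_growth)
  show "norm (lift2 M G X (lift M (W t) X) \<omega>) \<le> C * (1 + L) * (1 + norm (X \<omega>) + sqrt (mom M 2 X))"
    by (rule *(2)) (rule G_growth)
qed

lemma drift_hilb:
  assumes "regular_field L T W" "t \<in> {0..T}" "X \<in> hilb M"
  shows "lift2 M F X (lift M (W t) X) \<in> hilb M"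
    "mom M 2 (lift2 M F X (lift M (W t) X)) \<le> 6 * (C * (1 + L))^2 * (1 + mom M 2 X)"
    "lift2 M G X (lift M (W t) X) \<in> hilb M"
    "mom M 2 (lift2 M G X (lift M (W t) X)) \<le> 6 * (C * (1 + L))^2 * (1 + mom M 2 X)"
  using mom2_growth[OF assms(3) driftF[OF assms]] mom2_growth[OF assms(3) driftG[OF assms]] by auto

text \<open>Pointwise, \<open>|X|\<^sup>3 \<le> 1 + |X|\<^sup>4\<close>, and the product \<open>|X|\<^sup>3 E\<^sub>2(X)\<^sup>1\<^sup>/\<^sup>2\<close> is split by Young's inequality into
  \<open>|X|\<^sup>4\<close> and \<open>E\<^sub>2(X)|X|\<^sup>2\<close>, whose expectation is at most the fourth moment.\<close>

lemma cubic_drift_bound: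
  assumes X: "X \<in> Lq M 4" and A: "A \<in> borel_measurable M" and \<Lambda>: "0 \<le> \<Lambda>"
    and le: "\<And>\<omega>. norm (A \<omega>) \<le> \<Lambda> * (1 + norm (X \<omega>) + sqrt (mom M 2 X))"
  shows "\<bar>\<integral>\<omega>. norm (X \<omega>) ^ 2 * (X \<omega> \<bullet> A \<omega>) \<partial>M\<bar> \<le> 4 * \<Lambda> * (1 + mom M 4 X)"
proof -
  let ?s = "mom M 2 X"
  have pt: "\<bar>norm (X \<omega>) ^ 2 * (X \<omega> \<bullet> A \<omega>)\<bar> \<le> \<Lambda> * (1 + 3 * norm (X \<omega>) ^ 4 + ?s * norm (X \<omega>) ^ 2)" for \<omega>
  proof -
    define x where "x = norm (X \<omega>)"
    have x: "0 \<le> x" by (simp add: x_def)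
    have "\<bar>norm (X \<omega>) ^ 2 * (X \<omega> \<bullet> A \<omega>)\<bar> \<le> x^2 * (x * norm (A \<omega>))"
      unfolding x_def abs_mult by (intro mult_mono Cauchy_Schwarz_ineq2) auto
    also have "\<dots> \<le> x^2 * (x * (\<Lambda> * (1 + x + sqrt ?s)))"
      unfolding x_def by (intro mult_left_mono le) auto
    also have "\<dots> = \<Lambda> * (x^3 + x^4 + x^3 * sqrt ?s)" by (simp add: power_numeral_reduce algebra_simps)
    also have "\<dots> \<le> \<Lambda> * ((1 + x^4) + x^4 + (x^4 + ?s * x^2))"
    proof (intro mult_left_mono add_mono \<Lambda> order_refl)
      show "x^3 \<le> 1 + x^4"
      proof (cases "x \<le> 1")
        case True then show ?thesis using power_le_one[OF x True, of 3] zero_le_power[OF x, of 4] by linarith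
      next
        case False then show ?thesis using power_increasing[of 3 4 x] by linarith
      qed
      have "0 \<le> (x^2 - x * sqrt ?s)^2" by simp
      also have "\<dots> = x^4 + ?s * x^2 - 2 * (x^3 * sqrt ?s)"
        by (simp add: power2_diff power_mult_distrib) (simp add: power_numeral_reduce)
      finally have "2 * (x^3 * sqrt ?s) \<le> x^4 + ?s * x^2" by simp
      moreover have "0 \<le> x^3 * sqrt ?s" using x by simp
      ultimately show "x^3 * sqrt ?s \<le> x^4 + ?s * x^2" by linarith
    qed
    finally show ?thesis by (simp add: x_def algebra_simps)
  qed
  have i: "integrable M (\<lambda>\<omega>. norm (X \<omega>) ^ 4)" "integrable M (\<lambda>\<omega>. norm (X \<omega>) ^ 2)"
    using X L4_hilb[OF X] by (auto simp: Lq_def)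
  have i2: "integrable M (\<lambda>\<omega>. \<Lambda> * (1 + 3 * norm (X \<omega>) ^ 4 + ?s * norm (X \<omega>) ^ 2))" using i by auto
  have m: "(\<lambda>\<omega>. norm (X \<omega>) ^ 2 * (X \<omega> \<bullet> A \<omega>)) \<in> borel_measurable M"
    using Lq_measurable[OF X] A by measurable
  have i3: "integrable M (\<lambda>\<omega>. norm (X \<omega>) ^ 2 * (X \<omega> \<bullet> A \<omega>))"
    by (rule Bochner_Integration.integrable_bound[OF i2 m])
       (intro AE_I2, unfold real_norm_def, rule order_trans[OF pt abs_ge_self])
  have "\<bar>\<integral>\<omega>. norm (X \<omega>) ^ 2 * (X \<omega> \<bullet> A \<omega>) \<partial>M\<bar> \<le> (\<integral>\<omega>. \<bar>norm (X \<omega>) ^ 2 * (X \<omega> \<bullet> A \<omega>)\<bar> \<partial>M)"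
    by (rule integral_abs_bound)
  also have "\<dots> \<le> (\<integral>\<omega>. \<Lambda> * (1 + 3 * norm (X \<omega>) ^ 4 + ?s * norm (X \<omega>) ^ 2) \<partial>M)"
    by (intro integral_mono integrable_abs i2 i3 pt)
  also have "\<dots> = \<Lambda> * (1 + 3 * mom M 4 X + ?s^2)"
    using i by (simp add: mom_def prob_space power2_eq_square)
  also have "\<dots> \<le> \<Lambda> * (4 * (1 + mom M 4 X))"
    using mom2_sq_le[OF X] by (intro mult_left_mono \<Lambda>) auto
  finally show ?thesis by (simp add: mult_ac)
qed

text \<open>Young's inequality for \<open>h/\<eta>\<close>, whose norm is at most 1, keeps the bound linear in \<open>\<eta>\<close>.\<close>

lemma ip_perturbation_bound:
  assumes h: "h \<in> hilb M" "mom M 2 h \<le> \<eta>^2" "0 < \<eta>" and A: "A \<in> hilb M" 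
  shows "\<bar>ip M h A\<bar> \<le> \<eta> * ((1 + mom M 2 A) / 2)"
proof -
  have "\<bar>ip M (\<lambda>\<omega>. (1 / \<eta>) *\<^sub>R h \<omega>) A\<bar> \<le> (mom M 2 (\<lambda>\<omega>. (1 / \<eta>) *\<^sub>R h \<omega>) + mom M 2 A) / 2"
    by (intro ip_bound hilb_scale h A)
  also have "mom M 2 (\<lambda>\<omega>. (1 / \<eta>) *\<^sub>R h \<omega>) = mom M 2 h / \<eta>^2"
    by (simp add: mom_def power_divide)
  also have "mom M 2 h / \<eta>^2 \<le> 1" using h by (simp add: divide_simps)
  also have "ip M (\<lambda>\<omega>. (1 / \<eta>) *\<^sub>R h \<omega>) A = ip M h A / \<eta>" by (simp add: ip_def)
  finally have "\<bar>ip M h A\<bar> / \<eta> \<le> (1 + mom M 2 A) / 2" using h(3) by simp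
  then show ?thesis using h(3) by (simp add: divide_simps mult.commute)
qed

text \<open>The defining property of a monotone solution with the test function
  \<open>-q(s) - \<beta> c e\<^bsup>ls\<^esup> - \<langle>h,Z\<rangle> - \<beta> e\<^bsup>ls\<^esup> E\<^sub>4(Z)\<close>, after all terms along the drift have been estimated. Time
  differentiation of the exponential weight produces the factor \<open>l\<close>, everything that is estimated contributes at
  most \<open>K\<close>; hence for \<open>l \<ge> K\<close> only \<open>K \<beta> e\<^bsup>lt\<^esup>\<close> survives on the bad side. The constant \<open>c\<close> stands for the fourth
  moment of the frozen variable.\<close>

lemma first_order_inequality:
  assumes sol: "monotone_solution M T F G W" and W: "regular_field L T W"
    and t: "t \<in> {0<..<T}" and X: "X \<in> Lq M 4" and Y: "Y \<in> hilb M" and V: "V \<in> hilb M"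
    and h: "h \<in> hilb M" "mom M 2 h \<le> \<eta>^2" "0 < \<eta>" "\<eta> \<le> \<beta>" and l: "l > 0" and c: "c \<ge> 0"
    and q: "\<And>s. s < T \<Longrightarrow> (q has_real_derivative q' s) (at s)" "continuous_on {..<T} q'"
    and min: "\<And>s Z. s \<in> {0..<T} \<Longrightarrow> Z \<in> Lq M 4 \<Longrightarrow>
      ip M (lift M (W t) X - V) (X - Y) + \<beta> * exp (l * t) * (mom M 4 X + c) + q t + ip M h X
      \<le> ip M (lift M (W s) Z - V) (Z - Y) + \<beta> * exp (l * s) * (mom M 4 Z + c) + q s + ip M h Z"
  defines "U \<equiv> lift M (W t) X" and "K \<equiv> rate (C * (1 + L))"
  shows "ip M (lift2 M F X U) (U - V) + ip M (lift2 M G X U) (X - Y)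
    \<le> - q' t - (l - K) * (\<beta> * exp (l * t) * (mom M 4 X + c)) + K * (\<beta> * exp (l * t))"
proof -
  let ?A = "lift2 M F X U" and ?B = "lift2 M G X U"
  have \<beta>: "\<beta> > 0" using h by simp
  have t': "t \<in> {0..T}" "t < T" using t by auto
  note X2 = L4_hilb[OF X]
  define h' where "h' = (\<lambda>\<omega>. - h \<omega>)"
  have h'h: "h' \<in> hilb M" using h(1) by (auto simp: h'_def Lq_def)
  have ip_h': "ip M h' Z = - ip M h Z" for Z by (simp add: h'_def ip_minus_left)
  define \<phi> where "\<phi> s = - q s - \<beta> * exp (l * s) * c" for s
  define \<phi>' where "\<phi>' s = - q' s - \<beta> * (l * exp (l * s)) * c" for s
  have \<phi>_deriv: "(\<phi> has_real_derivative \<phi>' s) (at s)" if "s < T" for s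
    unfolding \<phi>_def \<phi>'_def
    by (rule DERIV_diff[OF DERIV_minus[OF q(1)[OF that]]]) (auto intro!: derivative_eq_intros)
  have C1: "C1_locally T \<phi>"
    by (rule C1_locallyI[OF \<phi>_deriv]) (auto simp: \<phi>'_def intro!: continuous_intros q(2))
  have minp: "min_point M T (\<lambda>s Z. ereal (ip M (lift M (W s) Z - V) (Z - Y)) - test_fun M \<phi> h' \<beta> l s Z) t X"
    unfolding min_point_def
  proof (intro ballI)
    fix s and Z :: "'w \<Rightarrow> 'a" assume s: "s \<in> {0..<T}" and Z: "Z \<in> hilb M"
    show "ereal (ip M (lift M (W t) X - V) (X - Y)) - test_fun M \<phi> h' \<beta> l t X
      \<le> ereal (ip M (lift M (W s) Z - V) (Z - Y)) - test_fun M \<phi> h' \<beta> l s Z"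
    proof (cases "Z \<in> Lq M 4")
      case True
      show ?thesis using min[OF s True]
        unfolding test_fun_finite[OF X] test_fun_finite[OF True] ip_h' \<phi>_def
        by (simp add: algebra_simps)
    next
      case False
      then show ?thesis using test_fun_infinite[OF Lq_measurable[OF Z] False \<beta>] by simp
    qed
  qed
  have "ip M ?A (U - V) + ip M ?B (X - Y) \<le> test_fun_dt M \<phi> h' \<beta> l t X + test_fun_dX M h' \<beta> l t X ?A"
    using sol[unfolded monotone_solution_def, THEN conjunct2, THEN conjunct2, rule_format,
        OF Y V h'h \<beta> l t X C1 minp] unfolding Let_def U_def .
  also have "\<dots> = - q' t - l * (\<beta> * exp (l * t) * (mom M 4 X + c)) - ip M h ?A
      - 4 * (\<beta> * exp (l * t)) * (\<integral>\<omega>. norm (X \<omega>) ^ 2 * (X \<omega> \<bullet> ?A \<omega>) \<partial>M)"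
    unfolding test_fun_dt_eq[OF X \<phi>_deriv[OF t'(2)]] test_fun_dX_def ip_h' \<phi>'_def
    by (simp add: algebra_simps)
  also have "\<dots> \<le> - q' t - l * (\<beta> * exp (l * t) * (mom M 4 X + c)) + K * (\<beta> * exp (l * t)) * (1 + mom M 4 X)"
  proof -
    define \<Lambda> where "\<Lambda> = C * (1 + L)"
    have K\<Lambda>: "K = rate \<Lambda>" by (simp add: K_def \<Lambda>_def)
    have \<Lambda>: "0 \<le> \<Lambda>" using C_nonneg regular_fieldD(1)[OF W] by (simp add: \<Lambda>_def)
    note A = drift_hilb(1,2)[OF W t'(1) X2, folded U_def \<Lambda>_def]
    let ?b = "\<beta> * exp (l * t)" and ?m = "mom M 4 X"
    have b: "\<beta> \<le> ?b" "0 < ?b" using \<beta> l t by auto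
    have "\<bar>ip M h ?A\<bar> \<le> \<eta> * ((1 + mom M 2 ?A) / 2)" by (rule ip_perturbation_bound[OF h(1-3) A(1)])
    also have "\<dots> \<le> ?b * ((1 + 6 * \<Lambda>^2) * (1 + ?m))"
    proof (rule mult_mono)
      have "6 * \<Lambda>^2 * (1 + mom M 2 X) \<le> 6 * \<Lambda>^2 * (1 + (?m + 1))"
        using mom2_le_mom4[OF X, of 1] by (intro mult_left_mono) auto
      also have "\<dots> \<le> 6 * \<Lambda>^2 * (2 * (1 + ?m))" by (intro mult_left_mono) auto
      also have "\<dots> = 12 * \<Lambda>^2 * (1 + ?m)" by simp
      finally have "mom M 2 ?A \<le> 12 * \<Lambda>^2 * (1 + ?m)" using A(2) by linarith
      moreover have "(1 + 6 * \<Lambda>^2) * (1 + ?m) = (1 + ?m) + (12 * \<Lambda>^2 * (1 + ?m)) / 2"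
        by (simp add: algebra_simps)
      moreover have "0 \<le> ?m" by simp
      ultimately show "(1 + mom M 2 ?A) / 2 \<le> (1 + 6 * \<Lambda>^2) * (1 + ?m)" by argo
    qed (use order_trans[OF h(4) b(1)] b in auto)
    finally have 1: "- ip M h ?A \<le> ?b * ((1 + 6 * \<Lambda>^2) * (1 + ?m))" by (rule abs_le_D2)
    have "- (\<integral>\<omega>. norm (X \<omega>) ^ 2 * (X \<omega> \<bullet> ?A \<omega>) \<partial>M) \<le> 4 * \<Lambda> * (1 + ?m)"
      by (rule abs_le_D2, rule cubic_drift_bound[OF X driftF(1)[OF W t'(1) X2, folded U_def] \<Lambda>
          driftF(2)[OF W t'(1) X2, folded U_def \<Lambda>_def]])
    then have 2: "(4 * ?b) * - (\<integral>\<omega>. norm (X \<omega>) ^ 2 * (X \<omega> \<bullet> ?A \<omega>) \<partial>M) \<le> (4 * ?b) * (4 * \<Lambda> * (1 + ?m))"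
      using b by (intro mult_left_mono) auto
    have 3: "K * ?b * (1 + ?m) = ?b * ((1 + 6 * \<Lambda>^2) * (1 + ?m)) + (4 * ?b) * (4 * \<Lambda> * (1 + ?m))"
      unfolding K\<Lambda> rate_def by (simp add: algebra_simps)
    show ?thesis using 1 2 unfolding 3 mult_minus_right by argo
  qed
  also have "\<dots> \<le> - q' t - (l - K) * (\<beta> * exp (l * t) * (mom M 4 X + c)) + K * (\<beta> * exp (l * t))"
  proof -
    have "0 \<le> K" using C_nonneg regular_fieldD(1)[OF W] unfolding K_def rate_def by simp
    then have "0 \<le> K * (\<beta> * exp (l * t)) * c" using \<beta> c by simp
    then show ?thesis by (simp add: algebra_simps)
  qed
  finally show ?thesis .
qed

end

section \<open>The initial layer\<close>

lemma ip_diff_split: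
  assumes "A \<in> hilb M" "A' \<in> hilb M" "U \<in> hilb M" "V \<in> hilb M"
  shows "ip M (A - A') (U - V) = ip M A (U - V) + ip M A' (V - U)"
proof -
  have "integrable M (\<lambda>\<omega>. A \<omega> \<bullet> (U - V) \<omega>)" "integrable M (\<lambda>\<omega>. A' \<omega> \<bullet> (V - U) \<omega>)"
    by (intro hilb_integrable_inner hilb_diff assms)+
  from Bochner_Integration.integral_add[OF this]
  have "(\<integral>\<omega>. A \<omega> \<bullet> (U - V) \<omega> + A' \<omega> \<bullet> (V - U) \<omega> \<partial>M) = ip M A (U - V) + ip M A' (V - U)"
    unfolding ip_def .
  moreover have "(\<lambda>\<omega>. (A - A') \<omega> \<bullet> (U - V) \<omega>) = (\<lambda>\<omega>. A \<omega> \<bullet> (U - V) \<omega> + A' \<omega> \<bullet> (V - U) \<omega>)"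
    by (auto simp: inner_diff_left inner_diff_right)
  ultimately show ?thesis unfolding ip_def[of M "A - A'"] by simp
qed

text \<open>The terms \<open>\<gamma>/(T-t)\<close> and \<open>\<gamma>/(T-s)\<close> make the sublevel sets compact although final time is excluded; their
  derivatives have a favourable sign.\<close>

definition time_penalty :: "real \<Rightarrow> (real \<times> real \<Rightarrow> real) \<Rightarrow> real \<Rightarrow> real \<times> real \<Rightarrow> real" where
  "time_penalty T r \<gamma> p = r p + \<gamma> / (T - fst p) + \<gamma> / (T - snd p)"

lemma time_penalty_admissible:
  assumes S0: "closed S0" "S0 \<subseteq> {0..T} \<times> {0..T}" and r: "continuous_on UNIV r" "\<And>p. p \<in> S0 \<Longrightarrow> 0 \<le> r p"
    and \<gamma>: "\<gamma> > 0"
  defines "S \<equiv> {p\<in>S0. fst p < T \<and> snd p < T}"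
  shows "continuous_on S (time_penalty T r \<gamma>)" "p \<in> S \<Longrightarrow> 0 \<le> time_penalty T r \<gamma> p"
    "compact {p\<in>S. time_penalty T r \<gamma> p \<le> c}"
proof -
  show cont: "continuous_on S (time_penalty T r \<gamma>)"
    unfolding time_penalty_def by (intro continuous_intros continuous_on_subset[OF r(1)]) (auto simp: S_def)
  have pos: "0 \<le> r p" "0 < \<gamma> / (T - fst p)" "0 < \<gamma> / (T - snd p)" if "p \<in> S" for p
    using that \<gamma> r(2) by (auto simp: S_def)
  show "0 \<le> time_penalty T r \<gamma> p" if "p \<in> S" for p using pos[OF that] by (simp add: time_penalty_def)
  show "compact {p\<in>S. time_penalty T r \<gamma> p \<le> c}"
  proof (cases "c > 0")
    case False
    then have *: "{p\<in>S. time_penalty T r \<gamma> p \<le> c} = {}" using pos by (force simp: time_penalty_def)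
    show ?thesis unfolding * by simp
  next
    case True
    define R where "R = S0 \<inter> ({..T - \<gamma> / c} \<times> {..T - \<gamma> / c})"
    have "\<gamma> / c > 0" using True \<gamma> by simp
    then have RS: "R \<subseteq> S" by (auto simp: R_def S_def)
    have R: "closed R" unfolding R_def by (intro closed_Int closed_Times S0) auto
    have "closed (R \<inter> time_penalty T r \<gamma> -` {..c})"
      by (rule continuous_closed_preimage[OF continuous_on_subset[OF cont RS] R]) simp
    moreover have "bounded (R \<inter> time_penalty T r \<gamma> -` {..c})"
      by (rule bounded_subset[of "{0..T} \<times> {0..T}"]) (use S0(2) in \<open>auto simp: R_def intro!: bounded_Times\<close>)
    moreover have "{p\<in>S. time_penalty T r \<gamma> p \<le> c} = R \<inter> time_penalty T r \<gamma> -` {..c}"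
    proof (intro equalityI subsetI)
      fix p assume "p \<in> {p\<in>S. time_penalty T r \<gamma> p \<le> c}"
      then have p: "p \<in> S" "time_penalty T r \<gamma> p \<le> c" by auto
      then have "\<gamma> / (T - fst p) \<le> c" "\<gamma> / (T - snd p) \<le> c" using pos[OF p(1)] by (auto simp: time_penalty_def)
      then have "\<gamma> / c \<le> T - fst p" "\<gamma> / c \<le> T - snd p"
        using p(1) True by (auto simp: S_def divide_simps mult.commute)
      then show "p \<in> R \<inter> time_penalty T r \<gamma> -` {..c}" using p by (auto simp: R_def S_def mem_Times_iff)
    qed (use RS in auto)
    ultimately show ?thesis by (simp add: compact_eq_bounded_closed)
  qed
qed

lemma blowup_deriv:
  assumes "s < (T::real)"
  shows "((\<lambda>s. \<gamma> / (T - s)) has_real_derivative \<gamma> / (T - s)^2) (at s)"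
  using assms by (auto intro!: derivative_eq_intros simp: power2_eq_square)

context master_equation
begin

lemma perturbation_bound_L4:
  assumes "h \<in> hilb M" "mom M 2 h \<le> \<eta>^2" "0 < \<eta>" and X: "X \<in> Lq M 4"
  shows "\<bar>ip M h X\<bar> \<le> \<eta> + (\<eta> / 2) * mom M 4 X"
proof -
  have "\<eta> * ((1 + mom M 2 X) / 2) \<le> \<eta> * ((1 + (mom M 4 X + 1)) / 2)"
    using mom2_le_mom4[OF X, of 1] assms(3) by (intro mult_left_mono) auto
  also have "\<dots> = \<eta> + (\<eta> / 2) * mom M 4 X" by (simp add: algebra_simps)
  finally show ?thesis using ip_perturbation_bound[OF assms(1-3) L4_hilb[OF X]] by linarith
qed

lemma perturbation_pair_le:
  assumes "h \<in> hilb M" "mom M 2 h \<le> \<eta>^2" "k \<in> hilb M" "mom M 2 k \<le> \<eta>^2" "0 < \<eta>"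
    and "X \<in> hilb M" "Y \<in> hilb M"
  shows "ip M h X + ip M k Y \<le> \<eta> * (2 + mom M 2 X + mom M 2 Y)"
proof -
  have "ip M h X \<le> \<eta> * ((1 + mom M 2 X) / 2)" "ip M k Y \<le> \<eta> * ((1 + mom M 2 Y) / 2)"
    by (rule abs_le_D1[OF ip_perturbation_bound[OF assms(1,2,5,6)]]
      abs_le_D1[OF ip_perturbation_bound[OF assms(3,4,5,7)]])+
  moreover have "\<eta> * ((1 + mom M 2 X) / 2) \<le> \<eta> * (1 + mom M 2 X)"
    "\<eta> * ((1 + mom M 2 Y) / 2) \<le> \<eta> * (1 + mom M 2 Y)"
    using assms(5) mom_nonneg[of M 2 X] mom_nonneg[of M 2 Y] by (auto intro!: mult_left_mono simp: field_simps)
  moreover have "\<eta> * (2 + mom M 2 X + mom M 2 Y) = \<eta> * (1 + mom M 2 X) + \<eta> * (1 + mom M 2 Y)"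
    by (simp add: algebra_simps)
  ultimately show ?thesis by linarith
qed

text \<open>Used where monotonicity of the coefficients is of no help, because only one of the two fields solves the
  equation: the pairing is then merely bounded below by second moments.\<close>

lemma drift_pairing_bound:
  assumes W: "regular_field L T W" and V: "regular_field L T V" and ts: "t \<in> {0..T}" "s \<in> {0..T}"
    and X: "X \<in> hilb M" and Y: "Y \<in> hilb M"
  defines "U \<equiv> lift M (V s) Y"
  shows "- (6 * (C * (1 + L))^2 + 12 * L^2 + 1) * (2 + mom M 2 X + mom M 2 Y)
    \<le> ip M (lift2 M F Y U) (U - lift M (W t) X) + ip M (lift2 M G Y U) (Y - X)"
proof -
  define \<Lambda> where "\<Lambda> = C * (1 + L)"
  note A = drift_hilb[OF V ts(2) Y, folded U_def \<Lambda>_def]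
  note U = lift_hilb[OF V ts(2) Y, folded U_def] and W' = lift_hilb[OF W ts(1) X]
  have 1: "- ip M (lift2 M F Y U) (U - lift M (W t) X) \<le> (mom M 2 (lift2 M F Y U) + mom M 2 (U - lift M (W t) X)) / 2"
    by (intro abs_le_D2 ip_bound A hilb_diff U W')
  have 2: "- ip M (lift2 M G Y U) (Y - X) \<le> (mom M 2 (lift2 M G Y U) + mom M 2 (Y - X)) / 2"
    by (intro abs_le_D2 ip_bound A hilb_diff X Y)
  have 3: "6 * c * (1 + d) = 6 * c + 6 * (c * d)" for c d :: real by (simp add: algebra_simps)
  have 4: "- (6 * \<Lambda>^2 + 12 * L^2 + 1) * (2 + mom M 2 X + mom M 2 Y) = - 12 * \<Lambda>^2 - 6 * (\<Lambda>^2 * mom M 2 X)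
     - 6 * (\<Lambda>^2 * mom M 2 Y) - 24 * L^2 - 12 * (L^2 * mom M 2 X) - 12 * (L^2 * mom M 2 Y) - 2 - mom M 2 X - mom M 2 Y"
    by (simp add: algebra_simps)
  have 5: "0 \<le> \<Lambda>^2 * mom M 2 X" "0 \<le> L^2 * mom M 2 X" "0 \<le> L^2 * mom M 2 Y" "0 \<le> \<Lambda>^2" "0 \<le> L^2" by simp_all
  show ?thesis
    unfolding \<Lambda>_def[symmetric] using 1 2 4 5 mom2_diff_le[OF U(1) W'(1)] mom2_diff_le[OF Y X] A(2,4) U(2) W'(2) unfolding 3 by argo
qed

text \<open>Minimise the doubled functional with \<open>t = 0\<close> and the penalty \<open>\<kappa>s\<close>. At a minimum with \<open>s = 0\<close> the value is
  almost nonnegative by hypothesis. At a minimum with \<open>s > 0\<close> the first-order inequality for \<open>V\<close> together with the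
  crude lower bound \<open>drift_pairing_bound\<close> gives \<open>\<kappa> < P(2 + 2/\<beta>) + K\<alpha>\<close>: the second moments in that bound are
  converted into fourth moments, which the surplus \<open>l - K = P\<close> in the exponential rate absorbs. But the
  right-hand side is the chosen value of \<open>\<kappa>\<close>.\<close>

lemma initial_layer:
  assumes sol: "monotone_solution M T F G V" and V: "regular_field L T V" and W: "regular_field L T W"
    and init: "\<And>X Y. X \<in> hilb M \<Longrightarrow> Y \<in> hilb M \<Longrightarrow> 0 \<le> gap M (W 0) (V 0) X Y" and \<alpha>: "\<alpha> > 0"
  obtains \<kappa> where "0 \<le> \<kappa>" "\<And>s X Y. s \<in> {0..<T} \<Longrightarrow> X \<in> Lq M 4 \<Longrightarrow> Y \<in> Lq M 4 \<Longrightarrow>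
    - \<kappa> * s - \<alpha> * (mom M 4 X + mom M 4 Y) \<le> gap M (W 0) (V s) X Y"
proof -
  define K where "K = rate (C * (1 + L))"
  define P where "P = 6 * (C * (1 + L))^2 + 12 * L^2 + 1"
  have K: "0 \<le> K" using C_nonneg regular_fieldD(1)[OF W] by (simp add: K_def rate_def)
  have P: "0 < P" unfolding P_def by (intro add_nonneg_pos add_nonneg_nonneg) auto
  define l where "l = K + P"
  have l: "l > 0" using K P by (simp add: l_def)
  \<comment> \<open>Compensates for the exponential weight, so that the final bound carries the constant \<open>\<alpha>\<close> itself.\<close>
  define \<beta> where "\<beta> = \<alpha> * exp (- l * T)"
  have \<beta>: "\<beta> > 0" using \<alpha> by (simp add: \<beta>_def)
  have \<beta>_le: "\<beta> * exp (l * s) \<le> \<alpha>" if "s \<le> T" for s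
    using that \<alpha> l by (simp add: \<beta>_def mult.assoc flip: exp_add)
  \<comment> \<open>The strict upper bound that a minimum at positive time would impose on \<open>\<kappa>\<close>.\<close>
  define \<kappa> where "\<kappa> = P * (2 + 2 / \<beta>) + K * \<alpha>"
  have \<kappa>: "0 \<le> \<kappa>" using P K \<alpha> \<beta> by (simp add: \<kappa>_def)
  show ?thesis
  proof (rule that[OF \<kappa>], rule ccontr)
    fix s0 X0 Y0 assume s0: "s0 \<in> {0..<T}" and X0: "X0 \<in> Lq M 4" and Y0: "Y0 \<in> Lq M 4"
      and neg: "\<not> - \<kappa> * s0 - \<alpha> * (mom M 4 X0 + mom M 4 Y0) \<le> gap M (W 0) (V s0) X0 Y0"
    define c where "c = - (gap M (W 0) (V s0) X0 Y0 + \<kappa> * s0 + \<alpha> * (mom M 4 X0 + mom M 4 Y0))"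
    have c: "c > 0" using neg by (simp add: c_def)
    define m0 where "m0 = 2 + mom M 2 X0 + mom M 2 Y0"
    have m0: "m0 \<ge> 2" by (simp add: m0_def)
    define \<eta> where "\<eta> = min \<beta> (c / (8 * m0))"
    have \<eta>: "0 < \<eta>" "\<eta> \<le> \<beta>" "\<eta> * m0 \<le> c / 8" "\<eta> \<le> c / 16"
    proof -
      show "0 < \<eta>" "\<eta> \<le> \<beta>" using c \<beta> m0 by (auto simp: \<eta>_def)
      have "\<eta> * m0 \<le> (c / (8 * m0)) * m0" using m0 by (intro mult_right_mono) (auto simp: \<eta>_def)
      then show *: "\<eta> * m0 \<le> c / 8" using m0 by simp
      have "\<eta> * 2 \<le> \<eta> * m0" using \<open>0 < \<eta>\<close> m0 by (intro mult_left_mono) auto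
      then show "\<eta> \<le> c / 16" using * by simp
    qed
    define \<gamma> where "\<gamma> = c * (T - s0) / 8"
    have \<gamma>: "\<gamma> > 0" "\<gamma> / (T - s0) = c / 8" "\<gamma> / T \<le> c / 8"
      using c s0 by (auto simp: \<gamma>_def divide_simps)
    define r where "r p = \<kappa> * snd p" for p :: "real \<times> real"
    define S where "S = {p \<in> {0} \<times> {0..T}. fst p < T \<and> snd p < T}"
    have S: "(0, s) \<in> S" if "s \<in> {0..<T}" for s using that T_pos by (auto simp: S_def)
    have adm: "continuous_on S (time_penalty T r \<gamma>)" "\<And>p. p \<in> S \<Longrightarrow> 0 \<le> time_penalty T r \<gamma> p"
      "\<And>c. compact {p\<in>S. time_penalty T r \<gamma> p \<le> c}"
      unfolding S_def
      by (rule time_penalty_admissible; use T_pos \<gamma> \<kappa> in \<open>auto simp: r_def intro!: continuous_intros closed_Times\<close>)+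
    have \<eta>2: "0 < \<eta>^2" using \<eta> by simp
    have Ssub: "S \<subseteq> {0..T} \<times> {0..T}" "S \<noteq> {}" using S[OF s0] T_pos by (auto simp: S_def)
    obtain h k t s X Y where h: "h \<in> hilb M" "mom M 2 h \<le> \<eta>^2" and k: "k \<in> hilb M" "mom M 2 k \<le> \<eta>^2"
      and ts: "(t, s) \<in> S" and X: "X \<in> Lq M 4" and Y: "Y \<in> Lq M 4"
      and min: "\<And>t' s' X' Y'. (t', s') \<in> S \<Longrightarrow> X' \<in> Lq M 4 \<Longrightarrow> Y' \<in> Lq M 4 \<Longrightarrow>
        doubled M W V \<beta> l (time_penalty T r \<gamma>) (t, s) X Y + ip M h X + ip M k Y
        \<le> doubled M W V \<beta> l (time_penalty T r \<gamma>) (t', s') X' Y' + ip M h X' + ip M k Y'"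
      using exists_perturbed_min[OF W V \<beta> less_imp_le[OF l] Ssub adm \<eta>2] by blast
    have t: "t = 0" and s: "s \<in> {0..<T}" using ts by (auto simp: S_def)
    note X2 = L4_hilb[OF X] and Y2 = L4_hilb[OF Y]
    have J: "doubled M W V \<beta> l (time_penalty T r \<gamma>) (0, s') X' Y' = gap M (W 0) (V s') X' Y'
      + \<beta> * exp (l * s') * (mom M 4 X' + mom M 4 Y') + (\<kappa> * s' + \<gamma> / T + \<gamma> / (T - s'))" for s' X' Y'
      by (simp add: doubled_def time_penalty_def r_def)
    define v where "v = doubled M W V \<beta> l (time_penalty T r \<gamma>) (t, s) X Y + ip M h X + ip M k Y"
    have "v \<le> doubled M W V \<beta> l (time_penalty T r \<gamma>) (0, s0) X0 Y0 + ip M h X0 + ip M k Y0"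
      unfolding v_def by (rule min[OF S[OF s0] X0 Y0])
    moreover have "\<beta> * exp (l * s0) * (mom M 4 X0 + mom M 4 Y0) \<le> \<alpha> * (mom M 4 X0 + mom M 4 Y0)"
      using s0 by (intro mult_right_mono \<beta>_le) auto
    moreover have "ip M h X0 + ip M k Y0 \<le> \<eta> * m0"
      unfolding m0_def by (rule perturbation_pair_le[OF h k \<eta>(1) L4_hilb[OF X0] L4_hilb[OF Y0]])
    moreover have "gap M (W 0) (V s0) X0 Y0 = - c - \<kappa> * s0 - \<alpha> * (mom M 4 X0 + mom M 4 Y0)"
      by (simp add: c_def)
    ultimately have v_le: "v \<le> - c / 2" using \<gamma>(2,3) \<eta>(3) c unfolding J by argo
    show False
    proof (cases "s = 0")
      case True
      have "- ip M h X \<le> \<eta> + (\<eta> / 2) * mom M 4 X" "- ip M k Y \<le> \<eta> + (\<eta> / 2) * mom M 4 Y"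
        by (intro abs_le_D2 perturbation_bound_L4 h k \<eta> X Y)+
      moreover have "(\<eta> / 2) * mom M 4 X \<le> \<beta> * mom M 4 X" "(\<eta> / 2) * mom M 4 Y \<le> \<beta> * mom M 4 Y"
        by (rule mult_right_mono; use \<eta>(1,2) in simp)+
      moreover have "0 \<le> gap M (W 0) (V 0) X Y" by (rule init[OF X2 Y2])
      moreover have "v = gap M (W 0) (V 0) X Y + \<beta> * mom M 4 X + \<beta> * mom M 4 Y + 2 * (\<gamma> / T) + ip M h X + ip M k Y"
        unfolding v_def t J True by (simp add: algebra_simps)
      moreover have "0 \<le> \<gamma> / T" using \<gamma> T_pos by simp
      ultimately have "- 2 * \<eta> \<le> v" by linarith
      then show False using v_le \<eta> c by linarith
    next
      case False
      then have s': "s \<in> {0<..<T}" using s by auto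
      define q where "q s = \<kappa> * s + \<gamma> / T + \<gamma> / (T - s)" for s
      define q' where "q' s = \<kappa> + \<gamma> / (T - s)^2" for s
      have q: "(q has_real_derivative q' s) (at s)" if "s < T" for s
        unfolding q_def q'_def
        by (rule DERIV_add[OF _ blowup_deriv[OF that]]) (auto intro!: derivative_eq_intros)
      have q'c: "continuous_on {..<T} q'"
        unfolding q'_def by (auto intro!: continuous_intros)
      note W' = lift_hilb[OF W _ X2, of 0]
      let ?U = "lift M (V s) Y"
      have "ip M (lift2 M F Y ?U) (?U - lift M (W 0) X) + ip M (lift2 M G Y ?U) (Y - X)
        \<le> - q' s - (l - K) * (\<beta> * exp (l * s) * (mom M 4 Y + mom M 4 X)) + K * (\<beta> * exp (l * s))"
        unfolding K_def
      proof (rule first_order_inequality[OF sol V s' Y X2 W'(1) k \<eta>(1,2) l _ q q'c])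
        fix s1 and Z :: "'w \<Rightarrow> 'a" assume "s1 \<in> {0..<T}" "Z \<in> Lq M 4"
        from min[OF S[OF this(1)] X this(2)]
        show "ip M (lift M (V s) Y - lift M (W 0) X) (Y - X) + \<beta> * exp (l * s) * (mom M 4 Y + mom M 4 X) + q s + ip M k Y
          \<le> ip M (lift M (V s1) Z - lift M (W 0) X) (Z - X) + \<beta> * exp (l * s1) * (mom M 4 Z + mom M 4 X) + q s1 + ip M k Z"
          unfolding t J gap_flip[of M "W 0"] unfolding gap_def q_def by (simp add: add.commute[of "mom M 4 X"])
      qed (use T_pos in auto)
      moreover have "- P * (2 + mom M 2 X + mom M 2 Y) \<le> ip M (lift2 M F Y ?U) (?U - lift M (W 0) X) + ip M (lift2 M G Y ?U) (Y - X)"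
        unfolding P_def by (rule drift_pairing_bound[OF W V _ _ X2 Y2]) (use s' T_pos in auto)
      moreover have "P * (2 + mom M 2 X + mom M 2 Y) \<le> P * (2 + (\<beta> * mom M 4 X + 1 / \<beta>) + (\<beta> * mom M 4 Y + 1 / \<beta>))"
        using P by (intro mult_left_mono add_mono mom2_le_mom4 X Y \<beta>) auto
      moreover have "\<dots> = P * (2 + 2 / \<beta>) + P * (\<beta> * (mom M 4 Y + mom M 4 X))" by (simp add: algebra_simps)
      moreover have "P * (\<beta> * (mom M 4 Y + mom M 4 X)) \<le> (l - K) * (\<beta> * exp (l * s) * (mom M 4 Y + mom M 4 X))"
      proof -
        have "\<beta> \<le> \<beta> * exp (l * s)" using \<beta> l s' by simp
        then show ?thesis unfolding l_def using P less_imp_le[OF \<beta>] by (intro mult_mono) auto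
      qed
      moreover have "K * (\<beta> * exp (l * s)) \<le> K * \<alpha>" using K s by (intro mult_left_mono \<beta>_le) auto
      moreover have "\<kappa> < q' s" using \<gamma> s by (simp add: q'_def)
      ultimately show False unfolding \<kappa>_def by linarith
    qed
  qed
qed

section \<open>Comparison by doubling the time variable\<close>

text \<open>The parameters are fixed in the order \<open>l\<close>, \<open>\<delta>\<close>, \<open>\<alpha>\<close>, then the constants \<open>\<kappa>\<close>
  of the initial layers, which depend on \<open>\<alpha>\<close>, then \<open>N\<close>, \<open>\<gamma>\<close> and \<open>\<eta>\<close>. Each penalty is so small at \<open>(t\<^sub>0, X\<^sub>0, Y\<^sub>0)\<close>
  that the minimal value \<open>v\<close> is at most \<open>-c/2\<close>.\<close>

lemma gap_nonneg_L4:
  assumes solW: "monotone_solution M T F G W" and W: "regular_field L T W"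
    and solV: "monotone_solution M T F G V" and V: "regular_field L T V"
    and init: "\<And>X Y. X \<in> hilb M \<Longrightarrow> Y \<in> hilb M \<Longrightarrow> 0 \<le> gap M (W 0) (V 0) X Y"
    and t0: "t0 \<in> {0..<T}" and X0: "X0 \<in> Lq M 4" and Y0: "Y0 \<in> Lq M 4"
  shows "0 \<le> gap M (W t0) (V t0) X0 Y0"
proof (rule ccontr)
  define c where "c = - gap M (W t0) (V t0) X0 Y0"
  assume "\<not> 0 \<le> gap M (W t0) (V t0) X0 Y0"
  then have c: "c > 0" by (simp add: c_def)
  define K where "K = rate (C * (1 + L))"
  have K: "0 \<le> K" using C_nonneg regular_fieldD(1)[OF W] by (simp add: K_def rate_def)
  define l where "l = K + 1"
  have l: "l > 0" using K by (simp add: l_def)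
  define E where "E = exp (2 * l * T)"
  have E: "E > 0" "exp (l * (t + s)) \<le> E" if "t \<le> T" "s \<le> T" for t s
    using that l by (auto simp: E_def)
  have E0: "E > 0" by (simp add: E_def)
  define m4 where "m4 = mom M 4 X0 + mom M 4 Y0"
  have m4: "m4 \<ge> 0" by (simp add: m4_def)
  define m2 where "m2 = 2 + mom M 2 X0 + mom M 2 Y0"
  have m2: "m2 \<ge> 2" by (simp add: m2_def)
  \<comment> \<open>The strict decrease in time that finally contradicts the two first-order inequalities.\<close>
  define \<delta> where "\<delta> = c / (16 * T)"
  have \<delta>: "\<delta> > 0" "\<delta> * (t0 + t0) \<le> c / 8"
    using c t0 T_pos by (auto simp: \<delta>_def divide_simps)
  \<comment> \<open>The first bound keeps the penalty at \<open>(X\<^sub>0, Y\<^sub>0)\<close> below \<open>c/8\<close>, the second makes \<open>K\<alpha>E < \<delta>\<close>.\<close>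
  define \<alpha> where "\<alpha> = min (c / (8 * E * (m4 + 1))) (\<delta> / (2 * E * (K + 1)))"
  have \<alpha>: "\<alpha> > 0" using c E0 m4 K \<delta> by (simp add: \<alpha>_def)
  have \<alpha>m: "\<alpha> * E * m4 \<le> c / 8"
  proof -
    have "\<alpha> * E * m4 \<le> \<alpha> * (E * (m4 + 1))" using \<alpha> E0 m4 by (simp add: algebra_simps)
    also have "\<dots> \<le> (c / (8 * E * (m4 + 1))) * (E * (m4 + 1))"
      using E0 m4 by (intro mult_right_mono) (auto simp: \<alpha>_def)
    also have "\<dots> = c / 8" using E0 m4 by (simp add: divide_simps)
    finally show ?thesis .
  qed
  have \<alpha>K: "K * (\<alpha> * E) < \<delta>"
  proof -
    have "\<alpha> * (E * (K + 1)) \<le> (\<delta> / (2 * E * (K + 1))) * (E * (K + 1))"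
      using E0 K by (intro mult_right_mono) (auto simp: \<alpha>_def)
    also have "\<dots> = \<delta> / 2" using E0 K by (simp add: divide_simps)
    finally have "K * (\<alpha> * E) + \<alpha> * E \<le> \<delta> / 2" by (simp add: algebra_simps)
    moreover have "0 < \<alpha> * E" using \<alpha> E0 by simp
    ultimately show ?thesis using \<delta>(1) by linarith
  qed
  have \<alpha>2: "\<alpha> / 2 > 0" using \<alpha> by simp
  have init': "0 \<le> gap M (V 0) (W 0) X Y" if "X \<in> hilb M" "Y \<in> hilb M" for X Y
    using init[OF that(2,1)] by (simp add: gap_flip)
  \<comment> \<open>Half of \<open>\<alpha>\<close>, since the other half has to absorb the linear perturbations.\<close>
  obtain \<kappa>1 where \<kappa>1: "0 \<le> \<kappa>1" "\<And>s X Y. s \<in> {0..<T} \<Longrightarrow> X \<in> Lq M 4 \<Longrightarrow> Y \<in> Lq M 4 \<Longrightarrow>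
    - \<kappa>1 * s - (\<alpha> / 2) * (mom M 4 X + mom M 4 Y) \<le> gap M (W 0) (V s) X Y"
    using initial_layer[OF solV V W init \<alpha>2] by blast
  obtain \<kappa>2 where \<kappa>2: "0 \<le> \<kappa>2" "\<And>s X Y. s \<in> {0..<T} \<Longrightarrow> X \<in> Lq M 4 \<Longrightarrow> Y \<in> Lq M 4 \<Longrightarrow>
    - \<kappa>2 * s - (\<alpha> / 2) * (mom M 4 X + mom M 4 Y) \<le> gap M (V 0) (W s) X Y"
    using initial_layer[OF solW W V init' \<alpha>2] by blast
  define \<kappa> where "\<kappa> = \<kappa>1 + \<kappa>2"
  \<comment> \<open>Then \<open>\<kappa>\<^sup>2/(4N) \<le> c/8\<close>, so the quadratic penalty compensates the loss \<open>\<kappa>s\<close> in the initial layer.\<close>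
  define N where "N = 2 * (\<kappa>^2 + 1) / c"
  have N: "N > 0" using c by (simp add: N_def add_nonneg_pos)
  have layer: "- (c / 8) \<le> N * s^2 - \<kappa>' * s" if "0 \<le> s" "0 \<le> \<kappa>'" "\<kappa>' \<le> \<kappa>" for s \<kappa>'
  proof -
    have "0 \<le> N * (s - \<kappa>' / (2 * N))^2" using N by simp
    also have "\<dots> = N * s^2 - \<kappa>' * s + \<kappa>'^2 / (4 * N)"
      using N by (simp add: power2_diff power_divide divide_simps power2_eq_square) (simp add: algebra_simps)
    finally have 1: "- (\<kappa>'^2 / (4 * N)) \<le> N * s^2 - \<kappa>' * s" by simp
    have "\<kappa>'^2 \<le> \<kappa>^2" using that by (intro power_mono) auto
    then have "\<kappa>'^2 / (4 * N) \<le> \<kappa>^2 / (4 * N)" using N by (intro divide_right_mono) auto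
    also have "\<dots> = (c / 8) * (\<kappa>^2 / (\<kappa>^2 + 1))" using c by (simp add: N_def)
    also have "\<dots> \<le> (c / 8) * 1" using c by (intro mult_left_mono) (auto simp: divide_simps add_nonneg_pos)
    finally show ?thesis using 1 by linarith
  qed
  define \<gamma> where "\<gamma> = c * (T - t0) / 16"
  have \<gamma>: "\<gamma> > 0" "\<gamma> / (T - t0) = c / 16" using c t0 by (auto simp: \<gamma>_def divide_simps)
  define \<eta> where "\<eta> = min (\<alpha> / 2) (c / (16 * m2))"
  have \<eta>: "0 < \<eta>" "\<eta> \<le> \<alpha> / 2" "\<eta> * m2 \<le> c / 16" "\<eta> \<le> c / 32"
  proof -
    show "0 < \<eta>" "\<eta> \<le> \<alpha> / 2" using c \<alpha> m2 by (auto simp: \<eta>_def)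
    have "\<eta> * m2 \<le> (c / (16 * m2)) * m2" using m2 by (intro mult_right_mono) (auto simp: \<eta>_def)
    then show *: "\<eta> * m2 \<le> c / 16" using m2 by simp
    have "\<eta> * 2 \<le> \<eta> * m2" using \<open>0 < \<eta>\<close> m2 by (intro mult_left_mono) auto
    then show "\<eta> \<le> c / 32" using * by simp
  qed
  define r where "r p = \<delta> * (fst p + snd p) + N * (fst p - snd p)^2" for p :: "real \<times> real"
  define S where "S = {p \<in> {0..T} \<times> {0..T}. fst p < T \<and> snd p < T}"
  have S: "(t, s) \<in> S" if "t \<in> {0..<T}" "s \<in> {0..<T}" for t s using that by (auto simp: S_def)
  have adm: "continuous_on S (time_penalty T r \<gamma>)" "\<And>p. p \<in> S \<Longrightarrow> 0 \<le> time_penalty T r \<gamma> p"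
    "\<And>c. compact {p\<in>S. time_penalty T r \<gamma> p \<le> c}"
    unfolding S_def
    by (rule time_penalty_admissible; use T_pos \<gamma> \<delta> N in \<open>auto simp: r_def intro!: continuous_intros closed_Times\<close>)+
  have \<eta>2: "0 < \<eta>^2" using \<eta> by simp
  have Ssub: "S \<subseteq> {0..T} \<times> {0..T}" "S \<noteq> {}" using S[OF t0 t0] by (auto simp: S_def)
  obtain h k t s X Y where h: "h \<in> hilb M" "mom M 2 h \<le> \<eta>^2" and k: "k \<in> hilb M" "mom M 2 k \<le> \<eta>^2"
    and ts: "(t, s) \<in> S" and X: "X \<in> Lq M 4" and Y: "Y \<in> Lq M 4"
    and min: "\<And>t' s' X' Y'. (t', s') \<in> S \<Longrightarrow> X' \<in> Lq M 4 \<Longrightarrow> Y' \<in> Lq M 4 \<Longrightarrow>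
      doubled M W V \<alpha> l (time_penalty T r \<gamma>) (t, s) X Y + ip M h X + ip M k Y
      \<le> doubled M W V \<alpha> l (time_penalty T r \<gamma>) (t', s') X' Y' + ip M h X' + ip M k Y'"
    using exists_perturbed_min[OF W V \<alpha> less_imp_le[OF l] Ssub adm \<eta>2] by blast
  have t: "t \<in> {0..<T}" and s: "s \<in> {0..<T}" using ts by (auto simp: S_def)
  note X2 = L4_hilb[OF X] and Y2 = L4_hilb[OF Y]
  have J: "doubled M W V \<alpha> l (time_penalty T r \<gamma>) (t', s') X' Y' = gap M (W t') (V s') X' Y'
    + \<alpha> * exp (l * (t' + s')) * (mom M 4 X' + mom M 4 Y')
    + (\<delta> * (t' + s') + N * (t' - s')^2 + \<gamma> / (T - t') + \<gamma> / (T - s'))" for t' s' X' Y'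
    by (simp add: doubled_def time_penalty_def r_def)
  define v where "v = doubled M W V \<alpha> l (time_penalty T r \<gamma>) (t, s) X Y + ip M h X + ip M k Y"
  have "v \<le> doubled M W V \<alpha> l (time_penalty T r \<gamma>) (t0, t0) X0 Y0 + ip M h X0 + ip M k Y0"
    unfolding v_def by (rule min[OF S[OF t0 t0] X0 Y0])
  moreover have "\<alpha> * exp (l * (t0 + t0)) * m4 \<le> \<alpha> * E * m4"
    using t0 \<alpha> m4 by (intro mult_right_mono mult_left_mono E) auto
  moreover have "ip M h X0 + ip M k Y0 \<le> \<eta> * m2"
    unfolding m2_def by (rule perturbation_pair_le[OF h k \<eta>(1) L4_hilb[OF X0] L4_hilb[OF Y0]])
  moreover have "N * (t0 - t0)^2 = 0" by simp
  ultimately have v_le: "v \<le> - c / 2"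
    using \<gamma>(2) \<eta>(3) c \<delta>(2) \<alpha>m c_def unfolding J m4_def[symmetric] by argo
  have v_ge: "gap M (W t) (V s) X Y + (\<alpha> / 2) * (mom M 4 X + mom M 4 Y) + N * (t - s)^2 - c / 16 \<le> v"
  proof -
    have 1: "- ip M h X \<le> \<eta> + (\<eta> / 2) * mom M 4 X" "- ip M k Y \<le> \<eta> + (\<eta> / 2) * mom M 4 Y"
      by (intro abs_le_D2 perturbation_bound_L4 h k \<eta> X Y)+
    have 2: "(\<eta> / 2) * mom M 4 X \<le> (\<alpha> / 2) * mom M 4 X" "(\<eta> / 2) * mom M 4 Y \<le> (\<alpha> / 2) * mom M 4 Y"
      using \<eta>(2) \<alpha> by (auto intro!: mult_right_mono)
    have "\<alpha> * 1 \<le> \<alpha> * exp (l * (t + s))" using t s l \<alpha> by (intro mult_left_mono) auto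
    then have 3: "\<alpha> * (mom M 4 X + mom M 4 Y) \<le> \<alpha> * exp (l * (t + s)) * (mom M 4 X + mom M 4 Y)"
      by (intro mult_right_mono) auto
    have 4: "\<alpha> * (mom M 4 X + mom M 4 Y) = (\<alpha> / 2) * (mom M 4 X + mom M 4 Y) + (\<alpha> / 2) * mom M 4 X + (\<alpha> / 2) * mom M 4 Y"
      by (simp add: algebra_simps)
    have 5: "0 \<le> \<delta> * (t + s)" "0 \<le> \<gamma> / (T - t)" "0 \<le> \<gamma> / (T - s)" using t s \<delta> \<gamma> by auto
    show ?thesis using 1 2 3 4 5 \<eta>(4) unfolding v_def J by linarith
  qed
  have "t \<noteq> 0"
  proof
    assume [simp]: "t = 0"
    have "- \<kappa>1 * s - (\<alpha> / 2) * (mom M 4 X + mom M 4 Y) \<le> gap M (W t) (V s) X Y"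
      using \<kappa>1(2)[OF s X Y] by simp
    moreover have "- (c / 8) \<le> N * (t - s)^2 - \<kappa>1 * s"
      using layer[of s \<kappa>1] s \<kappa>1(1) \<kappa>2(1) by (simp add: \<kappa>_def)
    ultimately show False using v_le v_ge c by linarith
  qed
  moreover have "s \<noteq> 0"
  proof
    assume [simp]: "s = 0"
    have "- \<kappa>2 * t - (\<alpha> / 2) * (mom M 4 X + mom M 4 Y) \<le> gap M (W t) (V s) X Y"
      using \<kappa>2(2)[OF t Y X] by (simp add: gap_flip[of M "V 0"] add.commute)
    moreover have "- (c / 8) \<le> N * (t - s)^2 - \<kappa>2 * t"
      using layer[of t \<kappa>2] t \<kappa>1(1) \<kappa>2(1) by (simp add: \<kappa>_def)
    ultimately show False using v_le v_ge c by linarith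
  qed
  ultimately have t': "t \<in> {0<..<T}" and s': "s \<in> {0<..<T}" using t s by auto
  have tT: "t \<in> {0..T}" and sT: "s \<in> {0..T}" using t s by auto
  let ?U = "lift M (W t) X" and ?U' = "lift M (V s) Y"
  note U = lift_hilb(1)[OF W tT X2] and U' = lift_hilb(1)[OF V sT Y2]
  let ?A = "lift2 M F X ?U" and ?A' = "lift2 M F Y ?U'" and ?B = "lift2 M G X ?U" and ?B' = "lift2 M G Y ?U'"
  note A = drift_hilb(1,3)[OF W tT X2] and A' = drift_hilb(1,3)[OF V sT Y2]
  let ?w = "\<alpha> * exp (l * (t + s))" and ?m = "mom M 4 X + mom M 4 Y"
  have w: "\<alpha> * exp (l * s) * exp (l * t) = ?w" "\<alpha> * exp (l * t) * exp (l * s) = ?w"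
    by (simp_all add: mult.assoc distrib_left flip: exp_add)
  have exp_ge: "\<alpha> \<le> \<alpha> * exp (l * s)" "\<alpha> \<le> \<alpha> * exp (l * t)" using \<alpha> l t s by auto
  have ineqW: "ip M ?A (?U - ?U') + ip M ?B (X - Y)
      \<le> - (\<delta> + 2 * N * (t - s) + \<gamma> / (T - t)^2) - (l - K) * (?w * ?m) + K * ?w"
  proof -
    define q where "q z = (\<delta> * (z + s) + N * (z - s)^2) + \<gamma> / (T - s) + \<gamma> / (T - z)" for z
    define q' where "q' z = \<delta> + 2 * N * (z - s) + \<gamma> / (T - z)^2" for z
    have q: "(q has_real_derivative q' z) (at z)" if "z < T" for z
      unfolding q_def q'_def
      by (rule DERIV_add[OF _ blowup_deriv[OF that]]) (auto intro!: derivative_eq_intros)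
    have q'c: "continuous_on {..<T} q'" unfolding q'_def by (auto intro!: continuous_intros)
    have \<eta>\<beta>: "\<eta> \<le> \<alpha> * exp (l * s)" using \<eta>(1,2) exp_ge(1) by linarith
    have "ip M ?A (?U - ?U') + ip M ?B (X - Y)
      \<le> - q' t - (l - K) * (\<alpha> * exp (l * s) * exp (l * t) * ?m) + K * (\<alpha> * exp (l * s) * exp (l * t))"
      unfolding K_def
    proof (rule first_order_inequality[OF solW W t' X Y2 U' h \<eta>(1) \<eta>\<beta> l _ q q'c])
      fix z and Z :: "'w \<Rightarrow> 'a" assume z: "z \<in> {0..<T}" "Z \<in> Lq M 4"
      have e: "\<alpha> * exp (l * s) * exp (l * z) = \<alpha> * exp (l * (z + s))" for z
        by (simp add: mult.assoc distrib_left add.commute flip: exp_add)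
      from min[OF S[OF z(1) s] z(2) Y]
      show "ip M (?U - ?U') (X - Y) + \<alpha> * exp (l * s) * exp (l * t) * ?m + q t + ip M h X
        \<le> ip M (lift M (W z) Z - ?U') (Z - Y) + \<alpha> * exp (l * s) * exp (l * z) * (mom M 4 Z + mom M 4 Y) + q z + ip M h Z"
        unfolding J gap_def q_def e by linarith
    qed auto
    then show ?thesis unfolding q'_def w .
  qed
  have ineqV: "ip M ?A' (?U' - ?U) + ip M ?B' (Y - X)
      \<le> - (\<delta> - 2 * N * (t - s) + \<gamma> / (T - s)^2) - (l - K) * (?w * ?m) + K * ?w"
  proof -
    define q where "q z = (\<delta> * (t + z) + N * (t - z)^2) + \<gamma> / (T - t) + \<gamma> / (T - z)" for z
    define q' where "q' z = \<delta> - 2 * N * (t - z) + \<gamma> / (T - z)^2" for z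
    have q: "(q has_real_derivative q' z) (at z)" if "z < T" for z
      unfolding q_def q'_def
      by (rule DERIV_add[OF _ blowup_deriv[OF that]]) (auto intro!: derivative_eq_intros simp: algebra_simps)
    have q'c: "continuous_on {..<T} q'" unfolding q'_def by (auto intro!: continuous_intros)
    have \<eta>\<beta>: "\<eta> \<le> \<alpha> * exp (l * t)" using \<eta>(1,2) exp_ge(2) by linarith
    have "ip M ?A' (?U' - ?U) + ip M ?B' (Y - X)
      \<le> - q' s - (l - K) * (\<alpha> * exp (l * t) * exp (l * s) * (mom M 4 Y + mom M 4 X)) + K * (\<alpha> * exp (l * t) * exp (l * s))"
      unfolding K_def
    proof (rule first_order_inequality[OF solV V s' Y X2 U k \<eta>(1) \<eta>\<beta> l _ q q'c])
      fix z and Z :: "'w \<Rightarrow> 'a" assume z: "z \<in> {0..<T}" "Z \<in> Lq M 4"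
      have e: "\<alpha> * exp (l * t) * exp (l * z) = \<alpha> * exp (l * (t + z))" for z
        by (simp add: mult.assoc distrib_left flip: exp_add)
      from min[OF S[OF t z(1)] X z(2)]
      show "ip M (?U' - ?U) (Y - X) + \<alpha> * exp (l * t) * exp (l * s) * (mom M 4 Y + mom M 4 X) + q s + ip M k Y
        \<le> ip M (lift M (V z) Z - ?U) (Z - X) + \<alpha> * exp (l * t) * exp (l * z) * (mom M 4 Z + mom M 4 X) + q z + ip M k Z"
        unfolding J gap_flip[of M "W t"] unfolding gap_def q_def e add.commute[of "mom M 4 X"] by linarith
    qed auto
    then show ?thesis unfolding q'_def w by (simp add: add.commute)
  qed
  have "0 \<le> ip M (?A - ?A') (?U - ?U') + ip M (?B - ?B') (X - Y)"
    using FG_monotone X2 Y2 U U' unfolding jointly_L2_monotone_def by blast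
  then have mono: "0 \<le> ip M ?A (?U - ?U') + ip M ?B (X - Y) + (ip M ?A' (?U' - ?U) + ip M ?B' (Y - X))"
    unfolding ip_diff_split[OF A(1) A'(1) U U'] ip_diff_split[OF A(2) A'(2) X2 Y2] by simp
  have "K * ?w \<le> K * (\<alpha> * E)" using K \<alpha> tT sT by (intro mult_left_mono E) auto
  moreover have "0 \<le> (l - K) * (?w * ?m)" using \<alpha> by (simp add: l_def)
  moreover have "0 \<le> \<gamma> / (T - t)^2" "0 \<le> \<gamma> / (T - s)^2" using \<gamma> by auto
  ultimately show False using ineqW ineqV mono \<alpha>K by linarith
qed

end

section \<open>From the cross inequality to pointwise equality\<close>

text \<open>Equality at a point \<open>x\<close> passes to limits of the law, in the form needed for both approximation steps below.\<close>

lemma regular_field_eqI: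
  assumes W: "regular_field L T W" and V: "regular_field L' T V" and t: "t \<in> {0..T}"
    and \<mu>: "\<mu> \<in> P2" "\<And>n. \<nu> n \<in> P2" and conv: "\<And>n. W2 (\<nu> n) \<mu> \<le> d n" "d \<longlonglongrightarrow> (0::real)"
    and eq: "\<And>n. W t x (\<nu> n) = V t x (\<nu> n)"
  shows "W t x \<mu> = V t x \<mu>"
proof -
  have lim: "(\<lambda>n. U t x (\<nu> n)) \<longlonglongrightarrow> U t x \<mu>" if "regular_field C T U" for C U
    using continuous_W2_seq[OF regular_fieldD(2)[OF that], of "(t, x)" \<mu> "\<lambda>_. (t, x)" \<nu> d] t \<mu> conv by simp
  show ?thesis using LIMSEQ_unique[OF lim[OF W]] lim[OF V] unfolding eq by blast
qed

lemma mom2_le_zero_imp_AE: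
  assumes "X \<in> hilb M" "mom M 2 X \<le> 0"
  shows "AE \<omega> in M. X \<omega> = 0"
proof -
  have "(\<integral>\<omega>. norm (X \<omega>) ^ 2 \<partial>M) = 0" using assms(2) mom_nonneg[of M 2 X] unfolding mom_def by linarith
  then have "AE \<omega> in M. norm (X \<omega>) ^ 2 = 0"
    using integral_nonneg_eq_0_iff_AE[OF Lq_integrable[OF assms(1)]] by simp
  then show ?thesis by simp
qed

context prob_space
begin

lemma truncation_dom_conv:
  fixes X :: "'a \<Rightarrow> 'b::euclidean_space"
  assumes X: "X \<in> hilb M"
  defines "Xn \<equiv> \<lambda>(n::nat) \<omega>. if norm (X \<omega>) \<le> real n then X \<omega> else 0"
  shows "Xn n \<in> Lq M 4" "dom_conv M Xn X (\<lambda>\<omega>. norm (X \<omega>))"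
proof -
  have [measurable]: "X \<in> borel_measurable M" using X by (rule Lq_measurable)
  have m: "Xn n \<in> borel_measurable M" for n unfolding Xn_def by measurable
  show "Xn n \<in> Lq M 4"
    by (rule LqI[OF m, where g = "\<lambda>_. real n ^ 4"]) (auto simp: Xn_def intro: power_mono)
  have "(\<lambda>n. Xn n \<omega>) \<longlonglongrightarrow> X \<omega>" for \<omega>
  proof (rule tendsto_eventually)
    obtain k :: nat where "norm (X \<omega>) \<le> real k" using real_arch_simple by blast
    then show "\<forall>\<^sub>F n in sequentially. Xn n \<omega> = X \<omega>"
      unfolding eventually_sequentially by (intro exI[of _ k]) (auto simp: Xn_def intro: order_trans)
  qed
  then show "dom_conv M Xn X (\<lambda>\<omega>. norm (X \<omega>))"
    using X m unfolding dom_conv_def by (auto simp: Lq_def) (auto simp: Xn_def)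
qed

text \<open>Truncations of \<open>X\<close> and \<open>Y\<close> lie in \<open>L\<^sup>4\<close>, and final time is approached by \<open>t(1 - 1/(n+2)) < T\<close>.\<close>

lemma gap_nonneg_extend:
  assumes W: "regular_field L T W" and V: "regular_field L T V" and T: "T > 0"
    and nonneg: "\<And>t X Y. t \<in> {0..<T} \<Longrightarrow> X \<in> Lq M 4 \<Longrightarrow> Y \<in> Lq M 4 \<Longrightarrow> 0 \<le> gap M (W t) (V t) X Y"
    and t: "t \<in> {0..T}" and X: "X \<in> hilb M" and Y: "Y \<in> hilb M"
  shows "0 \<le> gap M (W t) (V t) X Y"
proof -
  define tn where "tn n = t * (1 - 1 / real (n + 2))" for n :: nat
  have tn: "tn n \<in> {0..<T}" for n
  proof -
    have "t * (1 - 1 / real (n + 2)) \<le> T * (1 - 1 / real (n + 2))" using t by (intro mult_right_mono) auto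
    also have "\<dots> < T * 1" using T by (intro mult_strict_left_mono) auto
    finally show ?thesis using t by (auto simp: tn_def)
  qed
  have "(\<lambda>n. 1 / real (n + 2)) \<longlonglongrightarrow> 0"
    using LIMSEQ_ignore_initial_segment[OF lim_1_over_n[where 'a = real], of 2] by simp
  from tendsto_mult[OF tendsto_const[of t] tendsto_diff[OF tendsto_const[of 1] this]]
  have tlim: "tn \<longlonglongrightarrow> t" unfolding tn_def by simp
  have tT: "tn n \<in> {0..T}" for n using tn[of n] by auto
  note Xn = truncation_dom_conv[OF X] and Yn = truncation_dom_conv[OF Y]
  have "0 \<le> ip M (lift M (W t) X - lift M (V t) Y) (X - Y)"
    by (rule LIMSEQ_le_const[OF ip_lift_tendsto[OF W V tT tlim tT tlim Xn(2) Yn(2)]])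
       (use nonneg[OF tn Xn(1) Yn(1)] in \<open>auto simp: gap_def\<close>)
  then show ?thesis by (simp add: gap_def)
qed

text \<open>Minty's argument: with \<open>D = W(t,X) - V(t,X)\<close> and \<open>Y\<^sub>n = X + D/(n+1)\<close> the hypothesis says
  \<open>\<langle>W(t,X) - V(t,Y\<^sub>n), D\<rangle> \<le> 0\<close>, and the left-hand side tends to \<open>|D|\<^sup>2\<close>.\<close>

lemma minty_lift_eq:
  assumes W: "regular_field L T W" and V: "regular_field L T V" and t: "t \<in> {0..T}"
    and nonneg: "\<And>X Y. X \<in> hilb M \<Longrightarrow> Y \<in> hilb M \<Longrightarrow> 0 \<le> gap M (W t) (V t) X Y"
    and X: "X \<in> hilb M"
  shows "AE \<omega> in M. lift M (W t) X \<omega> = lift M (V t) X \<omega>"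
proof -
  define D where "D = lift M (W t) X - lift M (V t) X"
  have D: "D \<in> hilb M" unfolding D_def by (intro hilb_diff lift_hilb(1)[OF W t X] lift_hilb(1)[OF V t X])
  define Y where "Y n = (\<lambda>\<omega>. X \<omega> + (1 / real (Suc n)) *\<^sub>R D \<omega>)" for n
  have Yh: "Y n \<in> hilb M" for n unfolding Y_def by (intro hilb_add hilb_scale X D)
  have "(\<lambda>n. Y n \<omega>) \<longlonglongrightarrow> X \<omega> + 0 *\<^sub>R D \<omega>" for \<omega>
    unfolding Y_def by (intro tendsto_intros LIMSEQ_Suc[OF lim_1_over_n])
  moreover have "norm (Y n \<omega>) \<le> norm (X \<omega>) + norm (D \<omega>)" for n \<omega>
  proof -
    have "norm ((1 / real (Suc n)) *\<^sub>R D \<omega>) = (1 / real (Suc n)) * norm (D \<omega>)" by simp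
    also have "\<dots> \<le> 1 * norm (D \<omega>)" by (intro mult_right_mono) auto
    finally show ?thesis unfolding Y_def by (intro norm_triangle_le add_left_mono) simp
  qed
  moreover have "(\<lambda>\<omega>. norm (X \<omega>) + norm (D \<omega>)) \<in> hilb M"
    by (intro hilb_add) (use X D in \<open>auto simp: Lq_def\<close>)
  ultimately have Y: "dom_conv M Y X (\<lambda>\<omega>. norm (X \<omega>) + norm (D \<omega>))"
    using Lq_measurable[OF Yh] Lq_measurable[OF X] unfolding dom_conv_def by simp
  have V': "lift M (V t) (Y n) \<in> hilb M" for n by (rule lift_hilb(1)[OF V t Yh])
  have neg: "ip M (lift M (W t) X - lift M (V t) (Y n)) D \<le> 0" for n
  proof -
    have "0 \<le> gap M (W t) (V t) X (Y n)" by (rule nonneg[OF X Yh])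
    also have "\<dots> = - (1 / real (Suc n)) * ip M (lift M (W t) X - lift M (V t) (Y n)) D"
      unfolding gap_def ip_def Y_def by (simp add: inner_diff_left)
    finally show ?thesis by (simp add: zero_le_mult_iff divide_simps mult_le_0_iff split: if_splits)
  qed
  have "(\<lambda>n. ip M (lift M (W t) X - lift M (V t) (Y n)) D) \<longlonglongrightarrow> ip M (lift M (W t) X - lift M (V t) X) D"
    by (rule dom_conv_ip[OF dom_conv_diff[OF dom_conv_const[OF lift_hilb(1)[OF W t X]]
          dom_conv_lift[OF V t tendsto_const Y]] dom_conv_const[OF D]])
  then have "ip M D D \<le> 0" unfolding D_def[symmetric] by (rule LIMSEQ_le_const2) (use neg in auto)
  then have "AE \<omega> in M. D \<omega> = 0" by (intro mom2_le_zero_imp_AE[OF D]) (simp add: mom2_eq_ip)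
  then show ?thesis by eventually_elim (simp add: D_def)
qed

end

section \<open>Realising laws on the probability space\<close>

context prob_space
begin

definition nonatomic :: bool where
  "nonatomic \<longleftrightarrow> (\<forall>E\<in>events. \<forall>a. 0 \<le> a \<and> a \<le> prob E \<longrightarrow> (\<exists>A\<in>events. A \<subseteq> E \<and> prob A = a))"

text \<open>The function \<open>u \<mapsto> prob(E \<inter> {U \<le> u})\<close> is the distribution function of a finite measure without atoms,
  hence continuous, and the intermediate value theorem applies.\<close>

lemma nonatomicI_continuous_distribution:
  assumes U [measurable]: "U \<in> borel_measurable M" and null: "\<And>u::real. prob {\<omega>\<in>space M. U \<omega> = u} = 0"
  shows nonatomic
  unfolding nonatomic_def
proof (intro ballI allI impI)
  fix E a assume E: "E \<in> events" and a: "0 \<le> a \<and> a \<le> prob E"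
  define \<nu> where "\<nu> = distr (density M (indicator E)) borel U"
  have em: "emeasure \<nu> B = emeasure M (E \<inter> {\<omega>\<in>space M. U \<omega> \<in> B})" if [measurable]: "B \<in> sets borel" for B
  proof -
    have "emeasure \<nu> B = emeasure (density M (indicator E)) {\<omega>\<in>space M. U \<omega> \<in> B}"
      unfolding \<nu>_def by (subst emeasure_distr) (auto simp: vimage_def Int_def conj_commute)
    also have "\<dots> = (\<integral>\<^sup>+\<omega>. indicator E \<omega> * indicator {\<omega>\<in>space M. U \<omega> \<in> B} \<omega> \<partial>M)"
      using E by (subst emeasure_density) auto
    also have "\<dots> = (\<integral>\<^sup>+\<omega>. indicator (E \<inter> {\<omega>\<in>space M. U \<omega> \<in> B}) \<omega> \<partial>M)"
      by (intro nn_integral_cong) (auto split: split_indicator)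
    also have "\<dots> = emeasure M (E \<inter> {\<omega>\<in>space M. U \<omega> \<in> B})"
      by (rule nn_integral_indicator) (use E in simp)
    finally show ?thesis .
  qed
  have ms: "measure \<nu> B = prob (E \<inter> {\<omega>\<in>space M. U \<omega> \<in> B})" if "B \<in> sets borel" for B
    using em[OF that] by (simp add: measure_def)
  have sp: "space \<nu> = UNIV" "sets \<nu> = sets borel" by (simp_all add: \<nu>_def)
  have "finite_measure \<nu>" by (rule finite_measureI) (simp add: sp(1) em)
  then interpret \<nu>: finite_borel_measure \<nu>
    by (intro finite_borel_measure.intro finite_borel_measure_axioms.intro sp(2))
  have cont: "isCont (cdf \<nu>) x" for x
  proof -
    have "measure \<nu> {x} \<le> prob {\<omega>\<in>space M. U \<omega> = x}"
      unfolding ms[of "{x}", simplified] by (intro finite_measure_mono) auto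
    then show ?thesis unfolding \<nu>.isCont_cdf null using measure_nonneg[of \<nu> "{x}"] by linarith
  qed
  have tot: "measure \<nu> (space \<nu>) = prob E"
    unfolding sp(1) by (subst ms) (use sets.sets_into_space[OF E] in \<open>auto intro!: arg_cong[where f=prob]\<close>)
  show "\<exists>A\<in>events. A \<subseteq> E \<and> prob A = a"
  proof (cases "a = 0 \<or> a = prob E")
    case True
    then show ?thesis using E by (auto intro: bexI[of _ "{}"])
  next
    case False
    then have a': "0 < a" "a < prob E" using a by auto
    have "\<forall>\<^sub>F x in at_bot. cdf \<nu> x < a" by (rule order_tendstoD(2)[OF \<nu>.cdf_lim_at_bot a'(1)])
    then obtain x where x: "cdf \<nu> x < a" by (auto simp: eventually_at_bot_linorder)
    have "\<forall>\<^sub>F y in at_top. a < cdf \<nu> y"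
      by (rule order_tendstoD(1)[OF \<nu>.cdf_lim_at_top]) (simp add: tot a')
    then obtain y where y: "a < cdf \<nu> y" by (auto simp: eventually_at_top_linorder)
    have xy: "x \<le> y" using x y \<nu>.cdf_nondecreasing[of y x] by (cases "x \<le> y") auto
    obtain z where "cdf \<nu> z = a"
      using IVT'[of "cdf \<nu>" x a y] x y xy cont by (auto simp: continuous_at_imp_continuous_on)
    then have "prob (E \<inter> {\<omega>\<in>space M. U \<omega> \<in> {..z}}) = a" by (simp add: cdf_def ms)
    then show ?thesis using E by (intro bexI[of _ "E \<inter> {\<omega>\<in>space M. U \<omega> \<in> {..z}}"]) auto
  qed
qed

lemma nonatomic_partition:
  assumes na: nonatomic and "finite S" and p: "\<And>s. s \<in> S \<Longrightarrow> 0 \<le> p s"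
    and "E \<in> events" "(\<Sum>s\<in>S. p s) = prob E"
  shows "\<exists>A. (\<forall>s\<in>S. A s \<in> events \<and> A s \<subseteq> E \<and> prob (A s) = p s) \<and> disjoint_family_on A S"
  using assms(2-)
proof (induction S arbitrary: E rule: finite_induct)
  case empty
  then show ?case by (auto simp: disjoint_family_on_def)
next
  case (insert s S)
  have sum0: "0 \<le> (\<Sum>s\<in>S. p s)" using insert.prems by (intro sum_nonneg) auto
  have "0 \<le> p s \<and> p s \<le> prob E" using insert.prems insert.hyps sum0 by auto
  then obtain A0 where A0: "A0 \<in> events" "A0 \<subseteq> E" "prob A0 = p s"
    using na insert.prems(2) unfolding nonatomic_def by blast
  have "(\<Sum>s\<in>S. p s) = prob (E - A0)"
    using insert.prems insert.hyps A0 by (simp add: finite_measure_Diff)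
  then obtain A where A: "\<forall>s\<in>S. A s \<in> events \<and> A s \<subseteq> E - A0 \<and> prob (A s) = p s" "disjoint_family_on A S"
    using insert.IH[of "E - A0"] insert.prems A0 by auto
  show ?case
  proof (intro exI[of _ "A(s := A0)"] conjI)
    show "\<forall>s'\<in>insert s S. (A(s := A0)) s' \<in> events \<and> (A(s := A0)) s' \<subseteq> E \<and> prob ((A(s := A0)) s') = p s'"
      using A A0 insert.hyps by auto
    show "disjoint_family_on (A(s := A0)) (insert s S)"
      using A insert.hyps unfolding disjoint_family_on_def by auto
  qed
qed

text \<open>Cut the space into events with the required probabilities and let \<open>X\<close> be constant on each. Outside these
  events, that is on a null set, \<open>X\<close> has the default value \<open>0\<close>.\<close>

lemma nonatomic_simple_law:
  fixes f :: "'b \<Rightarrow> 'c::euclidean_space"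
  assumes na: nonatomic and N: "prob_space N" and f: "simple_function N f"
  shows "\<exists>X. X \<in> borel_measurable M \<and> finite (range X) \<and> law M X = law N f"
proof -
  interpret N: prob_space N by (rule N)
  define S where "S = f ` space N"
  have S: "finite S" using f by (simp add: S_def simple_function_def)
  have fm: "f \<in> borel_measurable N" using f by (rule borel_measurable_simple_function)
  define Q where "Q s = f -` {s} \<inter> space N" for s
  have Q: "Q s \<in> N.events" for s unfolding Q_def using fm by (rule measurable_sets) simp
  have Qd: "disjoint_family_on Q S'" for S' by (auto simp: disjoint_family_on_def Q_def)
  have Qsum: "N.prob (\<Union>s\<in>S'. Q s) = (\<Sum>s\<in>S'. N.prob (Q s))" if "S' \<subseteq> S" for S'
    using Q Qd finite_subset[OF that S] by (intro N.finite_measure_finite_Union) auto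
  have "(\<Union>s\<in>S. Q s) = space N" by (auto simp: Q_def S_def)
  then have "(\<Sum>s\<in>S. N.prob (Q s)) = prob (space M)" using Qsum[of S] by (simp add: prob_space N.prob_space)
  then have "\<exists>A. (\<forall>s\<in>S. A s \<in> events \<and> A s \<subseteq> space M \<and> prob (A s) = N.prob (Q s)) \<and> disjoint_family_on A S"
    by (intro nonatomic_partition[OF na S] sets.top) auto
  then obtain A where A: "\<And>s. s \<in> S \<Longrightarrow> A s \<in> events" "\<And>s. s \<in> S \<Longrightarrow> prob (A s) = N.prob (Q s)" "disjoint_family_on A S"
    by blast
  have Asum: "prob (\<Union>s\<in>S'. A s) = (\<Sum>s\<in>S'. prob (A s))" if "S' \<subseteq> S" for S'
    using A(1) that by (intro finite_measure_finite_Union finite_subset[OF that S]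
        disjoint_family_on_mono[OF that A(3)]) auto
  define X where "X \<omega> = (\<Sum>s\<in>S. indicator (A s) \<omega> *\<^sub>R s)" for \<omega>
  have X_eq: "X \<omega> = s" if "s \<in> S" "\<omega> \<in> A s" for \<omega> s
  proof -
    have "indicator (A s') \<omega> *\<^sub>R s' = (if s' = s then s else 0)" if "s' \<in> S" for s'
      using A(3) that \<open>s \<in> S\<close> \<open>\<omega> \<in> A s\<close> by (auto simp: disjoint_family_on_def indicator_def)
    then have "X \<omega> = (\<Sum>s'\<in>S. if s' = s then s else 0)" unfolding X_def by (intro sum.cong) auto
    then show ?thesis using S that by simp
  qed
  have X_zero: "X \<omega> = 0" if "\<And>s. s \<in> S \<Longrightarrow> \<omega> \<notin> A s" for \<omega>
    unfolding X_def using that by (intro sum.neutral) auto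
  have Xm [measurable]: "X \<in> borel_measurable M"
    unfolding X_def using A(1) by (intro borel_measurable_sum borel_measurable_scaleR borel_measurable_indicator) auto
  have "X \<omega> \<in> insert 0 S" for \<omega>
  proof (cases "\<exists>s\<in>S. \<omega> \<in> A s")
    case True
    then obtain s where "s \<in> S" "\<omega> \<in> A s" by blast
    then show ?thesis using X_eq[of s \<omega>] by simp
  next
    case False
    then show ?thesis using X_zero[of \<omega>] by blast
  qed
  then have "range X \<subseteq> insert 0 S" by blast
  then have fin: "finite (range X)" by (rule finite_subset) (simp add: S)
  have U: "(\<Union>s\<in>S. A s) \<in> events" using A S by auto
  have "prob (\<Union>s\<in>S. A s) = 1"
    using Asum[of S] A(2) \<open>(\<Sum>s\<in>S. N.prob (Q s)) = prob (space M)\<close> by (simp add: prob_space)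
  then have ae: "AE \<omega> in M. \<omega> \<in> (\<Union>s\<in>S. A s)" using U by (simp add: prob_eq_1)
  have "law M X = law N f"
  proof (rule measure_eqI)
    fix B assume "B \<in> sets (law M X)"
    then have B [measurable]: "B \<in> sets borel" by simp
    have "prob {\<omega>\<in>space M. X \<omega> \<in> B} = prob (\<Union>s\<in>S \<inter> B. A s)"
    proof (rule finite_measure_eq_AE)
      show "AE \<omega> in M. (\<omega> \<in> {\<omega>\<in>space M. X \<omega> \<in> B}) = (\<omega> \<in> (\<Union>s\<in>S \<inter> B. A s))"
        using ae
      proof eventually_elim
        case (elim \<omega>)
        then obtain s where s: "s \<in> S" "\<omega> \<in> A s" by blast
        have uniq: "s' = s" if "s' \<in> S" "\<omega> \<in> A s'" for s' using X_eq[OF s] X_eq[OF that] by simp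
        have "\<omega> \<in> space M" using sets.sets_into_space[OF A(1)[OF s(1)]] s(2) by blast
        moreover have "\<omega> \<in> (\<Union>s\<in>S \<inter> B. A s) \<longleftrightarrow> s \<in> B" using s uniq by blast
        ultimately show ?case using X_eq[OF s] by simp
      qed
      show "(\<Union>s\<in>S \<inter> B. A s) \<in> events" using A(1) S by (intro sets.finite_UN) auto
      show "{\<omega> \<in> space M. X \<omega> \<in> B} \<in> events" by measurable
    qed
    also have "\<dots> = (\<Sum>s\<in>S \<inter> B. N.prob (Q s))" using Asum[of "S \<inter> B"] A(2) by simp
    also have "\<dots> = N.prob (\<Union>s\<in>S \<inter> B. Q s)" using Qsum[of "S \<inter> B"] by simp
    also have "(\<Union>s\<in>S \<inter> B. Q s) = f -` B \<inter> space N" by (auto simp: Q_def S_def)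
    finally have "prob (X -` B \<inter> space M) = N.prob (f -` B \<inter> space N)"
      by (simp add: vimage_def Int_def conj_commute)
    then show "emeasure (law M X) B = emeasure (law N f) B"
      using fm by (simp add: emeasure_distr emeasure_eq_measure N.emeasure_eq_measure)
  qed simp
  then show ?thesis using Xm fin by blast
qed

lemma finite_range_hilb:
  assumes "X \<in> borel_measurable M" "finite (range X)"
  obtains b where "X \<in> hilb M" "\<And>\<omega>. norm (X \<omega>) \<le> b"
proof -
  obtain b where b: "\<And>\<omega>. norm (X \<omega>) \<le> b"
    using finite_imp_bounded[OF assms(2)] by (auto simp: bounded_iff)
  have "X \<in> hilb M"
    by (rule LqI[OF assms(1), where g = "\<lambda>_. b ^ 2"]) (auto intro!: power_mono b)
  then show ?thesis using b by (rule that)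
qed

text \<open>The lifts only agree almost surely, which says nothing at a point \<open>x\<close> that the law does not charge. Moving
  \<open>X\<close> to \<open>x\<close> on an event of probability \<open>1/(n+1)\<close> gives nearby laws with an atom at \<open>x\<close>.\<close>

lemma eq_on_bounded_laws:
  assumes na: nonatomic and W: "regular_field L T W" and V: "regular_field L T V" and t: "t \<in> {0..T}"
    and eq: "\<And>X. X \<in> hilb M \<Longrightarrow> AE \<omega> in M. lift M (W t) X \<omega> = lift M (V t) X \<omega>"
    and X: "X \<in> hilb M" "\<And>\<omega>. norm (X \<omega>) \<le> b"
  shows "W t x (law M X) = V t x (law M X)"
proof -
  have "\<exists>A\<in>events. A \<subseteq> space M \<and> prob A = 1 / real (Suc n)" for n
    using na[unfolded nonatomic_def, rule_format, OF sets.top, of "1 / real (Suc n)"]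
      sets.sets_into_space by (auto simp: prob_space)
  then obtain A where A: "\<And>n. A n \<in> events" "\<And>n. prob (A n) = 1 / real (Suc n)" by metis
  define Y where "Y n \<omega> = (if \<omega> \<in> A n then x else X \<omega>)" for n \<omega>
  have Ym: "Y n \<in> borel_measurable M" for n
    unfolding Y_def using Lq_measurable[OF X(1)] A(1)[of n] by (intro measurable_If_set) auto
  define c where "c = norm x + b"
  have b0: "0 \<le> b" using X(2) norm_ge_zero order_trans by blast
  have Yh: "Y n \<in> hilb M" for n
  proof (rule LqI[OF Ym, where g = "\<lambda>_. c ^ 2"])
    show "norm (Y n \<omega>) ^ 2 \<le> c ^ 2" for \<omega>
      using X(2)[of \<omega>] b0 norm_ge_zero[of x] by (intro power_mono) (auto simp: Y_def c_def intro: add_increasing)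
  qed simp
  have mom: "mom M 2 (Y n - X) \<le> c^2 * (1 / real (Suc n))" for n
  proof -
    have "mom M 2 (Y n - X) \<le> (\<integral>\<omega>. c^2 * indicator (A n) \<omega> \<partial>M)"
      unfolding mom_def
    proof (rule integral_mono)
      show "integrable M (\<lambda>\<omega>. norm ((Y n - X) \<omega>) ^ 2)" by (rule Lq_integrable[OF hilb_diff[OF Yh X(1)]])
      show "norm ((Y n - X) \<omega>) ^ 2 \<le> c^2 * indicator (A n) \<omega>" for \<omega>
      proof (cases "\<omega> \<in> A n")
        case True
        have "norm (x - X \<omega>) \<le> c" unfolding c_def using X(2)[of \<omega>] by (intro norm_triangle_le_diff add_left_mono) 
        then show ?thesis using True by (simp add: Y_def power_mono)
      qed (simp add: Y_def)
    qed (use A(1)[of n] in \<open>auto simp: less_top[symmetric]\<close>)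
    also have "\<dots> = c^2 * prob (A n)" using A(1)[of n] by simp
    finally show ?thesis by (simp add: A)
  qed
  show ?thesis
  proof (rule regular_field_eqI[OF W V t law_P2(1)[OF X(1)] law_P2(1)[OF Yh]])
    show "W2 (law M (Y n)) (law M X) \<le> sqrt (c^2 * (1 / real (Suc n)))" for n
      using W2_law_le[OF Yh X(1)] real_sqrt_le_mono[OF mom] by (rule order_trans)
    have "(\<lambda>n. sqrt (c^2 * (1 / real (Suc n)))) \<longlonglongrightarrow> sqrt (c^2 * 0)"
      by (intro tendsto_real_sqrt tendsto_mult tendsto_const LIMSEQ_Suc[OF lim_1_over_n])
    then show "(\<lambda>n. sqrt (c^2 * (1 / real (Suc n)))) \<longlonglongrightarrow> 0" by simp
    show "W t x (law M (Y n)) = V t x (law M (Y n))" for n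
    proof (rule ccontr)
      assume ne: "W t x (law M (Y n)) \<noteq> V t x (law M (Y n))"
      have "AE \<omega> in M. \<omega> \<notin> A n"
        using eq[OF Yh[of n]] by eventually_elim (use ne in \<open>auto simp: lift_def Y_def\<close>)
      then have "prob (A n) = 0" using prob_eq_0[OF A(1)[of n]] by simp
      then show False by (simp add: A)
    qed
  qed
qed

text \<open>The identity on \<open>\<mu>\<close> is a dominated limit of simple functions, and each simple law is realised on \<open>M\<close>.\<close>

lemma eq_everywhere:
  fixes W V :: "real \<Rightarrow> 'b::euclidean_space \<Rightarrow> 'b measure \<Rightarrow> 'b"
  assumes na: nonatomic and W: "regular_field L T W" and V: "regular_field L T V" and t: "t \<in> {0..T}"
    and eq: "\<And>X. X \<in> hilb M \<Longrightarrow> AE \<omega> in M. lift M (W t) X \<omega> = lift M (V t) X \<omega>"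
    and \<mu>: "\<mu> \<in> P2"
  shows "W t x \<mu> = V t x \<mu>"
proof -
  interpret \<mu>: prob_space \<mu> using \<mu> by (rule P2_prob)
  note id = id_hilb[OF \<mu>]
  obtain f where "(\<forall>n. simple_function \<mu> (f n)) \<and> (\<forall>y\<in>space \<mu>. (\<lambda>n. f n y) \<longlonglongrightarrow> y) \<and>
    (\<forall>n. \<forall>y\<in>space \<mu>. dist (f n y) 0 \<le> 2 * dist y 0)"
    using borel_measurable_implies_sequence_metric[OF Lq_measurable[OF id]] ..
  then have f: "\<And>n. simple_function \<mu> (f n)" "\<And>y. y \<in> space \<mu> \<Longrightarrow> (\<lambda>n. f n y) \<longlonglongrightarrow> y"
    "\<And>n y. y \<in> space \<mu> \<Longrightarrow> norm (f n y) \<le> 2 * norm y" by auto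
  have "(\<lambda>y. 2 *\<^sub>R norm y) \<in> hilb \<mu>" by (rule hilb_scale) (use id in \<open>auto simp: Lq_def\<close>)
  then have dc: "dom_conv \<mu> f (\<lambda>y. y) (\<lambda>y. 2 * norm y)"
    using f Lq_measurable[OF id] borel_measurable_simple_function[OF f(1)] unfolding dom_conv_def by auto
  have "\<exists>X. X \<in> borel_measurable M \<and> finite (range X) \<and> law M X = law \<mu> (f n)" for n
    by (rule nonatomic_simple_law[OF na \<mu>.prob_space_axioms f(1)])
  then obtain X where X: "\<And>n. X n \<in> borel_measurable M" "\<And>n. finite (range (X n))" "\<And>n. law M (X n) = law \<mu> (f n)"
    by metis
  show ?thesis
  proof (rule regular_field_eqI[OF W V t \<mu> \<mu>.law_P2(1)[OF dom_conv_hilb(1)[OF dc]]])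
    show "W2 (law \<mu> (f n)) \<mu> \<le> sqrt (mom \<mu> 2 (f n - (\<lambda>y. y)))" for n
      using \<mu>.W2_law_le[OF dom_conv_hilb(1)[OF dc] id] by (simp add: law_id[OF \<mu>])
    show "(\<lambda>n. sqrt (mom \<mu> 2 (f n - (\<lambda>y. y)))) \<longlonglongrightarrow> 0"
      using tendsto_real_sqrt[OF dom_conv_mom2_diff[OF dc]] by simp
    show "W t x (law \<mu> (f n)) = V t x (law \<mu> (f n))" for n
    proof -
      obtain b where "X n \<in> hilb M" "\<And>\<omega>. norm (X n \<omega>) \<le> b" using finite_range_hilb[OF X(1,2)] by blast
      from eq_on_bounded_laws[OF na W V t eq this] show ?thesis by (simp add: X(3))
    qed
  qed
qed

lemma brownian_motion_nonatomic:
  assumes "brownian_motion M B"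
  shows nonatomic
proof (rule nonatomicI_continuous_distribution)
  let ?U = "\<lambda>\<omega>. B 1 \<omega> - B 0 \<omega>"
  have "\<forall>s t. 0 \<le> s \<and> s < t \<longrightarrow>
      distributed M lborel (\<lambda>\<omega>. B t \<omega> - B s \<omega>) (normal_density 0 (sqrt (t - s)))"
    using assms unfolding brownian_motion_def by blast
  from this[rule_format, of 0 1] have d: "distributed M lborel ?U (normal_density 0 (sqrt (1 - 0)))" by simp
  show U: "?U \<in> borel_measurable M" using distributed_measurable[OF d] by simp
  show "prob {\<omega>\<in>space M. ?U \<omega> = u} = 0" for u
  proof -
    have "emeasure M {\<omega>\<in>space M. ?U \<omega> = u} = emeasure (distr M lborel ?U) {u}"
      using U by (subst emeasure_distr) (auto intro!: arg_cong[where f="emeasure M"])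
    also have "\<dots> = (\<integral>\<^sup>+x. ennreal (normal_density 0 (sqrt (1 - 0)) x) * indicator {u} x \<partial>lborel)"
      unfolding distributed_distr_eq_density[OF d] by (subst emeasure_density) auto
    also have "\<dots> = (\<integral>\<^sup>+(x::real). 0 \<partial>lborel)"
      by (rule nn_integral_cong_AE, rule eventually_mono[OF AE_lborel_singleton[of u]]) auto
    finally show ?thesis by (simp add: measure_def)
  qed
qed

end

section \<open>Uniqueness and monotonicity\<close>

theorem theorem2p10:
  fixes M :: "'w measure"
    and I :: "'i set"
    and B :: "'i \<Rightarrow> real \<Rightarrow> 'w \<Rightarrow> real"
    and T :: real
    and W0 :: "real ^ 'n \<Rightarrow> (real ^ 'n) measure \<Rightarrow> real ^ 'n"
    and F G :: "real ^ 'n \<Rightarrow> (real ^ 'n) measure \<Rightarrow> real ^ 'n \<Rightarrow> real ^ 'n"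
  assumes "prob_space M"
    and "I \<noteq> {}" and "indep_brownian_motions M I B"
    and "T > 0"
    and "continuous_W2 UNIV W0"
    and "continuous_W2 UNIV (\<lambda>(x, u) \<mu>. F x \<mu> u)"
    and "continuous_W2 UNIV (\<lambda>(x, u) \<mu>. G x \<mu> u)"
    and "\<exists>C. \<forall>x. \<forall>\<mu>\<in>P2. \<forall>u. norm (W0 x \<mu>) + norm (F x \<mu> u) + norm (G x \<mu> u)
           \<le> C * (1 + norm x + norm u + sqrt (E2 \<mu>))"
    and "L2_monotone M W0"
    and "jointly_L2_monotone M F G"
  shows "(\<forall>W W'. monotone_solution M T F G W \<and> has_initial_condition W W0 \<and>
             monotone_solution M T F G W' \<and> has_initial_condition W' W0 \<longrightarrow>
             (\<forall>t\<in>{0..T}. \<forall>x. \<forall>\<mu>\<in>P2. W t x \<mu> = W' t x \<mu>)) \<and>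
         (\<forall>W. monotone_solution M T F G W \<and> has_initial_condition W W0 \<longrightarrow>
             (\<forall>t\<in>{0..T}. L2_monotone M (W t)))"
proof -
  interpret prob_space M by fact
  obtain C0 where C0: "\<And>x \<mu> u. \<mu> \<in> P2 \<Longrightarrow> norm (W0 x \<mu>) + norm (F x \<mu> u) + norm (G x \<mu> u)
      \<le> C0 * (1 + norm x + norm u + sqrt (E2 \<mu>))"
    using assms(8) by blast
  define C where "C = max C0 0"
  have growth: "norm (F x \<mu> u) \<le> C * (1 + norm x + norm u + sqrt (E2 \<mu>))"
    "norm (G x \<mu> u) \<le> C * (1 + norm x + norm u + sqrt (E2 \<mu>))" if "\<mu> \<in> P2" for x \<mu> u
  proof -
    have "C0 * (1 + norm x + norm u + sqrt (E2 \<mu>)) \<le> C * (1 + norm x + norm u + sqrt (E2 \<mu>))"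
      unfolding C_def by (intro mult_right_mono) auto
    then show "norm (F x \<mu> u) \<le> C * (1 + norm x + norm u + sqrt (E2 \<mu>))"
      "norm (G x \<mu> u) \<le> C * (1 + norm x + norm u + sqrt (E2 \<mu>))"
      using C0[OF that, of x u] norm_ge_zero[of "W0 x \<mu>"] norm_ge_zero[of "F x \<mu> u"]
        norm_ge_zero[of "G x \<mu> u"] by linarith+
  qed
  interpret master_equation M T F G C
    by unfold_locales (use assms(4,6,7,10) growth in \<open>auto simp: C_def\<close>)
  obtain i where "i \<in> I" using assms(2) by blast
  then have "brownian_motion M (B i)" using assms(3) by (simp add: indep_brownian_motions_def)
  then have na: nonatomic by (rule brownian_motion_nonatomic)
  have init: "0 \<le> gap M (W 0) (V 0) X Y"
    if "has_initial_condition W W0" "has_initial_condition V W0" "X \<in> hilb M" "Y \<in> hilb M" for W V X Y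
  proof -
    have "lift M (W 0) X = lift M W0 X" "lift M (V 0) Y = lift M W0 Y"
      using that(1,2) law_P2(1)[OF that(3)] law_P2(1)[OF that(4)]
      by (simp_all add: lift_def has_initial_condition_def)
    then show ?thesis using assms(9) that(3,4) by (simp add: gap_def L2_monotone_def)
  qed
  have cross: "0 \<le> gap M (W t) (V t) X Y"
    if "monotone_solution M T F G W" "has_initial_condition W W0"
      "monotone_solution M T F G V" "has_initial_condition V W0"
      "regular_field L T W" "regular_field L T V"
      "t \<in> {0..T}" "X \<in> hilb M" "Y \<in> hilb M" for W V L t X Y
  proof (rule gap_nonneg_extend[OF that(5,6) assms(4) _ that(7-9)])
    show "0 \<le> gap M (W t) (V t) X Y" if "t \<in> {0..<T}" "X \<in> Lq M 4" "Y \<in> Lq M 4" for t X Y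
      by (rule gap_nonneg_L4[OF \<open>monotone_solution M T F G W\<close> \<open>regular_field L T W\<close>
            \<open>monotone_solution M T F G V\<close> \<open>regular_field L T V\<close>
            init[OF \<open>has_initial_condition W W0\<close> \<open>has_initial_condition V W0\<close>] that])
  qed
  show ?thesis
  proof (intro conjI allI impI ballI; (elim conjE)?)
    fix W W' t and x :: "real ^ 'n" and \<mu> :: "(real ^ 'n) measure"
    assume W: "monotone_solution M T F G W" "has_initial_condition W W0"
      and W': "monotone_solution M T F G W'" "has_initial_condition W' W0"
      and t: "t \<in> {0..T}" and \<mu>: "\<mu> \<in> P2"
    obtain L L' where "regular_field L T W" "regular_field L' T W'"
      using monotone_solution_regular[OF W(1)] monotone_solution_regular[OF W'(1)] by metis
    then have R: "regular_field (max L L') T W" "regular_field (max L L') T W'"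
      by (auto intro: regular_field_mono)
    show "W t x \<mu> = W' t x \<mu>"
      by (rule eq_everywhere[OF na R t minty_lift_eq[OF R t cross[OF W W' R t]] \<mu>])
  next
    fix W t assume W: "monotone_solution M T F G W" "has_initial_condition W W0" and t: "t \<in> {0..T}"
    obtain L where R: "regular_field L T W" using monotone_solution_regular[OF W(1)] .
    show "L2_monotone M (W t)"
      unfolding L2_monotone_def using cross[OF W W R R t] by (simp add: gap_def)
  qed
qed

end
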